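(* Let $\lambda$ be a partition and let $\mu=(\mu_1,\ldots,\mu_r)$ be a composition of length $r$ of the same integer $n=|\lambda|=|\mu|$. Then $$\sum_{\eta}K_{\eta\mu}K_{\eta\lambda}(t)=\sum_{\{\nu\}}t^{c(\nu)}\prod_{k=1}^{r-1}\prod_{i\ge 1}\left[\begin{matrix}\nu_i^{(k+1)}-\nu_{i+1}^{(k)}\\ \nu_i^{(k)}-\nu_{i+1}^{(k)}\end{matrix}\right]_t ,$$ where the left-hand sum is over all partitions $\eta$ of $n$, the right-hand sum is over all flags of partitions $\nu=\{\emptyset=\nu^{(0)}\subset\nu^{(1)}\subset\cdots\subset\nu^{(r)}=\lambda'\}$ such that $|\nu^{(k)}|=\mu_1+\cdots+\mu_k$ for $1\le k\le r$, and $$c(\nu)=\sum_{k=0}^{r-1}\sum_{i\ge 1}\binom{\nu_i^{(k+1)}-\nu_i^{(k)}}{2},\qquad \binom{\alpha}{2}:=\frac{\alpha(\alpha-1)}{2}.$$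
   Context: For a partition $\lambda$, $\lambda'$ is the conjugate partition, $|\lambda|$ the sum of its parts, and $\lambda_i=0$ for $i$ larger than the length. The inclusion $\alpha\subset\beta$ of partitions means $\alpha_i\le\beta_i$ for all $i$ (equality allowed). $K_{\eta\lambda}(t)$ is the Kostka–Foulkes polynomial, defined by $s_\eta(x)=\sum_\lambda K_{\eta\lambda}(t)P_\lambda(x;t)$, where $s_\eta$ is the Schur function and $P_\lambda(x;t)$ the Hall–Littlewood symmetric function. For a composition $\mu$, $K_{\eta\mu}$ is the Kostka number, i.e. the number of semistandard Young tableaux of shape $\eta$ and weight (content) $\mu$. The $t$-binomial coefficient is $\left[\begin{matrix}N\\ m\end{matrix}\right]_t=\frac{(t;t)_N}{(t;t)_m(t;t)_{N-m}}$ for $0\le m\le N$ and $0$ otherwise, with $(t;t)_m=\prod_{j=1}^m(1-t^j)$. *)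

theory Defs
  imports
    "HOL-Library.Poly_Mapping"
    "HOL-Library.FuncSet"
    "HOL-Combinatorics.Permutations"
    "HOL-Computational_Algebra.Polynomial_Factorial"
    "Jordan_Normal_Form.Determinant"
begin

section \<open>Partitions\<close>

text \<open>
  A partition is the infinite sequence of its parts, indexed from 0: the part usually written
  \<open>\<lambda>\<^sub>i\<close> (with \<open>i \<ge> 1\<close>) is \<open>p (i - 1)\<close>.  Inclusion of partitions is the pointwise order \<open>\<le>\<close> on
  functions, and the empty partition is \<open>\<lambda>_. 0\<close>.  Sums and products over all \<open>i \<ge> 1\<close> are
  \<^const>\<open>Sum_any\<close> and \<^const>\<open>Prod_any\<close>, which are meaningful here since only finitely many
  terms (factors) differ from 0 (from 1).
\<close>

type_synonym seq = "nat \<Rightarrow> nat"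

definition is_partition :: "seq \<Rightarrow> bool" where
  "is_partition p \<longleftrightarrow> antimono p \<and> finite {i. p i \<noteq> 0}"

definition psize :: "seq \<Rightarrow> nat" where
  "psize p = Sum_any p"

definition partitions_of :: "nat \<Rightarrow> seq set" where
  "partitions_of n = {p. is_partition p \<and> psize p = n}"

definition conjugate :: "seq \<Rightarrow> seq" where
  "conjugate p = (\<lambda>i. card {j. i < p j})"

section \<open>Kostka numbers\<close>

definition diagram :: "seq \<Rightarrow> (nat \<times> nat) set" where
  "diagram p = {(i, j). j < p i}"

text \<open>
  The weight \<open>\<mu>\<close> is a list; the entries of a tableau are positions in it, so that the letter
  \<open>k\<close> (with \<open>1 \<le> k \<le> r\<close>) appears here as \<open>k - 1\<close>.
\<close>

definition ssyt :: "seq \<Rightarrow> nat list \<Rightarrow> (nat \<times> nat \<Rightarrow> nat) set" where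
  "ssyt p \<mu> = {T \<in> diagram p \<rightarrow>\<^sub>E {..<length \<mu>}.
     (\<forall>i j j'. j < j' \<and> (i, j') \<in> diagram p \<longrightarrow> T (i, j) \<le> T (i, j')) \<and>
     (\<forall>i i' j. i < i' \<and> (i', j) \<in> diagram p \<longrightarrow> T (i, j) < T (i', j)) \<and>
     (\<forall>k<length \<mu>. card {c \<in> diagram p. T c = k} = \<mu> ! k)}"

definition kostka :: "seq \<Rightarrow> nat list \<Rightarrow> nat" where
  "kostka p \<mu> = card (ssyt p \<mu>)"

section \<open>Schur and Hall--Littlewood functions in finitely many variables\<close>

text \<open>
  The Schur function of \<open>x 0, \<dots>, x (N - 1)\<close> as the ratio of alternants
  \<open>det (x\<^sub>i ^ (\<lambda>\<^sub>j + N - j)) / det (x\<^sub>i ^ (N - j))\<close>.  The condition \<open>p N = 0\<close> says that the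
  length of \<open>p\<close> is at most \<open>N\<close>.
\<close>

definition schur :: "nat \<Rightarrow> (nat \<Rightarrow> 'a::field) \<Rightarrow> seq \<Rightarrow> 'a" where
  "schur N x p =
     (if p N = 0 then
        det (mat N N (\<lambda>(i, j). x i ^ (p j + (N - 1 - j)))) /
        det (mat N N (\<lambda>(i, j). x i ^ (N - 1 - j)))
      else 0)"

definition hl_v :: "'a::field \<Rightarrow> nat \<Rightarrow> 'a" where
  "hl_v t m = (\<Prod>i=1..m. (1 - t ^ i) / (1 - t))"

text \<open>
  \<open>v\<^sub>\<lambda>(t)\<close> is the product over all \<open>a \<ge> 0\<close> of \<open>v\<^sub>m(t)\<close>, where \<open>m\<close> is the multiplicity of \<open>a\<close>
  among the first \<open>N\<close> parts; the part \<open>a = 0\<close> is included and has multiplicity \<open>N - \<ell>(\<lambda>)\<close>.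
\<close>

definition hl_norm :: "nat \<Rightarrow> 'a::field \<Rightarrow> seq \<Rightarrow> 'a" where
  "hl_norm N t p = Prod_any (\<lambda>a. hl_v t (card {j. j < N \<and> p j = a}))"

definition hall_littlewood :: "nat \<Rightarrow> (nat \<Rightarrow> 'a::field) \<Rightarrow> 'a \<Rightarrow> seq \<Rightarrow> 'a" where
  "hall_littlewood N x t p =
     (if p N = 0 then
        (\<Sum>w | w permutes {..<N}.
           (\<Prod>i<N. x (w i) ^ p i) *
           (\<Prod>(i, j) | i < j \<and> j < N. (x (w i) - t * x (w j)) / (x (w i) - x (w j))))
        / hl_norm N t p
      else 0)"

section \<open>Kostka--Foulkes polynomials\<close>

text \<open>
  The field of fractions of \<open>\<int>[t][x\<^sub>0, x\<^sub>1, \<dots>]\<close>.  A monomial in the \<open>x\<^sub>i\<close> is its exponent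
  vector, of type \<open>nat \<Rightarrow>\<^sub>0 nat\<close>, and \<open>\<int>[t]\<close> is \<open>int poly\<close>.
\<close>

type_synonym rat_fun = "((nat \<Rightarrow>\<^sub>0 nat) \<Rightarrow>\<^sub>0 int poly) fract"

definition scalar :: "int poly \<Rightarrow> rat_fun" where
  "scalar c = to_fract (Poly_Mapping.single 0 c)"

definition var_x :: "nat \<Rightarrow> rat_fun" where
  "var_x i = to_fract (Poly_Mapping.single (Poly_Mapping.single i 1) 1)"

definition var_t :: "int poly" where
  "var_t = [:0, 1:]"

text \<open>
  \<open>K\<close> is the family of coefficients in the expansion of the symmetric function \<open>s\<^sub>p\<close> on the
  functions \<open>P\<^sub>q(x;t)\<close>.  A symmetric function in infinitely many variables is the compatible
  family of its restrictions to \<open>x\<^sub>0, \<dots>, x\<^bsub>N-1\<^esub>\<close>, so an identity between such functions is an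
  identity for every \<open>N\<close>.
\<close>

definition hl_expansion :: "seq \<Rightarrow> (seq \<Rightarrow>\<^sub>0 int poly) \<Rightarrow> bool" where
  "hl_expansion p K \<longleftrightarrow>
     Poly_Mapping.keys K \<subseteq> {q. is_partition q} \<and>
     (\<forall>N. schur N var_x p =
        (\<Sum>q\<in>Poly_Mapping.keys K.
           scalar (Poly_Mapping.lookup K q) * hall_littlewood N var_x (scalar var_t) q))"

definition kostka_foulkes :: "seq \<Rightarrow> seq \<Rightarrow> int poly" where
  "kostka_foulkes p q = Poly_Mapping.lookup (THE K. hl_expansion p K) q"

section \<open>Binomial coefficients and flags\<close>

definition t_poch :: "nat \<Rightarrow> int poly" where
  "t_poch m = (\<Prod>j=1..m. (1 - var_t ^ j))"

text \<open>The division is exact in \<open>\<int>[t]\<close>.\<close>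

definition t_binomial :: "nat \<Rightarrow> nat \<Rightarrow> int poly" where
  "t_binomial N m = (if m \<le> N then t_poch N div (t_poch m * t_poch (N - m)) else 0)"

definition flags :: "seq \<Rightarrow> nat list \<Rightarrow> seq list set" where
  "flags p \<mu> = {\<nu>. length \<nu> = length \<mu> + 1 \<and>
     (\<forall>k\<le>length \<mu>. is_partition (\<nu> ! k)) \<and>
     \<nu> ! 0 = (\<lambda>_. 0) \<and> \<nu> ! length \<mu> = conjugate p \<and>
     (\<forall>k<length \<mu>. \<nu> ! k \<le> \<nu> ! (k + 1)) \<and>
     (\<forall>k\<in>{1..length \<mu>}. psize (\<nu> ! k) = (\<Sum>j<k. \<mu> ! j))}"

definition flag_exponent :: "nat \<Rightarrow> seq list \<Rightarrow> nat" where
  "flag_exponent r \<nu> = (\<Sum>k<r. Sum_any (\<lambda>i. ((\<nu> ! (k + 1)) i - (\<nu> ! k) i) choose 2))"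

end

theory Submission
  imports Defs
begin

text \<open>
  Both sides are the coefficient of \<open>P\<^sub>\<lambda>\<close> in the product \<open>h\<^sub>\<mu>\<close> of the complete symmetric functions \<open>h\<^sub>m\<close> for
  the entries \<open>m\<close> of \<open>\<mu>\<close>.  Expanding \<open>h\<^sub>\<mu>\<close> in Schur functions, and these in Hall--Littlewood functions,
  gives the left-hand side; multiplying \<open>P\<^sub>\<emptyset> = 1\<close> by one \<open>h\<^sub>m\<close> after the other, using the Pieri rule for
  \<open>h\<^sub>m P\<^sub>\<nu>\<close>, gives the right-hand side.  The Pieri rule for \<open>e\<^sub>r P\<^sub>\<nu>\<close> comes from the straightening relation
  \<open>R\<^bsub>(\<dots>,a,a+1,\<dots>)\<^esub> = t R\<^bsub>(\<dots>,a+1,a,\<dots>)\<^esub>\<close> between symmetrized monomials, and the one for \<open>h\<^sub>m P\<^sub>\<nu>\<close> from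
  the one for \<open>e\<^sub>r P\<^sub>\<nu>\<close> by inverting \<open>\<Sum> (-1)\<^sup>i e\<^sub>i h\<^bsub>m-i\<^esub> = 0\<close>.  Schur functions are the case \<open>t = 0\<close>.
  Comparing leading monomials modulo \<open>t\<close> shows that the coefficients are unique.
\<close>

section \<open>Gaussian binomial coefficients\<close>

text \<open>The straightening relation only exchanges neighbouring exponents that differ by one.
  This decides that \<open>e_r\<close> comes before \<open>h_m\<close>: \<open>e_r\<close> adds 0 or
  1 to each exponent, so disorder arises only inside a block of equal parts and only in the form
  that the relation repairs, while \<open>h_m\<close> adds arbitrary amounts. Shapes are recorded by
  column lengths because these are the end points of the blocks of equal parts. Pieri coefficients
  then factor over columns, and chains of shapes built by \<open>h_m\<close> are literally the flags
  that end in the conjugate of \<open>lam\<close>. Identities are proved in \<open>N\<close>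
  variables, with coefficients independent of \<open>N\<close>; functions of partitions with more
  than \<open>N\<close> parts are 0. Since \<open>kostka_foulkes\<close> is a definite description
  with values in Z[t], an expansion with polynomial coefficients has to exist; linear algebra over
  the fraction field would not give one. It comes from solving \<open>h_m s_d = s_c + ...\<close>
  for \<open>s_c\<close>, as multiplication by \<open>h_m\<close> keeps the coefficients in Z[t].
  For uniqueness a comparison modulo t yields divisibility by t only, so it is repeated for the
  quotients.\<close>

fun gauss_binom :: "'a::comm_ring_1 \<Rightarrow> nat \<Rightarrow> nat \<Rightarrow> 'a" where
  "gauss_binom t n 0 = 1"
| "gauss_binom t 0 (Suc k) = 0"
| "gauss_binom t (Suc n) (Suc k) = gauss_binom t n (Suc k) + t ^ (n - k) * gauss_binom t n k"

definition qpoch :: "'a::comm_ring_1 \<Rightarrow> nat \<Rightarrow> 'a" where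
  "qpoch t m = (\<Prod>j=1..m. (1 - t ^ j))"

lemma qpoch_0 [simp]: "qpoch t 0 = 1"
  and qpoch_Suc: "qpoch t (Suc m) = qpoch t m * (1 - t ^ Suc m)"
  by (simp_all add: qpoch_def)

lemma gauss_binom_eq_0: "n < k \<Longrightarrow> gauss_binom t n k = 0"
proof (induction n arbitrary: k)
  case 0
  then show ?case by (cases k) auto
next
  case (Suc n)
  then show ?case by (cases k) auto
qed

lemma gauss_binom_self [simp]: "gauss_binom t n n = 1"
  by (induction n) (auto simp: gauss_binom_eq_0)

text \<open>The two Pascal terms contribute \<open>1 - t ^ (n - j)\<close> and
  \<open>t ^ (n - j) * (1 - t ^ Suc j)\<close>, which add up to \<open>1 - t ^ Suc n\<close>. The
  form without division makes sense in \<open>int poly\<close>, where the binomials of the theorem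
  live, as well as in fields.\<close>

lemma gauss_binom_qpoch:
  "k \<le> n \<Longrightarrow> gauss_binom t n k * (qpoch t k * qpoch t (n - k)) = qpoch t n"
proof (induction n arbitrary: k)
  case 0
  then show ?case by simp
next
  case (Suc n)
  show ?case
  proof (cases k)
    case 0
    then show ?thesis by simp
  next
    case (Suc j)
    show ?thesis
    proof (cases "j = n")
      case True
      then show ?thesis using Suc by simp
    next
      case False
      then have jn: "j < n" using Suc Suc.prems by simp
      have d: "n - j = Suc (n - Suc j)" using jn by simp
      have 1: "gauss_binom t n (Suc j) * (qpoch t (Suc j) * qpoch t (n - Suc j)) = qpoch t n"
        using Suc.IH[of "Suc j"] jn by simp
      have 2: "gauss_binom t n j * (qpoch t j * qpoch t (n - j)) = qpoch t n"
        using Suc.IH[of j] jn by simp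
      have "gauss_binom t (Suc n) (Suc j) * (qpoch t (Suc j) * qpoch t (Suc n - Suc j))
          = gauss_binom t n (Suc j) * (qpoch t (Suc j) * qpoch t (n - j)) +
            t ^ (n - j) * (gauss_binom t n j * (qpoch t j * qpoch t (n - j))) * (1 - t ^ Suc j)"
        by (simp add: algebra_simps qpoch_Suc)
      also have "gauss_binom t n (Suc j) * (qpoch t (Suc j) * qpoch t (n - j))
          = qpoch t n * (1 - t ^ (n - j))"
        unfolding d qpoch_Suc[of t "n - Suc j"]
        using 1 by (metis (no_types, lifting) mult.assoc)
      also have "t ^ (n - j) * (gauss_binom t n j * (qpoch t j * qpoch t (n - j))) * (1 - t ^ Suc j)
          = t ^ (n - j) * qpoch t n * (1 - t ^ Suc j)"
        by (simp only: 2)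
      also have "qpoch t n * (1 - t ^ (n - j)) + t ^ (n - j) * qpoch t n * (1 - t ^ Suc j)
          = qpoch t n * (1 - t ^ ((n - j) + Suc j))"
        unfolding power_add by (simp add: algebra_simps)
      also have "(n - j) + Suc j = Suc n" using jn by simp
      finally show ?thesis using Suc by (simp add: qpoch_Suc)
    qed
  qed
qed

lemma gauss_binom_zero: "gauss_binom (0::'a::comm_ring_1) n k = (if k \<le> n then 1 else 0)"
proof (induction n arbitrary: k)
  case 0
  then show ?case by (cases k) auto
next
  case (Suc n)
  then show ?case by (cases k) (auto simp: power_0_left)
qed

lemma gauss_binom_hom:
  assumes "f 1 = 1" "f 0 = 0" "\<And>a b. f (a + b) = f a + f b" "\<And>a b. f (a * b) = f a * f b"
  shows "f (gauss_binom t n k) = gauss_binom (f t) n k"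
proof -
  have p: "f (a ^ m) = f a ^ m" for a m by (induction m) (auto simp: assms)
  show ?thesis
    by (induction t n k rule: gauss_binom.induct) (auto simp: assms p)
qed

text \<open>The condition makes every \<open>qpoch t m\<close> invertible. It holds for the
  indeterminate and for \<open>t = 0\<close>, the two values at which the locale is used.\<close>

locale not_root_of_unity =
  fixes t :: "'a::field"
  assumes power_neq_1: "\<And>i. i > 0 \<Longrightarrow> t ^ i \<noteq> 1"
begin

lemma qpoch_nz: "qpoch t m \<noteq> 0"
  using power_neq_1 by (auto simp: qpoch_def)

lemma gauss_binom_eq:
  "k \<le> n \<Longrightarrow> gauss_binom t n k = qpoch t n / (qpoch t k * qpoch t (n - k))"
  using gauss_binom_qpoch[of k n t] qpoch_nz by (simp add: field_simps)

text \<open>Both sides are \<open>qpoch t (a - k)\<close> divided by the product of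
  \<open>qpoch\<close> at \<open>a - b\<close>, \<open>b - c\<close> and \<open>c - k\<close>. It
  separates the dependence on \<open>b\<close> from that on \<open>k\<close>, which correspond to
  different coordinates when the Pieri coefficients are inverted.\<close>

lemma gauss_binom_trinomial_revision:
  assumes "c \<le> b" "b \<le> a" "k \<le> c"
  shows "gauss_binom t (a - k) (b - k) * gauss_binom t (b - k) (b - c)
       = gauss_binom t (a - k) (c - k) * gauss_binom t (a - c) (b - c)"
  using assms qpoch_nz by (simp add: gauss_binom_eq field_simps)

text \<open>This is the other Pascal recursion. It follows because the coefficients at
  \<open>Suc k\<close> and \<open>k\<close> differ by the factor
  \<open>(1 - t ^ (n - k)) / (1 - t ^ Suc k)\<close>, so the defining recursion can be
  rewritten.\<close>

lemma gauss_binom_Suc': "gauss_binom t (Suc n) (Suc k)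
   = t ^ Suc k * gauss_binom t n (Suc k) + gauss_binom t n k"
proof (cases "Suc k \<le> n")
  case True
  define d where "d = n - Suc k"
  have n: "n = Suc (d + k)" using True by (simp add: d_def)
  have nk: "n - k = Suc d" using n by simp
  have "gauss_binom t n (Suc k) * (qpoch t (Suc k) * qpoch t d)
      = gauss_binom t n k * (qpoch t k * qpoch t (Suc d))"
    using gauss_binom_qpoch[of "Suc k" n t] gauss_binom_qpoch[of k n t] True
    by (simp add: nk flip: d_def)
  then have "(gauss_binom t n (Suc k) * (1 - t ^ Suc k)) * (qpoch t k * qpoch t d)
      = (gauss_binom t n k * (1 - t ^ Suc d)) * (qpoch t k * qpoch t d)"
    by (simp only: qpoch_Suc ac_simps)
  then have "gauss_binom t n (Suc k) * (1 - t ^ Suc k) = gauss_binom t n k * (1 - t ^ Suc d)"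
    using qpoch_nz by simp
  then show ?thesis by (simp add: algebra_simps nk)
next
  case False
  then show ?thesis by (cases "k = n") (auto simp: gauss_binom_eq_0)
qed

text \<open>The sum is the product of \<open>t ^ i - 1\<close> over \<open>i < d\<close>, up to sign
  the q-binomial theorem at -1, and the factor for \<open>i = 0\<close> vanishes. The second Pascal
  recursion brings out these factors one at a time.\<close>

lemma gauss_binom_alternating_sum:
  "(\<Sum>j\<le>d. (-1) ^ j * t ^ ((d - j) choose 2) * gauss_binom t d j) = (if d = 0 then 1 else 0)"
proof -
  define A where "A d = (\<Sum>j\<le>d. (-1) ^ j * t ^ ((d - j) choose 2) * gauss_binom t d j)" for d
  have rec: "A (Suc d) = (t ^ d - 1) * A d" for d
  proof -
    have "A (Suc d) = t ^ (Suc d choose 2) +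
      (\<Sum>j\<le>d. (-1) ^ Suc j * t ^ ((d - j) choose 2) * gauss_binom t (Suc d) (Suc j))"
      unfolding A_def sum.atMost_Suc_shift by simp
    also have "\<dots> = t ^ (Suc d choose 2) +
      (\<Sum>j\<le>d. (-1) ^ Suc j * t ^ ((d - j) choose 2) * t ^ Suc j * gauss_binom t d (Suc j)) - A d"
      unfolding A_def gauss_binom_Suc' by (simp add: algebra_simps sum.distrib sum_negf sum_subtractf)
    also have "t ^ (Suc d choose 2) +
      (\<Sum>j\<le>d. (-1) ^ Suc j * t ^ ((d - j) choose 2) * t ^ Suc j * gauss_binom t d (Suc j))
      = (\<Sum>j\<le>Suc d. (-1) ^ j * t ^ ((Suc d - j) choose 2) * t ^ j * gauss_binom t d j)"
      unfolding sum.atMost_Suc_shift by simp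
    also have "\<dots> = (\<Sum>j\<le>d. (-1) ^ j * t ^ ((Suc d - j) choose 2) * t ^ j * gauss_binom t d j)"
      by (simp add: gauss_binom_eq_0)
    also have "\<dots> = (\<Sum>j\<le>d. t ^ d * ((-1) ^ j * t ^ ((d - j) choose 2) * gauss_binom t d j))"
    proof (rule sum.cong)
      fix j assume "j \<in> {..d}"
      then have *: "((Suc d - j) choose 2) + j = d + ((d - j) choose 2)"
        by (simp add: Suc_diff_le numeral_2_eq_2)
      have "t ^ ((Suc d - j) choose 2) * t ^ j = t ^ d * t ^ ((d - j) choose 2)"
        by (metis * power_add)
      then show "(-1) ^ j * t ^ ((Suc d - j) choose 2) * t ^ j * gauss_binom t d j =
         t ^ d * ((-1) ^ j * t ^ ((d - j) choose 2) * gauss_binom t d j)"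
        by (simp add: mult.assoc mult.left_commute)
    qed simp
    also have "\<dots> = t ^ d * A d" by (simp add: A_def sum_distrib_left)
    finally show ?thesis by (simp add: algebra_simps)
  qed
  have "A 1 = 0" by (simp add: rec[of 0, simplified])
  then have "A (Suc d) = 0" for d by (induction d) (auto simp: rec)
  moreover have "A 0 = 1" by (simp add: A_def numeral_2_eq_2)
  ultimately have "A d = (if d = 0 then 1 else 0)" by (cases d) auto
  then show ?thesis by (simp add: A_def)
qed

end

text \<open>The \<open>div\<close> is exact because the recursion exhibits the quotient as a
  polynomial. The divisor can be cancelled since \<open>t_poch\<close> has constant term 1.\<close>

lemma t_binomial_eq_gauss_binom: "t_binomial N m = gauss_binom var_t N m"
proof (cases "m \<le> N")
  case True
  have e: "t_poch = qpoch var_t" by (simp add: fun_eq_iff t_poch_def qpoch_def)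
  have nz: "t_poch k \<noteq> 0" for k
  proof -
    have "poly (t_poch k) 0 = 1"
      by (auto simp: t_poch_def poly_prod var_t_def power_0_left intro!: prod.neutral)
    then show ?thesis by auto
  qed
  show ?thesis
    using gauss_binom_qpoch[OF True, of var_t] True nz
    unfolding t_binomial_def e[symmetric]
    by (metis mult_eq_0_iff nonzero_mult_div_cancel_right)
next
  case False
  then show ?thesis by (simp add: t_binomial_def gauss_binom_eq_0)
qed

section \<open>Boxes of integer sequences\<close>

definition Box :: "seq \<Rightarrow> seq \<Rightarrow> seq set" where
  "Box c u = {k. c \<le> k \<and> k \<le> u}"

lemma finite_Box:
  assumes "finite {i. u i \<noteq> 0}"
  shows "finite (Box c u)"
proof (rule finite_subset)
  let ?B = "\<Union>i\<in>{i. u i \<noteq> 0}. {..u i}"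
  show "Box c u \<subseteq> {f. \<forall>x. (x \<in> {i. u i \<noteq> 0} \<longrightarrow> f x \<in> ?B) \<and> (x \<notin> {i. u i \<noteq> 0} \<longrightarrow> f x = 0)}"
    by (auto simp: Box_def le_fun_def) (metis le_zero_eq)
  show "finite {f. \<forall>x. (x \<in> {i. u i \<noteq> 0} \<longrightarrow> f x \<in> ?B) \<and> (x \<notin> {i. u i \<noteq> 0} \<longrightarrow> f x = 0)}"
    using assms by (intro finite_set_of_finite_funs) auto
qed

text \<open>Freezing coordinate \<open>b\<close> at its lowest value leaves a box again, so
  coordinates can be summed one at a time while the index stays a sequence.\<close>

lemma sum_Box_split:
  fixes h :: "seq \<Rightarrow> 'a::comm_monoid_add"
  assumes "c b \<le> u b"
  shows "(\<Sum>k\<in>Box c u. h k) = (\<Sum>k\<in>Box c (u(b := c b)). \<Sum>v\<in>{c b..u b}. h (k(b := v)))"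
proof -
  have "Box c u = (\<lambda>(k, v). k(b := v)) ` (Box c (u(b := c b)) \<times> {c b..u b})" (is "_ = ?f ` ?A")
  proof (intro equalityI subsetI)
    fix k assume k: "k \<in> Box c u"
    then have "(k(b := c b), k b) \<in> ?A" by (auto simp: Box_def le_fun_def)
    moreover have "k = ?f (k(b := c b), k b)" by simp
    ultimately show "k \<in> ?f ` ?A" by blast
  next
    fix k assume "k \<in> ?f ` ?A"
    then show "k \<in> Box c u" using assms by (auto simp: Box_def le_fun_def split: if_splits)
  qed
  moreover have "inj_on ?f ?A"
  proof (rule inj_onI, clarify)
    fix k v k' v'
    assume "k \<in> Box c (u(b := c b))" "k' \<in> Box c (u(b := c b))"
      and e: "k(b := v) = k'(b := v')"
    then have "k b = k' b" by (auto simp: Box_def le_fun_def intro: order_antisym dest!: spec[of _ b])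
    then have "k i = k' i" for i using fun_cong[OF e, of i] by (cases "i = b") auto
    with fun_cong[OF e, of b] show "k = k' \<and> v = v'" by auto
  qed
  ultimately show ?thesis
    by (simp add: sum.cartesian_product sum.reindex case_prod_unfold)
qed

section \<open>Symmetrized monomials\<close>

definition pairs :: "nat \<Rightarrow> (nat \<times> nat) set" where
  "pairs N = {(i, j). i < j \<and> j < N}"

definition hl_sym :: "nat \<Rightarrow> (nat \<Rightarrow> 'a::field) \<Rightarrow> 'a \<Rightarrow> seq \<Rightarrow> 'a" where
  "hl_sym N x t \<alpha> = (\<Sum>w | w permutes {..<N}. (\<Prod>i<N. x (w i) ^ \<alpha> i) *
     (\<Prod>(i, j)\<in>pairs N. (x (w i) - t * x (w j)) / (x (w i) - x (w j))))"

lemma finite_pairs [simp]: "finite (pairs N)"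
  by (rule finite_subset[of _ "{..<N} \<times> {..<N}"]) (auto simp: pairs_def)

lemma hl_sym_cong: "(\<And>i. i < N \<Longrightarrow> \<alpha> i = \<beta> i) \<Longrightarrow> hl_sym N x t \<alpha> = hl_sym N x t \<beta>"
  unfolding hl_sym_def by (intro sum.cong arg_cong2[where f = "(*)"] prod.cong) auto

text \<open>Grouping \<open>w\<close> with its composite with an adjacent transposition reduces
  straightening to a computation in two variables. The condition \<open>w i < w (Suc i)\<close>
  picks one permutation from each pair.\<close>

lemma sum_permutes_transpose:
  fixes f :: "(nat \<Rightarrow> nat) \<Rightarrow> 'a::comm_monoid_add"
  assumes "Suc i < N"
  shows "(\<Sum>w | w permutes {..<N}. f w) =
    (\<Sum>w | w permutes {..<N} \<and> w i < w (Suc i). f w + f (w \<circ> transpose i (Suc i)))"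
proof -
  let ?s = "transpose i (Suc i)"
  have s: "?s permutes {..<N}" using assms by (intro permutes_swap_id) auto
  have fin: "finite {w. w permutes {..<N}}" by (simp add: finite_permutations)
  have ne: "w i \<noteq> w (Suc i)" if "w permutes {..<N}" for w
    using permutes_inj[OF that] by (metis injD n_not_Suc_n)
  have "{w. w permutes {..<N}} = {w. w permutes {..<N} \<and> w i < w (Suc i)} \<union>
      {w. w permutes {..<N} \<and> w (Suc i) < w i}"
    using ne by (auto simp: less_le)
  then have "(\<Sum>w | w permutes {..<N}. f w) =
      sum f ({w. w permutes {..<N} \<and> w i < w (Suc i)} \<union> {w. w permutes {..<N} \<and> w (Suc i) < w i})"
    by (rule arg_cong)
  also have "\<dots> = (\<Sum>w | w permutes {..<N} \<and> w i < w (Suc i). f w) +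
      (\<Sum>w | w permutes {..<N} \<and> w (Suc i) < w i. f w)"
    by (rule sum.union_disjoint) (auto intro: finite_subset[OF _ fin])
  also have "(\<Sum>w | w permutes {..<N} \<and> w (Suc i) < w i. f w) =
      (\<Sum>w | w permutes {..<N} \<and> w i < w (Suc i). f (w \<circ> ?s))"
    by (rule sum.reindex_bij_witness[where i = "\<lambda>w. w \<circ> ?s" and j = "\<lambda>w. w \<circ> ?s"])
      (auto simp: comp_assoc permutes_compose[OF s])
  finally show ?thesis by (simp add: sum.distrib)
qed

text \<open>For two variables this is the computation
  \<open>b (a - t b) - a (b - t a) = t (a\<^sup>2 - b\<^sup>2)\<close>; the remaining factors are invariant
  under exchanging the two variables.\<close>

lemma hl_sym_straighten:
  assumes inj: "inj x" and i: "Suc i < N" and a: "\<alpha> (Suc i) = Suc (\<alpha> i)"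
  shows "hl_sym N x t \<alpha> = t * hl_sym N x t (\<alpha>(i := Suc (\<alpha> i), Suc i := \<alpha> i))"
proof -
  let ?s = "transpose i (Suc i)"
  let ?\<beta> = "\<alpha>(i := Suc (\<alpha> i), Suc i := \<alpha> i)"
  let ?Q = "pairs N - {(i, Suc i)}"
  define \<phi> where "\<phi> w = (\<lambda>(j, k). (x (w j) - t * x (w k)) / (x (w j) - x (w k)))" for w :: "nat \<Rightarrow> nat"
  define C where "C w = (\<Prod>p\<in>?Q. \<phi> w p)" for w
  define M where "M w = (\<Prod>j\<in>{..<N} - {i, Suc i}. x (w j) ^ \<alpha> j)" for w :: "nat \<Rightarrow> nat"
  define T where "T \<gamma> w = (\<Prod>j<N. x (w j) ^ \<gamma> j) * (\<Prod>p\<in>pairs N. \<phi> w p)" for \<gamma> w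
  have T: "T \<gamma> w = x (w i) ^ \<gamma> i * x (w (Suc i)) ^ \<gamma> (Suc i) * \<phi> w (i, Suc i) * (M w * C w)"
    if "\<And>j. j \<noteq> i \<Longrightarrow> j \<noteq> Suc i \<Longrightarrow> \<gamma> j = \<alpha> j" for \<gamma> w
  proof -
    have 1: "(\<Prod>p\<in>pairs N. \<phi> w p) = \<phi> w (i, Suc i) * C w"
      unfolding C_def by (rule prod.remove[OF finite_pairs]) (use i in \<open>auto simp: pairs_def\<close>)
    have "(\<Prod>j<N. x (w j) ^ \<gamma> j) = x (w i) ^ \<gamma> i * (\<Prod>j\<in>{..<N} - {i}. x (w j) ^ \<gamma> j)"
      by (rule prod.remove) (use i in auto)
    also have "(\<Prod>j\<in>{..<N} - {i}. x (w j) ^ \<gamma> j) =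
      x (w (Suc i)) ^ \<gamma> (Suc i) * (\<Prod>j\<in>{..<N} - {i} - {Suc i}. x (w j) ^ \<gamma> j)"
      by (rule prod.remove) (use i in auto)
    also have "(\<Prod>j\<in>{..<N} - {i} - {Suc i}. x (w j) ^ \<gamma> j) = M w"
      unfolding M_def by (rule prod.cong) (use that in auto)
    finally show ?thesis unfolding T_def 1 by (simp add: mult_ac)
  qed
  have M: "M (w \<circ> ?s) = M w" for w
    unfolding M_def by (rule prod.cong) (auto simp: transpose_def)
  have C: "C (w \<circ> ?s) = C w" for w
    unfolding C_def
    by (rule prod.reindex_bij_witness[where i = "\<lambda>(j, k). (?s j, ?s k)" and j = "\<lambda>(j, k). (?s j, ?s k)"])
      (use i in \<open>auto simp: pairs_def \<phi>_def transpose_def split: if_splits\<close>)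
  have pair: "T \<alpha> w + T \<alpha> (w \<circ> ?s) = t * (T ?\<beta> w + T ?\<beta> (w \<circ> ?s))" if "w i < w (Suc i)" for w
  proof -
    have ne: "x (w i) \<noteq> x (w (Suc i))" using that inj by (metis injD less_irrefl)
    have fin: "a ^ m * b ^ Suc m * ((a - t * b) / (a - b)) * K + b ^ m * a ^ Suc m * ((b - t * a) / (b - a)) * K
      = t * (a ^ Suc m * b ^ m * ((a - t * b) / (a - b)) * K + b ^ Suc m * a ^ m * ((b - t * a) / (b - a)) * K)"
      if "a \<noteq> b" for a b K :: 'a and m
    proof -
      have r: "(b - t * a) / (b - a) = (t * a - b) / (a - b)"
        by (metis minus_diff_eq minus_divide_divide)
      have "(b * (a - t * b) + a * (t * a - b)) / (a - b) = t * (a + b)"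
        using that by (simp add: field_simps)
      moreover have "(a * (a - t * b) + b * (t * a - b)) / (a - b) = a + b"
        using that by (simp add: field_simps)
      ultimately have e: "b * ((a - t * b) / (a - b)) + a * ((t * a - b) / (a - b)) =
         t * (a * ((a - t * b) / (a - b)) + b * ((t * a - b) / (a - b)))"
        by (simp add: add_divide_distrib)
      have "a ^ m * b ^ Suc m * X * K + b ^ m * a ^ Suc m * Y * K = a ^ m * b ^ m * K * (b * X + a * Y)"
        "a ^ Suc m * b ^ m * X * K + b ^ Suc m * a ^ m * Y * K = a ^ m * b ^ m * K * (a * X + b * Y)" for X Y
        by (simp_all add: algebra_simps)
      then show ?thesis unfolding r by (simp only: e mult.left_commute)
    qed
    show ?thesis
      using fin[OF ne, of "\<alpha> i" "M w * C w"]
      by (simp add: T M C \<phi>_def a)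
  qed
  have "hl_sym N x t \<alpha> = (\<Sum>w | w permutes {..<N}. T \<alpha> w)"
    by (simp add: hl_sym_def T_def \<phi>_def)
  also have "\<dots> = (\<Sum>w | w permutes {..<N} \<and> w i < w (Suc i). t * (T ?\<beta> w + T ?\<beta> (w \<circ> ?s)))"
    unfolding sum_permutes_transpose[OF i] by (rule sum.cong) (simp_all add: pair)
  also have "\<dots> = t * (\<Sum>w | w permutes {..<N}. T ?\<beta> w)"
    unfolding sum_permutes_transpose[OF i] by (rule sum_distrib_left[symmetric])
  also have "(\<Sum>w | w permutes {..<N}. T ?\<beta> w) = hl_sym N x t ?\<beta>"
    unfolding hl_sym_def T_def \<phi>_def ..
  finally show ?thesis .
qed

definition bump :: "seq \<Rightarrow> nat set \<Rightarrow> seq" where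
  "bump \<alpha> S = (\<lambda>i. \<alpha> i + of_bool (i \<in> S))"

text \<open>The size condition is an indicator, so that the index set is a full power set; this
  splits as a product over blocks of rows.\<close>

definition esym :: "nat \<Rightarrow> (nat \<Rightarrow> 'a::comm_semiring_1) \<Rightarrow> nat \<Rightarrow> 'a" where
  "esym N x r = (\<Sum>S\<in>Pow {..<N}. of_bool (card S = r) * (\<Prod>i\<in>S. x i))"

text \<open>The factor \<open>esym\<close> is symmetric, so in the summand of \<open>w\<close> it
  may be written in the permuted variables. There each of its monomials raises the exponents on a
  set \<open>S\<close>.\<close>

lemma esym_times_hl_sym:
  "esym N x r * hl_sym N x t \<alpha> = (\<Sum>S\<in>Pow {..<N}. of_bool (card S = r) * hl_sym N x t (bump \<alpha> S))"
proof -
  define D where "D w = (\<Prod>(i, j)\<in>pairs N. (x (w i) - t * x (w j)) / (x (w i) - x (w j)))" for w :: "nat \<Rightarrow> nat"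
  have e: "esym N x r = (\<Sum>S\<in>Pow {..<N}. of_bool (card S = r) * (\<Prod>i\<in>S. x (w i)))"
    if w: "w permutes {..<N}" for w
  proof -
    have iw: "inj w" using w by (rule permutes_inj)
    have im: "bij_betw ((`) w) (Pow {..<N}) (Pow {..<N})"
      using bij_betw_Pow[OF permutes_imp_bij[OF w]] .
    show ?thesis unfolding esym_def
      by (subst sum.reindex_bij_betw[OF im, symmetric])
        (simp add: card_image inj_on_subset[OF iw] prod.reindex)
  qed
  have m: "(\<Prod>i\<in>S. x (w i)) * (\<Prod>i<N. x (w i) ^ \<alpha> i) = (\<Prod>i<N. x (w i) ^ bump \<alpha> S i)"
    if "S \<subseteq> {..<N}" for S and w :: "nat \<Rightarrow> nat"
  proof -
    have "(\<Prod>i\<in>S. x (w i)) = (\<Prod>i<N. x (w i) ^ of_bool (i \<in> S))"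
      by (rule prod.mono_neutral_cong_left) (use that in auto)
    then show ?thesis by (simp add: bump_def power_add prod.distrib mult.commute)
  qed
  have "esym N x r * hl_sym N x t \<alpha> =
    (\<Sum>w | w permutes {..<N}. esym N x r * ((\<Prod>i<N. x (w i) ^ \<alpha> i) * D w))"
    unfolding hl_sym_def D_def by (rule sum_distrib_left)
  also have "\<dots> = (\<Sum>w | w permutes {..<N}. \<Sum>S\<in>Pow {..<N}.
      of_bool (card S = r) * ((\<Prod>i<N. x (w i) ^ bump \<alpha> S i) * D w))"
  proof (rule sum.cong[OF refl])
    fix w assume "w \<in> {w. w permutes {..<N}}"
    then have w: "w permutes {..<N}" by simp
    show "esym N x r * ((\<Prod>i<N. x (w i) ^ \<alpha> i) * D w) = (\<Sum>S\<in>Pow {..<N}.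
      of_bool (card S = r) * ((\<Prod>i<N. x (w i) ^ bump \<alpha> S i) * D w))"
      unfolding e[OF w] sum_distrib_right
      by (rule sum.cong[OF refl]) (simp add: m[symmetric] mult_ac)
  qed
  also have "\<dots> = (\<Sum>S\<in>Pow {..<N}. of_bool (card S = r) * hl_sym N x t (bump \<alpha> S))"
    unfolding sum.swap[of _ "Pow {..<N}"] hl_sym_def D_def by (simp add: sum_distrib_left)
  finally show ?thesis .
qed

text \<open>A raised exponent behind a row of equal ones shows the pattern \<open>v, v + 1\<close>.
  Each straightening moves it one place forward at the cost of a factor \<open>t\<close>, and
  \<open>d\<close> moves are made.\<close>

lemma hl_sym_bump_shift:
  assumes "inj x" and "q + d < N" and "\<And>i. i \<in> {q..q + d} \<Longrightarrow> \<alpha> i = v"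
    and "Q \<inter> {q..q + d} = {}"
  shows "hl_sym N x t (bump \<alpha> (insert (q + d) Q)) = t ^ d * hl_sym N x t (bump \<alpha> (insert q Q))"
  using assms(2-)
proof (induction d)
  case 0
  then show ?case by simp
next
  case (Suc d)
  let ?b = "bump \<alpha> (insert (Suc (q + d)) Q)"
  have n: "q + d \<notin> Q" "Suc (q + d) \<notin> Q" using Suc.prems(3) by auto
  have v: "\<alpha> (q + d) = v" "\<alpha> (Suc (q + d)) = v" using Suc.prems(2) by auto
  have "hl_sym N x t ?b = t * hl_sym N x t (?b(q + d := Suc (?b (q + d)), Suc (q + d) := ?b (q + d)))"
    by (rule hl_sym_straighten) (use Suc.prems n v assms(1) in \<open>auto simp: bump_def\<close>)
  also have "?b(q + d := Suc (?b (q + d)), Suc (q + d) := ?b (q + d)) = bump \<alpha> (insert (q + d) Q)"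
    using n v by (auto simp: bump_def fun_eq_iff)
  also have "hl_sym N x t (bump \<alpha> (insert (q + d) Q)) = t ^ d * hl_sym N x t (bump \<alpha> (insert q Q))"
    using Suc.prems by (intro Suc.IH) auto
  finally show ?case by (simp add: mult.assoc)
qed

lemma sum_Pow_insert:
  fixes f :: "'b set \<Rightarrow> 'a::comm_monoid_add"
  assumes "finite A" "a \<notin> A"
  shows "(\<Sum>S\<in>Pow (insert a A). f S) = (\<Sum>S\<in>Pow A. f S) + (\<Sum>S\<in>Pow A. f (insert a S))"
proof -
  have "inj_on (insert a) (Pow A)" using assms(2) by (auto simp: inj_on_def)
  moreover have "Pow A \<inter> insert a ` Pow A = {}" using assms(2) by auto
  ultimately show ?thesis
    using assms(1) by (simp add: Pow_insert sum.union_disjoint sum.reindex)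
qed

lemma sum_Pow_Un:
  fixes f :: "'b set \<Rightarrow> 'a::comm_monoid_add"
  assumes "finite A" "finite B" "A \<inter> B = {}"
  shows "(\<Sum>S\<in>Pow (A \<union> B). f S) = (\<Sum>S\<in>Pow A. \<Sum>S'\<in>Pow B. f (S \<union> S'))"
  unfolding sum.cartesian_product
  by (rule sum.reindex_bij_witness[where i = "\<lambda>(S, S'). S \<union> S'" and j = "\<lambda>S. (S \<inter> A, S \<inter> B)"])
    (use assms in \<open>auto intro!: arg_cong[where f = f]\<close>)

text \<open>Subsets are split by whether they contain the last position of the block. If so, the
  other \<open>s\<close> raised positions are collected in front by induction, and the last one
  passes \<open>m - s\<close> positions, giving \<open>t ^ (m - s)\<close>: this is the recursion of
  \<open>gauss_binom\<close>. The weight \<open>g\<close> and the set \<open>Q\<close> are general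
  because the second case changes them to \<open>g (Suc _)\<close> and
  \<open>insert (p + m) Q\<close>.\<close>

lemma hl_sym_block_sum:
  fixes g :: "nat \<Rightarrow> 'a::field"
  assumes "inj x" and "p + m \<le> N" and "\<And>i. i \<in> {p..<p + m} \<Longrightarrow> \<alpha> i = v"
    and "Q \<inter> {p..<p + m} = {}"
  shows "(\<Sum>S\<in>Pow {p..<p + m}. g (card S) * hl_sym N x t (bump \<alpha> (Q \<union> S))) =
    (\<Sum>s\<le>m. g s * gauss_binom t m s * hl_sym N x t (bump \<alpha> (Q \<union> {p..<p + s})))"
  using assms(2-)
proof (induction m arbitrary: g Q)
  case 0
  then show ?case by simp
next
  case (Suc m)
  define F where "F S = hl_sym N x t (bump \<alpha> S)" for S
  have ins: "{p..<p + Suc m} = insert (p + m) {p..<p + m}" by auto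
  have 1: "(\<Sum>S\<in>Pow {p..<p + m}. g (card S) * F (Q \<union> S)) =
    (\<Sum>s\<le>m. g s * gauss_binom t m s * F (Q \<union> {p..<p + s}))"
    unfolding F_def using Suc.prems by (intro Suc.IH) auto
  have "(\<Sum>S\<in>Pow {p..<p + m}. g (card (insert (p + m) S)) * F (Q \<union> insert (p + m) S)) =
    (\<Sum>S\<in>Pow {p..<p + m}. g (Suc (card S)) * F (insert (p + m) Q \<union> S))"
  proof (rule sum.cong[OF refl])
    fix S assume "S \<in> Pow {p..<p + m}"
    then have "finite S" "p + m \<notin> S" by (auto intro: finite_subset)
    then show "g (card (insert (p + m) S)) * F (Q \<union> insert (p + m) S) =
      g (Suc (card S)) * F (insert (p + m) Q \<union> S)" by simp
  qed
  also have "\<dots> = (\<Sum>s\<le>m. g (Suc s) * gauss_binom t m s * F (insert (p + m) Q \<union> {p..<p + s}))"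
    unfolding F_def using Suc.prems by (intro Suc.IH) auto
  also have "\<dots> = (\<Sum>s\<le>m. g (Suc s) * (t ^ (m - s) * gauss_binom t m s) * F (Q \<union> {p..<p + Suc s}))"
  proof (rule sum.cong[OF refl])
    fix s assume s: "s \<in> {..m}"
    have "F (insert (p + s + (m - s)) (Q \<union> {p..<p + s})) = t ^ (m - s) * F (insert (p + s) (Q \<union> {p..<p + s}))"
      unfolding F_def
      by (rule hl_sym_bump_shift) (use assms(1) Suc.prems s in auto)
    moreover have "insert (p + s) (Q \<union> {p..<p + s}) = Q \<union> {p..<p + Suc s}" by auto
    ultimately show "g (Suc s) * gauss_binom t m s * F (insert (p + m) Q \<union> {p..<p + s}) =
      g (Suc s) * (t ^ (m - s) * gauss_binom t m s) * F (Q \<union> {p..<p + Suc s})"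
      using s by simp
  qed
  finally have 2: "(\<Sum>S\<in>Pow {p..<p + m}. g (card (insert (p + m) S)) * F (Q \<union> insert (p + m) S)) = \<dots>" .
  have "(\<Sum>s\<le>m. g s * gauss_binom t m s * F (Q \<union> {p..<p + s})) =
    (\<Sum>s\<le>Suc m. g s * gauss_binom t m s * F (Q \<union> {p..<p + s}))"
    by (simp add: gauss_binom_eq_0)
  also have "\<dots> = g 0 * F Q + (\<Sum>s\<le>m. g (Suc s) * gauss_binom t m (Suc s) * F (Q \<union> {p..<p + Suc s}))"
    unfolding sum.atMost_Suc_shift by simp
  finally have 3: "(\<Sum>s\<le>m. g s * gauss_binom t m s * F (Q \<union> {p..<p + s})) = \<dots>" .
  have "(\<Sum>S\<in>Pow {p..<p + Suc m}. g (card S) * F (Q \<union> S)) =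
    g 0 * F Q + (\<Sum>s\<le>m. g (Suc s) * gauss_binom t (Suc m) (Suc s) * F (Q \<union> {p..<p + Suc s}))"
    unfolding ins sum_Pow_insert[OF finite_atLeastLessThan, of "p + m" p "p + m", simplified] 1 2 3
    by (simp add: algebra_simps sum.distrib)
  also have "\<dots> = (\<Sum>s\<le>Suc m. g s * gauss_binom t (Suc m) s * F (Q \<union> {p..<p + s}))"
    unfolding sum.atMost_Suc_shift by simp
  finally show ?case unfolding F_def .
qed

section \<open>The action of elementary symmetric functions\<close>

text \<open>For the conjugate \<open>c\<close> of a partition \<open>p\<close> with at most \<open>N\<close> parts, the positions \<open>i < N\<close> with
  \<open>p i = a\<close> form the interval from \<open>c a\<close> to \<open>shift N c a\<close>.\<close>

definition shift :: "nat \<Rightarrow> seq \<Rightarrow> seq" where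
  "shift N c a = (case a of 0 \<Rightarrow> N | Suc b \<Rightarrow> c b)"

lemma shift_simps [simp]: "shift N c 0 = N" "shift N c (Suc a) = c a"
  by (simp_all add: shift_def)

lemma le_shift: "antimono c \<Longrightarrow> c 0 \<le> N \<Longrightarrow> c a \<le> shift N c a"
  by (cases a) (auto simp: antimono_def)

lemma shift_le: "antimono c \<Longrightarrow> c 0 \<le> N \<Longrightarrow> shift N c a \<le> N"
  by (cases a) (auto simp: antimono_def dest: spec2[of _ 0] intro: order_trans)

lemma conjugate_eqI:
  assumes "antimono c" "c a \<le> i" "\<And>b. b < a \<Longrightarrow> i < c b"
  shows "conjugate c i = a"
proof -
  have "{j. i < c j} = {..<a}"
    using assms by (auto simp: antimono_def) (meson leD leI order_trans)
  then show ?thesis by (simp add: conjugate_def)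
qed

lemma conjugate_shift:
  assumes "antimono c" "c a \<le> i" "i < shift N c a"
  shows "conjugate c i = a"
proof (rule conjugate_eqI)
  fix b assume "b < a"
  then obtain a' where "a = Suc a'" "b \<le> a'" by (cases a) auto
  then show "i < c b" using assms(1,3) by (auto simp: antimono_def intro: less_le_trans)
qed (use assms in auto)

text \<open>The blocks are treated one by one, the block of the part 0 standing last among the rows.
  The number of boxes put into block \<open>a\<close> becomes \<open>k a - c a\<close>, and they are
  collected in its first rows, those from \<open>c a\<close> to \<open>k a\<close>. The rows in
  \<open>Q\<close> lie before all blocks treated so far and do not interfere; in the induction they
  absorb the choice made in block \<open>b\<close>.\<close>

lemma hl_sym_sum_Pow_Box:
  fixes g :: "nat \<Rightarrow> 'a::field"
  assumes inj: "inj x" and c: "antimono c" and N: "c 0 \<le> N" and Q: "Q \<subseteq> {..<shift N c b}"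
  shows "(\<Sum>S\<in>Pow {shift N c b..<N}. g (card S) * hl_sym N x t (bump (conjugate c) (Q \<union> S))) =
    (\<Sum>k\<in>Box c (\<lambda>a. if a < b then shift N c a else c a).
       g (\<Sum>a<b. k a - c a) * (\<Prod>a<b. gauss_binom t (shift N c a - c a) (k a - c a)) *
       hl_sym N x t (bump (conjugate c) (Q \<union> (\<Union>a<b. {c a..<k a}))))"
  using Q
proof (induction b arbitrary: g Q)
  case 0
  have "Box c c = {c}" by (auto simp: Box_def)
  then show ?case by simp
next
  case (Suc b)
  define F where "F S = hl_sym N x t (bump (conjugate c) S)" for S
  define U where "U b = (\<lambda>a. if a < b then shift N c a else c a)" for b
  define W where "W b k = (\<Prod>a<b. gauss_binom t (shift N c a - c a) (k a - c a))" for b and k :: seq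
  define m where "m = shift N c b - c b"
  have m: "shift N c b = c b + m" using le_shift[OF c N, of b] by (simp add: m_def)
  have mN: "c b + m \<le> N" using shift_le[OF c N, of b] m by simp
  have reg: "{shift N c (Suc b)..<N} = {c b..<c b + m} \<union> {shift N c b..<N}"
    using m mN by auto
  have "(\<Sum>S\<in>Pow {shift N c (Suc b)..<N}. g (card S) * F (Q \<union> S)) =
    (\<Sum>S\<in>Pow {c b..<c b + m}. \<Sum>S'\<in>Pow {shift N c b..<N}. g (card (S \<union> S')) * F (Q \<union> (S \<union> S')))"
    unfolding reg by (rule sum_Pow_Un) (use m in auto)
  also have "\<dots> = (\<Sum>S\<in>Pow {c b..<c b + m}. \<Sum>S'\<in>Pow {shift N c b..<N}. g (card S + card S') * F ((Q \<union> S) \<union> S'))"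
  proof (intro sum.cong refl)
    fix S S' assume s: "S \<in> Pow {c b..<c b + m}" "S' \<in> Pow {shift N c b..<N}"
    then have "finite S" "finite S'" by (auto intro: finite_subset)
    moreover have "S \<inter> S' = {}" using s m by fastforce
    ultimately have "card (S \<union> S') = card S + card S'" by (rule card_Un_disjoint)
    then show "g (card (S \<union> S')) * F (Q \<union> (S \<union> S')) = g (card S + card S') * F (Q \<union> S \<union> S')"
      by (simp add: Un_assoc)
  qed
  also have "\<dots> = (\<Sum>S\<in>Pow {c b..<c b + m}. \<Sum>k\<in>Box c (U b).
      g (card S + (\<Sum>a<b. k a - c a)) * W b k * F (Q \<union> S \<union> (\<Union>a<b. {c a..<k a})))"
  proof (rule sum.cong[OF refl])
    fix S assume s: "S \<in> Pow {c b..<c b + m}"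
    have "Q \<union> S \<subseteq> {..<shift N c b}" using s Suc.prems m by auto
    from Suc.IH[OF this, of "\<lambda>j. g (card S + j)"]
    show "(\<Sum>S'\<in>Pow {shift N c b..<N}. g (card S + card S') * F ((Q \<union> S) \<union> S')) =
      (\<Sum>k\<in>Box c (U b). g (card S + (\<Sum>a<b. k a - c a)) * W b k * F (Q \<union> S \<union> (\<Union>a<b. {c a..<k a})))"
      by (simp add: F_def U_def W_def)
  qed
  also have "\<dots> = (\<Sum>k\<in>Box c (U b). W b k * (\<Sum>S\<in>Pow {c b..<c b + m}.
      g (card S + (\<Sum>a<b. k a - c a)) * F ((Q \<union> (\<Union>a<b. {c a..<k a})) \<union> S)))"
    by (subst sum.swap) (simp add: sum_distrib_left ac_simps)
  also have "\<dots> = (\<Sum>k\<in>Box c (U b). W b k * (\<Sum>s\<le>m.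
      g (s + (\<Sum>a<b. k a - c a)) * gauss_binom t m s * F ((Q \<union> (\<Union>a<b. {c a..<k a})) \<union> {c b..<c b + s})))"
  proof (rule sum.cong[OF refl])
    fix k assume k: "k \<in> Box c (U b)"
    have d: "(Q \<union> (\<Union>a<b. {c a..<k a})) \<inter> {c b..<c b + m} = {}"
    proof -
      have "j < c b" if "j \<in> Q" for j using Suc.prems that by auto
      moreover have "shift N c b \<le> c a" if "a < b" for a
        using that c by (cases b) (auto simp: antimono_def)
      ultimately show ?thesis using m by fastforce
    qed
    have "(\<Sum>S\<in>Pow {c b..<c b + m}.
      g (card S + (\<Sum>a<b. k a - c a)) * F ((Q \<union> (\<Union>a<b. {c a..<k a})) \<union> S)) =
      (\<Sum>s\<le>m. g (s + (\<Sum>a<b. k a - c a)) * gauss_binom t m s * F ((Q \<union> (\<Union>a<b. {c a..<k a})) \<union> {c b..<c b + s}))"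
      unfolding F_def
      by (rule hl_sym_block_sum[OF inj mN _ d, where g = "\<lambda>j. g (j + _)" and v = b])
        (use conjugate_shift[OF c, of b _ N] m in simp)
    then show "W b k * (\<Sum>S\<in>Pow {c b..<c b + m}.
      g (card S + (\<Sum>a<b. k a - c a)) * F ((Q \<union> (\<Union>a<b. {c a..<k a})) \<union> S)) =
      W b k * (\<Sum>s\<le>m. g (s + (\<Sum>a<b. k a - c a)) * gauss_binom t m s * F ((Q \<union> (\<Union>a<b. {c a..<k a})) \<union> {c b..<c b + s}))"
      by simp
  qed
  also have "\<dots> = (\<Sum>k\<in>Box c (U b). \<Sum>s\<le>m. g (\<Sum>a<Suc b. (k(b := c b + s)) a - c a) *
      W (Suc b) (k(b := c b + s)) * F (Q \<union> (\<Union>a<Suc b. {c a..<(k(b := c b + s)) a})))"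
  proof (rule sum.cong[OF refl])
    fix k
    have e1: "(\<Sum>a<Suc b. (k(b := c b + s)) a - c a) = s + (\<Sum>a<b. k a - c a)" for s by simp
    have e2: "W (Suc b) (k(b := c b + s)) = W b k * gauss_binom t m s" for s
      by (simp add: W_def m)
    have e3: "(\<Union>a<Suc b. {c a..<(k(b := c b + s)) a}) = (\<Union>a<b. {c a..<k a}) \<union> {c b..<c b + s}" for s
      by (auto simp: lessThan_Suc)
    show "W b k * (\<Sum>s\<le>m. g (s + (\<Sum>a<b. k a - c a)) * gauss_binom t m s * F ((Q \<union> (\<Union>a<b. {c a..<k a})) \<union> {c b..<c b + s})) =
      (\<Sum>s\<le>m. g (\<Sum>a<Suc b. (k(b := c b + s)) a - c a) *
      W (Suc b) (k(b := c b + s)) * F (Q \<union> (\<Union>a<Suc b. {c a..<(k(b := c b + s)) a})))"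
      unfolding e1 e2 e3 by (simp add: sum_distrib_left ac_simps)
  qed
  also have "\<dots> = (\<Sum>k\<in>Box c (U b). \<Sum>v\<in>{c b..c b + m}. g (\<Sum>a<Suc b. (k(b := v)) a - c a) *
      W (Suc b) (k(b := v)) * F (Q \<union> (\<Union>a<Suc b. {c a..<(k(b := v)) a})))"
    by (intro sum.cong[OF refl] sum.reindex_bij_witness[where i = "\<lambda>v. v - c b" and j = "\<lambda>s. c b + s"]) auto
  \<comment> \<open>The box for \<open>b\<close> is the one for \<open>Suc b\<close> with coordinate
    \<open>b\<close> frozen, which is the shape in which the new coordinate can be merged
    in.\<close>
  also have "U b = (U (Suc b))(b := c b)" by (auto simp: U_def fun_eq_iff)
  also have "c b + m = U (Suc b) b" by (simp add: U_def m)
  also have "(\<Sum>k\<in>Box c ((U (Suc b))(b := c b)). \<Sum>v\<in>{c b..U (Suc b) b}. g (\<Sum>a<Suc b. (k(b := v)) a - c a) *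
      W (Suc b) (k(b := v)) * F (Q \<union> (\<Union>a<Suc b. {c a..<(k(b := v)) a}))) =
      (\<Sum>k\<in>Box c (U (Suc b)). g (\<Sum>a<Suc b. k a - c a) * W (Suc b) k * F (Q \<union> (\<Union>a<Suc b. {c a..<k a})))"
    by (rule sum_Box_split[symmetric]) (use le_shift[OF c N] in \<open>auto simp: U_def\<close>)
  finally show ?case by (simp only: F_def U_def W_def)
qed

text \<open>Raising the first rows of every block keeps the exponents decreasing. A raised row of
  block \<open>a\<close> gets the part \<open>Suc a\<close> and so counts for column
  \<open>a\<close>, whose length grows from \<open>c a\<close> to \<open>k a\<close>; the bound
  \<open>k (Suc a) <= c a\<close> is contained in \<open>shift\<close>.\<close>

lemma bump_conjugate:
  assumes c: "antimono c" and k: "k \<in> Box c (shift N c)" and b: "\<And>a. b \<le> a \<Longrightarrow> k a = c a" and i: "i < N"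
  shows "bump (conjugate c) (\<Union>a<b. {c a..<k a}) i = conjugate k i"
proof -
  have kc: "c a \<le> k a" "k a \<le> shift N c a" for a using k by (auto simp: Box_def le_fun_def)
  have ks: "k (Suc a) \<le> c a" for a using kc(2)[of "Suc a"] by simp
  then have ka: "antimono k" unfolding antimono_iff_le_Suc using kc(1) order_trans by blast
  show ?thesis
  proof (cases "i \<in> (\<Union>a<b. {c a..<k a})")
    case True
    then obtain a where a: "c a \<le> i" "i < k a" by auto
    have "conjugate c i = a" using conjugate_shift[OF c a(1)] a(2) kc(2)[of a] by (metis less_le_trans)
    moreover have "conjugate k i = Suc a"
    proof (rule conjugate_eqI[OF ka])
      show "k (Suc a) \<le> i" using ks[of a] a by simp
      fix j assume "j < Suc a"
      then show "i < k j" using a(2) ka by (auto simp: antimono_def less_Suc_eq_le intro: less_le_trans)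
    qed
    ultimately show ?thesis using True by (simp add: bump_def)
  next
    case False
    have "i < k a \<longleftrightarrow> i < c a" for a
    proof
      assume ik: "i < k a"
      show "i < c a"
      proof (rule ccontr)
        assume n: "\<not> i < c a"
        then have "a < b" using b[of a] ik by (cases "a < b") auto
        then show False using False n ik by auto
      qed
    qed (use kc(1)[of a] in simp)
    then show ?thesis using False by (simp add: bump_def conjugate_def)
  qed
qed

lemma esym_times_hl_sym_conjugate:
  assumes inj: "inj x" and c: "antimono c" and N: "c 0 \<le> N" and b0: "b > 0"
    and b: "\<And>a. b \<le> Suc a \<Longrightarrow> c a = 0"
  shows "esym N x r * hl_sym N x t (conjugate c) = (\<Sum>k\<in>Box c (shift N c).
      of_bool ((\<Sum>a<b. k a - c a) = r) * (\<Prod>a<b. gauss_binom t (shift N c a - c a) (k a - c a)) *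
      hl_sym N x t (conjugate k))"
proof -
  obtain b' where b': "b = Suc b'" using b0 by (cases b) auto
  \<comment> \<open>The bound \<open>b\<close> lies beyond the last nonempty column of
    \<open>c\<close>, so the blocks below \<open>b\<close> exhaust all \<open>N\<close>
    rows.\<close>
  have sb: "shift N c b = 0" using b b' by simp
  have bx: "(\<lambda>a. if a < b then shift N c a else c a) = shift N c"
  proof
    fix a show "(if a < b then shift N c a else c a) = shift N c a"
      using b b' by (cases a) auto
  qed
  have "esym N x r * hl_sym N x t (conjugate c) =
    (\<Sum>S\<in>Pow {shift N c b..<N}. of_bool (card S = r) * hl_sym N x t (bump (conjugate c) ({} \<union> S)))"
    unfolding esym_times_hl_sym sb by (simp add: atLeast0LessThan)
  also have "\<dots> = (\<Sum>k\<in>Box c (shift N c).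
       of_bool ((\<Sum>a<b. k a - c a) = r) * (\<Prod>a<b. gauss_binom t (shift N c a - c a) (k a - c a)) *
       hl_sym N x t (bump (conjugate c) ({} \<union> (\<Union>a<b. {c a..<k a}))))"
    by (subst hl_sym_sum_Pow_Box[OF inj c N, where g = "\<lambda>j. of_bool (j = r)"]) (auto simp: bx)
  also have "\<dots> = (\<Sum>k\<in>Box c (shift N c).
      of_bool ((\<Sum>a<b. k a - c a) = r) * (\<Prod>a<b. gauss_binom t (shift N c a - c a) (k a - c a)) *
      hl_sym N x t (conjugate k))"
  proof (rule sum.cong[OF refl])
    fix k assume k: "k \<in> Box c (shift N c)"
    have "k a = c a" if "b \<le> a" for a
      using k that b b' by (cases a) (auto simp: Box_def le_fun_def dest!: spec[of _ a])
    then have "hl_sym N x t (bump (conjugate c) (\<Union>a<b. {c a..<k a})) = hl_sym N x t (conjugate k)"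
      by (intro hl_sym_cong bump_conjugate[OF c k])
    then show "of_bool ((\<Sum>a<b. k a - c a) = r) * (\<Prod>a<b. gauss_binom t (shift N c a - c a) (k a - c a)) *
       hl_sym N x t (bump (conjugate c) ({} \<union> (\<Union>a<b. {c a..<k a}))) =
       of_bool ((\<Sum>a<b. k a - c a) = r) * (\<Prod>a<b. gauss_binom t (shift N c a - c a) (k a - c a)) *
      hl_sym N x t (conjugate k)" by simp
  qed
  finally show ?thesis .
qed

section \<open>The symmetrization of the empty monomial\<close>

text \<open>The degree is only bounded because some \<open>b i\<close> may be 0, as happens for
  \<open>- t\<close> at \<open>t = 0\<close>; the coefficient at \<open>card A\<close> is correct in
  any case.\<close>

lemma degree_coeff_prod_linear:
  fixes a b :: "'b \<Rightarrow> 'a::field"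
  assumes "finite A"
  shows "degree (\<Prod>i\<in>A. [:a i, b i:]) \<le> card A \<and> coeff (\<Prod>i\<in>A. [:a i, b i:]) (card A) = (\<Prod>i\<in>A. b i)"
  using assms
proof (induction A rule: finite_induct)
  case empty
  then show ?case by simp
next
  case (insert j A)
  let ?p = "\<Prod>i\<in>A. [:a i, b i:]"
  have "degree ([:a j, b j:] * ?p) \<le> Suc (card A)"
    using insert.IH by (intro order.trans[OF degree_mult_le]) (auto simp: add.commute intro: le_SucI)
  moreover have "coeff ([:a j, b j:] * ?p) (Suc (card A)) = b j * (\<Prod>i\<in>A. b i)"
    using insert.IH by (simp add: coeff_eq_0)
  ultimately show ?case using insert.hyps by simp
qed

context not_root_of_unity
begin

lemma t_neq_1: "1 - t \<noteq> 0"
  using power_neq_1[of 1] by simp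

text \<open>Lagrange interpolation at the points \<open>x i\<close> of the polynomial
  \<open>\<Prod>(x i - t z) - t ^ n \<Prod>(x i - z)\<close>, of degree less than \<open>n\<close>, evaluated at \<open>z = 0\<close>.\<close>

lemma sum_prod_partial_fractions:
  assumes inj: "inj_on x {..<n}" and nz: "\<And>i. i < n \<Longrightarrow> x i \<noteq> 0"
  shows "(\<Sum>b<n. \<Prod>i\<in>{..<n} - {b}. (x i - t * x b) / (x i - x b)) = (1 - t ^ n) / (1 - t)"
proof (cases "n = 0")
  case True
  then show ?thesis by simp
next
  case False
  define F where "F = (\<Prod>i<n. [:x i, - t:])"
  define G where "G = (\<Prod>i<n. [:x i, - 1:])"
  define l where "l b = (\<Prod>i\<in>{..<n} - {b}. [:x i, - 1:])" for b
  define d where "d b = (\<Prod>i\<in>{..<n} - {b}. (x i - x b))" for b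
  define L where "L = (\<Sum>b<n. smult (poly F (x b) / d b) (l b))"
  define H where "H = F - smult (t ^ n) G - L"
  have F: "degree F \<le> n" "coeff F n = (- t) ^ n"
    using degree_coeff_prod_linear[of "{..<n}" x "\<lambda>_. - t"] by (simp_all add: F_def)
  have G: "degree G \<le> n" "coeff G n = (- 1) ^ n"
    using degree_coeff_prod_linear[of "{..<n}" x "\<lambda>_. - 1"] by (simp_all add: G_def)
  have l: "degree (l b) < n" if "b < n" for b
    using conjunct1[OF degree_coeff_prod_linear[of "{..<n} - {b}" x "\<lambda>_. - 1"]] that
    by (simp add: l_def)
  have L: "degree L < n"
    unfolding L_def using False l
    by (intro degree_sum_less) (auto intro: le_less_trans[OF degree_smult_le])
  have "degree H \<le> n"
    unfolding H_def using F G L by (intro degree_diff_le order.trans[OF degree_smult_le]) auto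
  moreover have "coeff H n = 0"
    unfolding H_def using F G L by (simp add: coeff_eq_0 power_minus[of t] mult.commute)
  ultimately have H: "degree H < n"
    using False by (metis coeff_0_degree_minus_1 degree_0 gr_zeroI le_neq_implies_less leading_coeff_0_iff)
  have dnz: "d b \<noteq> 0" if "b < n" for b
    using inj that unfolding d_def by (auto simp: inj_on_def)
  have "poly H (x c) = 0" if c: "c < n" for c
  proof -
    have "poly G (x c) = 0" using c by (auto simp: G_def poly_prod)
    moreover have "poly L (x c) = (\<Sum>b<n. if b = c then poly F (x c) else 0)"
      unfolding L_def poly_sum
    proof (rule sum.cong[OF refl])
      fix b assume b: "b \<in> {..<n}"
      show "poly (smult (poly F (x b) / d b) (l b)) (x c) = (if b = c then poly F (x c) else 0)"
      proof (cases "b = c")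
        case True
        have "poly (l b) (x b) = d b" by (simp add: l_def d_def poly_prod)
        then show ?thesis using True dnz[of b] b by simp
      next
        case False
        then have "poly (l b) (x c) = 0" using c by (auto simp: l_def poly_prod)
        then show ?thesis using False by simp
      qed
    qed
    ultimately show ?thesis using c by (simp add: H_def)
  qed
  then have sub: "x ` {..<n} \<subseteq> {z. poly H z = 0}" by auto
  have "H = 0"
  proof (rule ccontr)
    assume nz: "H \<noteq> 0"
    have "n = card (x ` {..<n})" using inj by (simp add: card_image)
    also have "\<dots> \<le> card {z. poly H z = 0}" by (rule card_mono[OF poly_roots_finite[OF nz] sub])
    also have "\<dots> \<le> degree H" by (rule card_poly_roots_bound[OF nz])
    finally show False using H by simp
  qed
  then have "poly H 0 = 0" by simp
  then have "poly F 0 - t ^ n * poly G 0 = poly L 0" by (simp add: H_def)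
  moreover have "poly F 0 = (\<Prod>i<n. x i)" "poly G 0 = (\<Prod>i<n. x i)"
    by (simp_all add: F_def G_def poly_prod)
  \<comment> \<open>In \<open>poly F (x b)\<close> the factor of index \<open>b\<close> is
    \<open>(1 - t) * x b\<close>. This is the origin of the denominator \<open>1 - t\<close> and
    restores the product of all variables.\<close>
  moreover have "poly L 0 = (1 - t) * (\<Prod>i<n. x i) * (\<Sum>b<n. \<Prod>i\<in>{..<n} - {b}. (x i - t * x b) / (x i - x b))"
    unfolding L_def poly_sum sum_distrib_left
  proof (rule sum.cong[OF refl])
    fix b assume b: "b \<in> {..<n}"
    have "poly F (x b) = (x b - t * x b) * (\<Prod>i\<in>{..<n} - {b}. x i - t * x b)"
      unfolding F_def poly_prod
      by (subst prod.remove[of _ b]) (use b in \<open>simp_all add: mult.commute\<close>)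
    moreover have "poly (l b) 0 = (\<Prod>i\<in>{..<n} - {b}. x i)" by (simp add: l_def poly_prod)
    moreover have "(\<Prod>i<n. x i) = x b * (\<Prod>i\<in>{..<n} - {b}. x i)" using b by (simp add: prod.remove)
    ultimately show "poly (smult (poly F (x b) / d b) (l b)) 0 =
      (1 - t) * (\<Prod>i<n. x i) * (\<Prod>i\<in>{..<n} - {b}. (x i - t * x b) / (x i - x b))"
      by (simp only: d_def prod_dividef poly_smult) (simp add: algebra_simps)
  qed
  ultimately have "(1 - t ^ n) * (\<Prod>i<n. x i) =
    ((1 - t) * (\<Sum>b<n. \<Prod>i\<in>{..<n} - {b}. (x i - t * x b) / (x i - x b))) * (\<Prod>i<n. x i)"
    by (simp add: algebra_simps)
  moreover have "(\<Prod>i<n. x i) \<noteq> 0" using nz by auto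
  ultimately have "1 - t ^ n = (1 - t) * (\<Sum>b<n. \<Prod>i\<in>{..<n} - {b}. (x i - t * x b) / (x i - x b))"
    by simp
  then show ?thesis using t_neq_1 by simp
qed

lemma hl_v_0 [simp]: "hl_v t 0 = 1"
  and hl_v_Suc: "hl_v t (Suc m) = hl_v t m * ((1 - t ^ Suc m) / (1 - t))"
  by (simp_all add: hl_v_def)

lemma hl_v_eq_qpoch: "hl_v t m = qpoch t m / (1 - t) ^ m"
  by (induction m) (simp_all add: hl_v_Suc qpoch_Suc)

lemma hl_v_nz: "hl_v t m \<noteq> 0"
  using qpoch_nz t_neq_1 by (simp add: hl_v_eq_qpoch)

lemma gauss_binom_eq_hl_v:
  "k \<le> n \<Longrightarrow> gauss_binom t n k = hl_v t n / (hl_v t k * hl_v t (n - k))"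
  using t_neq_1 qpoch_nz
  by (simp add: gauss_binom_eq hl_v_eq_qpoch power_add[symmetric])

text \<open>Permutations are sorted by the variable \<open>x b\<close> that takes the last place.
  The factors of the pairs with the last place depend on \<open>b\<close> alone, the remaining ones
  form the same sum in \<open>N\<close> variables, and the sum over \<open>b\<close> is the partial
  fraction identity. The variables are generalized because the remaining ones are
  renumbered.\<close>

lemma hl_sym_0:
  assumes "inj x" and "\<And>i. x i \<noteq> 0"
  shows "hl_sym N x t (\<lambda>_. 0) = hl_v t N"
  using assms
proof (induction N arbitrary: x)
  case 0
  then show ?case by (simp add: hl_sym_def pairs_def)
next
  case (Suc N)
  define \<phi> where "\<phi> a b = (a - t * b) / (a - b)" for a b
  have pS: "pairs (Suc N) = pairs N \<union> (\<lambda>i. (i, N)) ` {..<N}"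
    by (auto simp: pairs_def less_Suc_eq)
  have prS: "(\<Prod>p\<in>pairs (Suc N). f p) = (\<Prod>p\<in>pairs N. f p) * (\<Prod>i<N. f (i, N))" for f :: "nat \<times> nat \<Rightarrow> 'a"
    unfolding pS by (subst prod.union_disjoint) (auto simp: pairs_def[of N] prod.reindex inj_on_def finite_pairs[unfolded pairs_def])
  have inner: "(\<Sum>q | q permutes {..<N}. \<Prod>(i, j)\<in>pairs (Suc N).
      \<phi> (x ((transpose N b \<circ> q) i)) (x ((transpose N b \<circ> q) j))) =
      hl_v t N * (\<Prod>i\<in>{..<Suc N} - {b}. \<phi> (x i) (x b))" if b: "b < Suc N" for b
  proof -
    define y where "y = x \<circ> transpose N b"
    have iy: "inj y" unfolding y_def using Suc.prems(1) by (intro inj_compose) auto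
    have yN: "y N = x b" by (simp add: y_def)
    have "(\<Sum>q | q permutes {..<N}. \<Prod>(i, j)\<in>pairs (Suc N).
      \<phi> (x ((transpose N b \<circ> q) i)) (x ((transpose N b \<circ> q) j))) =
      (\<Sum>q | q permutes {..<N}. (\<Prod>(i, j)\<in>pairs N. \<phi> (y (q i)) (y (q j))) * (\<Prod>i<N. \<phi> (y i) (x b)))"
    proof (rule sum.cong[OF refl])
      fix q assume "q \<in> {q. q permutes {..<N}}"
      then have q: "q permutes {..<N}" by simp
      then have qN: "q N = N" by (rule permutes_not_in) simp
      have "(\<Prod>i<N. \<phi> (y (q i)) (x b)) = (\<Prod>i<N. \<phi> (y i) (x b))"
        using prod.permute[OF q, of "\<lambda>i. \<phi> (y i) (x b)"] by (simp add: comp_def)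
      then show "(\<Prod>(i, j)\<in>pairs (Suc N).
        \<phi> (x ((transpose N b \<circ> q) i)) (x ((transpose N b \<circ> q) j))) =
        (\<Prod>(i, j)\<in>pairs N. \<phi> (y (q i)) (y (q j))) * (\<Prod>i<N. \<phi> (y i) (x b))"
        unfolding prS using qN yN by (simp add: y_def)
    qed
    also have "\<dots> = (\<Sum>q | q permutes {..<N}. \<Prod>(i, j)\<in>pairs N. \<phi> (y (q i)) (y (q j))) * (\<Prod>i<N. \<phi> (y i) (x b))"
      by (rule sum_distrib_right[symmetric])
    also have "(\<Sum>q | q permutes {..<N}. \<Prod>(i, j)\<in>pairs N. \<phi> (y (q i)) (y (q j))) = hl_v t N"
      using Suc.IH[OF iy] Suc.prems(2) by (simp add: hl_sym_def y_def \<phi>_def)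
    also have "(\<Prod>i<N. \<phi> (y i) (x b)) = (\<Prod>i\<in>{..<Suc N} - {b}. \<phi> (x i) (x b))"
      by (rule prod.reindex_bij_witness[where i = "transpose N b" and j = "transpose N b"])
        (use b in \<open>auto simp: y_def transpose_def split: if_splits\<close>)
    finally show ?thesis .
  qed
  have "hl_sym (Suc N) x t (\<lambda>_. 0) = (\<Sum>w | w permutes (insert N {..<N}).
      \<Prod>(i, j)\<in>pairs (Suc N). \<phi> (x (w i)) (x (w j)))"
    by (simp add: hl_sym_def \<phi>_def lessThan_Suc)
  also have "\<dots> = (\<Sum>b\<in>insert N {..<N}. \<Sum>q | q permutes {..<N}. \<Prod>(i, j)\<in>pairs (Suc N).
      \<phi> (x ((transpose N b \<circ> q) i)) (x ((transpose N b \<circ> q) j)))"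
    by (rule sum_over_permutations_insert) auto
  also have "\<dots> = (\<Sum>b\<in>insert N {..<N}. hl_v t N * (\<Prod>i\<in>{..<Suc N} - {b}. \<phi> (x i) (x b)))"
    by (rule sum.cong[OF refl], rule inner) auto
  also have "\<dots> = hl_v t N * (\<Sum>b<Suc N. \<Prod>i\<in>{..<Suc N} - {b}. \<phi> (x i) (x b))"
    unfolding lessThan_Suc by (rule sum_distrib_left[symmetric])
  also have "(\<Sum>b<Suc N. \<Prod>i\<in>{..<Suc N} - {b}. \<phi> (x i) (x b)) = (1 - t ^ Suc N) / (1 - t)"
    unfolding \<phi>_def using Suc.prems
    by (intro sum_prod_partial_fractions) (auto intro: inj_on_subset)
  finally show ?case by (simp only: hl_v_Suc)
qed

end

section \<open>Partitions and their conjugates\<close>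

lemma less_conjugate_iff:
  assumes "is_partition c"
  shows "i < conjugate c j \<longleftrightarrow> j < c i"
proof -
  have anti: "antimono c" and "finite {i. c i \<noteq> 0}" using assms by (auto simp: is_partition_def)
  then obtain m where "m \<notin> {i. c i \<noteq> 0}" using ex_new_if_finite[OF infinite_UNIV_nat] by blast
  then have ex: "c m \<le> j" by simp
  define a where "a = (LEAST i. c i \<le> j)"
  have ca: "c a \<le> j" unfolding a_def by (rule LeastI[of "\<lambda>i. c i \<le> j", OF ex])
  have lt: "j < c b" if "b < a" for b using not_less_Least[OF that[unfolded a_def]] by simp
  have "conjugate c j = a" by (rule conjugate_eqI[OF anti ca lt])
  moreover have "i < a \<longleftrightarrow> j < c i"
  proof (cases "i < a")
    case False
    then have "c i \<le> c a" using anti by (simp add: antimono_def)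
    then show ?thesis using False ca by simp
  qed (use lt in simp)
  ultimately show ?thesis by simp
qed

text \<open>With \<open>Suc a\<close> in the condition, column \<open>b - 1\<close> is still empty,
  so that the boxes of a vertical strip, which may open one new column, stay below
  \<open>b\<close>.\<close>

lemma is_partition_bound:
  assumes "is_partition c"
  obtains b where "b > 0" "\<And>a. b \<le> Suc a \<Longrightarrow> c a = 0"
proof -
  have f: "finite {i. c i \<noteq> 0}" using assms by (simp add: is_partition_def)
  then obtain m where m: "\<forall>i\<in>{i. c i \<noteq> 0}. i < m" using finite_nat_set_iff_bounded by blast
  show ?thesis by (rule that[of "Suc m"]) (use m in force)+
qed

lemma is_partitionI:
  assumes "\<And>a. c (Suc a) \<le> c a" "\<And>a. b \<le> a \<Longrightarrow> c a = 0"
  shows "is_partition c"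
proof -
  have "{i. c i \<noteq> 0} \<subseteq> {..<b}"
  proof
    fix i assume "i \<in> {i. c i \<noteq> 0}"
    then show "i \<in> {..<b}" using assms(2)[of i] by (cases "b \<le> i") auto
  qed
  then have "finite {i. c i \<noteq> 0}" by (rule finite_subset) simp
  moreover have "antimono c"
    unfolding antimono_iff_le_Suc by (rule allI) (rule assms(1))
  ultimately show ?thesis unfolding is_partition_def by (rule conjI[rotated])
qed

lemma is_partition_antimono: "is_partition c \<Longrightarrow> antimono c"
  by (simp add: is_partition_def)

lemma is_partition_conjugate:
  assumes "is_partition c"
  shows "is_partition (conjugate c)"
proof (rule is_partitionI[of _ "c 0"])
  fix a
  have "i < conjugate c a" if "i < conjugate c (Suc a)" for i
    using that by (simp add: less_conjugate_iff[OF assms])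
  then show "conjugate c (Suc a) \<le> conjugate c a" by (meson not_le order_refl)
next
  fix a assume "c 0 \<le> a"
  then have "\<not> 0 < conjugate c a" by (simp add: less_conjugate_iff[OF assms])
  then show "conjugate c a = 0" by simp
qed

lemma conjugate_conjugate: "is_partition c \<Longrightarrow> conjugate (conjugate c) = c"
  by (rule ext) (simp add: conjugate_def[of "conjugate c"] less_conjugate_iff)

lemma conjugate_eq_0_iff: "is_partition c \<Longrightarrow> conjugate c N = 0 \<longleftrightarrow> c 0 \<le> N"
  using less_conjugate_iff[of c 0 N] by auto

lemma psize_eq:
  assumes "\<And>a. b \<le> a \<Longrightarrow> k a = 0"
  shows "psize k = (\<Sum>a<b. k a)"
  unfolding psize_def
proof (rule Sum_any.expand_superset)
  show "{a. k a \<noteq> 0} \<subseteq> {..<b}"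
    using assms by (metis (mono_tags) lessThan_iff mem_Collect_eq not_le subsetI)
qed simp

lemma psize_conjugate:
  assumes "is_partition c"
  shows "psize (conjugate c) = psize c"
proof -
  obtain b where b: "\<And>a. b \<le> Suc a \<Longrightarrow> c a = 0" using is_partition_bound[OF assms] by blast
  have z: "conjugate c a = 0" if "c 0 \<le> a" for a using conjugate_eq_0_iff[OF assms] that by simp
  have 1: "conjugate c i = card ({..<b} \<inter> {j. i < c j})" for i
  proof -
    have "j < b" if "i < c j" for j using b[of j] that by (cases "j < b") auto
    then have "{j. i < c j} = {..<b} \<inter> {j. i < c j}" by auto
    then show ?thesis by (simp add: conjugate_def)
  qed
  have 2: "c j = card ({..<c 0} \<inter> {i. i < c j})" for j
  proof -
    have "c j \<le> c 0" using is_partition_antimono[OF assms] by (simp add: antimono_def)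
    then have "{..<c 0} \<inter> {i. i < c j} = {..<c j}" by auto
    then show ?thesis by simp
  qed
  have "psize (conjugate c) = (\<Sum>i<c 0. conjugate c i)" by (rule psize_eq) (rule z)
  also have "\<dots> = (\<Sum>i<c 0. \<Sum>j<b. of_bool (i < c j))"
    by (simp add: 1 sum_of_bool_eq)
  also have "\<dots> = (\<Sum>j<b. \<Sum>i<c 0. of_bool (i < c j))" by (rule sum.swap)
  also have "\<dots> = (\<Sum>j<b. c j)"
    by (rule sum.cong[OF refl], rule trans[OF _ 2[symmetric]])
      (simp add: sum_of_bool_eq)
  also have "\<dots> = psize c" by (rule psize_eq[symmetric]) (use b in auto)
  finally show ?thesis .
qed

lemma bij_betw_conjugate: "bij_betw conjugate (partitions_of n) (partitions_of n)"
  by (rule bij_betwI[where g = conjugate])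
    (auto simp: partitions_of_def is_partition_conjugate psize_conjugate conjugate_conjugate)

text \<open>The first \<open>Suc a\<close> parts are all at least \<open>k a\<close>. This bounds
  the parts and their number by \<open>n\<close>, which gives finiteness and a cutoff common to all
  partitions of \<open>n\<close>.\<close>

lemma partitions_of_bound:
  assumes "k \<in> partitions_of n"
  shows "Suc a * k a \<le> n"
proof -
  have p: "is_partition k" "psize k = n" using assms by (auto simp: partitions_of_def)
  obtain b where b: "\<And>a. b \<le> Suc a \<Longrightarrow> k a = 0" using is_partition_bound[OF p(1)] by blast
  have "Suc a * k a = (\<Sum>j<Suc a. k a)" by simp
  also have "\<dots> \<le> (\<Sum>j<Suc a. k j)"
    using is_partition_antimono[OF p(1)] by (intro sum_mono) (auto simp: antimono_def)
  also have "\<dots> \<le> (\<Sum>j<max b (Suc a). k j)" by (rule sum_mono2) auto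
  also have "\<dots> = psize k" by (rule psize_eq[symmetric]) (use b in auto)
  finally show ?thesis using p by simp
qed

lemma partitions_of_eq_0: "k \<in> partitions_of n \<Longrightarrow> n \<le> a \<Longrightarrow> k a = 0"
  using partitions_of_bound[of k n a] by (cases "k a") auto

lemma finite_partitions_of: "finite (partitions_of n)"
proof (rule finite_subset)
  show "partitions_of n \<subseteq> Box (\<lambda>_. 0) (\<lambda>a. if a < n then n else 0)"
  proof
    fix k assume k: "k \<in> partitions_of n"
    have "k a \<le> n" for a using partitions_of_bound[OF k, of a] by simp
    then show "k \<in> Box (\<lambda>_. 0) (\<lambda>a. if a < n then n else 0)"
      using partitions_of_eq_0[OF k] by (auto simp: Box_def le_fun_def)
  qed
  show "finite (Box (\<lambda>_. 0) (\<lambda>a. if a < n then n else 0))"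
    by (rule finite_Box) (rule finite_subset[of _ "{..<n}"], auto)
qed

lemma psize_mono:
  assumes "k \<le> l" "is_partition l"
  shows "psize k \<le> psize l"
proof -
  obtain b where b: "\<And>a. b \<le> Suc a \<Longrightarrow> l a = 0" using is_partition_bound[OF assms(2)] by blast
  have kl: "k a \<le> l a" for a using assms by (simp add: le_fun_def)
  have "psize k = (\<Sum>a<b. k a)"
    by (rule psize_eq) (metis b kl le_SucI le_zero_eq)
  also have "\<dots> \<le> (\<Sum>a<b. l a)" by (rule sum_mono) (rule kl)
  also have "\<dots> = psize l" by (rule psize_eq[symmetric]) (use b in auto)
  finally show ?thesis .
qed

lemma psize_le_eq:
  assumes "k \<le> l" "is_partition l" "psize l \<le> psize k"
  shows "k = l"
proof (rule ccontr)
  obtain b where b: "\<And>a. b \<le> Suc a \<Longrightarrow> l a = 0" using is_partition_bound[OF assms(2)] by blast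
  have kl: "k a \<le> l a" for a using assms by (simp add: le_fun_def)
  assume "k \<noteq> l"
  then obtain a where a: "k a < l a" using kl by (metis ext le_neq_implies_less)
  then have "a < b" using b[of a] by (cases "a < b") auto
  have "psize k = (\<Sum>a<b. k a)"
    by (rule psize_eq) (metis b kl le_SucI le_zero_eq)
  also have "\<dots> < (\<Sum>a<b. l a)"
    by (rule sum_strict_mono_ex1) (use kl a \<open>a < b\<close> in auto)
  also have "\<dots> = psize l" by (rule psize_eq[symmetric]) (use b in auto)
  finally show False using assms(3) by simp
qed

section \<open>The Pieri rule for elementary symmetric functions\<close>

lemma hl_norm_conjugate:
  assumes c: "is_partition c" and N: "c 0 \<le> N" and b0: "b > 0" and b: "\<And>a. b \<le> Suc a \<Longrightarrow> c a = 0"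
  shows "hl_norm N t (conjugate c) = (\<Prod>a<b. hl_v t (shift N c a - c a))"
proof -
  have "card {j. j < N \<and> conjugate c j = a} = shift N c a - c a" for a
  proof -
    have anti: "antimono c" using c by (rule is_partition_antimono)
    have "{j. j < N \<and> conjugate c j = a} = {c a..<shift N c a}"
    proof (intro equalityI subsetI)
      fix j assume j: "j \<in> {j. j < N \<and> conjugate c j = a}"
      then have "\<not> a < conjugate c j" by simp
      then have "c a \<le> j" using less_conjugate_iff[OF c] by simp
      moreover have "j < shift N c a"
        using j less_conjugate_iff[OF c, of "a - 1" j] by (cases a) auto
      ultimately show "j \<in> {c a..<shift N c a}" by simp
    next
      fix j assume j: "j \<in> {c a..<shift N c a}"
      then show "j \<in> {j. j < N \<and> conjugate c j = a}"
        using conjugate_shift[OF anti, of a j N] shift_le[OF anti N, of a] by auto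
    qed
    then show ?thesis by simp
  qed
  then have "hl_norm N t (conjugate c) = Prod_any (\<lambda>a. hl_v t (shift N c a - c a))"
    by (simp add: hl_norm_def)
  also have "\<dots> = (\<Prod>a<b. hl_v t (shift N c a - c a))"
  proof (rule Prod_any.expand_superset)
    show "{a. hl_v t (shift N c a - c a) \<noteq> 1} \<subseteq> {..<b}"
    proof
      fix a assume a: "a \<in> {a. hl_v t (shift N c a - c a) \<noteq> 1}"
      show "a \<in> {..<b}"
      proof (rule ccontr)
        assume "a \<notin> {..<b}"
        then have "shift N c a = 0" using b0 b[of "a - 1"] by (cases a) auto
        then show False using a by (simp add: hl_v_def)
      qed
    qed
  qed simp
  finally show ?thesis .
qed

lemma hall_littlewood_conjugate:
  assumes "is_partition c"
  shows "hall_littlewood N x t (conjugate c) =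
    (if c 0 \<le> N then hl_sym N x t (conjugate c) / hl_norm N t (conjugate c) else 0)"
  using conjugate_eq_0_iff[OF assms] by (simp add: hall_littlewood_def hl_sym_def pairs_def)

text \<open>Here and below, \<open>c\<close>, \<open>k\<close> and \<open>l\<close> are the conjugates of the partitions that index the
  symmetric functions, so that \<open>c a\<close> is the length of column \<open>a\<close>.\<close>

definition pieri_e :: "'a::comm_ring_1 \<Rightarrow> seq \<Rightarrow> seq \<Rightarrow> 'a" where
  "pieri_e t k c = of_bool (c \<le> k) * Prod_any (\<lambda>a. gauss_binom t (k a - k (Suc a)) (k a - c a))"

lemma pieri_e_eq:
  assumes "\<And>a. b \<le> a \<Longrightarrow> k a = 0"
  shows "pieri_e t k c = of_bool (c \<le> k) * (\<Prod>a<b. gauss_binom t (k a - k (Suc a)) (k a - c a))"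
proof -
  have "a < b" if "gauss_binom t (k a - k (Suc a)) (k a - c a) \<noteq> 1" for a
    using that assms[of a] by (cases "b \<le> a") auto
  then have "{a. gauss_binom t (k a - k (Suc a)) (k a - c a) \<noteq> 1} \<subseteq> {..<b}" by auto
  then show ?thesis
    unfolding pieri_e_def by (subst Prod_any.expand_superset[of "{..<b}"]) auto
qed

text \<open>If \<open>c a < k (Suc a)\<close>, the lower index of the binomial at \<open>a\<close>
  exceeds the upper one. So the coefficient itself enforces that \<open>k\<close> arises from
  \<open>c\<close> by a vertical strip.\<close>

lemma pieri_e_eq_0:
  assumes "is_partition k" "c \<le> k" "\<not> k (Suc a) \<le> c a"
  shows "pieri_e t k c = 0"
proof -
  obtain b where b: "\<And>a. b \<le> Suc a \<Longrightarrow> k a = 0" using is_partition_bound[OF assms(1)] by blast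
  have "k (Suc a) \<le> k a" using is_partition_antimono[OF assms(1)] by (simp add: antimono_def)
  then have "gauss_binom t (k a - k (Suc a)) (k a - c a) = 0"
    using assms(3) by (intro gauss_binom_eq_0) auto
  moreover have "a < b" using b[of "Suc a"] assms(3) by (cases "a < b") auto
  ultimately have "(\<Prod>a<b. gauss_binom t (k a - k (Suc a)) (k a - c a)) = 0"
    by (intro prod_zero) auto
  then show ?thesis using b by (subst pieri_e_eq[of b]) auto
qed

text \<open>The members of this box are the shapes with at most \<open>N\<close> rows that arise
  from \<open>c\<close> by adding a vertical strip: the upper bound \<open>shift N c\<close> says
  \<open>k 0 <= N\<close> and \<open>k (Suc a) <= c a\<close>.\<close>

lemma Box_shift:
  assumes c: "is_partition c" and k: "k \<in> Box c (shift N c)" and b0: "b > 0" and b: "\<And>a. b \<le> Suc a \<Longrightarrow> c a = 0"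
  shows "is_partition k" "c a \<le> k a" "k (Suc a) \<le> c a" "k 0 \<le> N" "b \<le> a \<Longrightarrow> k a = 0"
    "psize k = psize c + (\<Sum>a<b. k a - c a)"
proof -
  have le: "c a \<le> k a" "k a \<le> shift N c a" for a using k by (auto simp: Box_def le_fun_def)
  show 1: "c a \<le> k a" "k (Suc a) \<le> c a" "k 0 \<le> N" for a
    using le[of a] le(2)[of "Suc a"] le(2)[of 0] by auto
  show z: "k a = 0" if "b \<le> a" for a using that 1(2)[of "a - 1"] b[of "a - 1"] b0 by (cases a) auto
  show "is_partition k" by (rule is_partitionI[OF _ z]) (use 1 order_trans in blast)
  have "psize k = (\<Sum>a<b. k a)" by (rule psize_eq) (rule z)
  also have "\<dots> = (\<Sum>a<b. c a + (k a - c a))" using 1(1) by simp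
  also have "\<dots> = psize c + (\<Sum>a<b. k a - c a)"
    unfolding sum.distrib by (subst psize_eq[of b c]) (use b in auto)
  finally show "psize k = psize c + (\<Sum>a<b. k a - c a)" .
qed

text \<open>Distinct variables keep the denominators away from 0, and nonzero ones are used in the
  partial fraction identity. The locale serves both the generic parameter and the Schur
  case.\<close>

locale hl_setting = not_root_of_unity t for t :: "'a::field" +
  fixes x :: "nat \<Rightarrow> 'a"
  assumes inj_x: "inj x" and x_nz: "x i \<noteq> 0"
begin

abbreviation HL :: "nat \<Rightarrow> seq \<Rightarrow> 'a" where
  "HL N c \<equiv> hall_littlewood N x t (conjugate c)"

lemma hl_norm_conjugate_nz: "is_partition c \<Longrightarrow> c 0 \<le> N \<Longrightarrow> hl_norm N t (conjugate c) \<noteq> 0"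
  by (rule is_partition_bound[of c], assumption, subst hl_norm_conjugate) (auto simp: hl_v_nz)

text \<open>The action on symmetrized monomials yields binomials in the block lengths of
  \<open>c\<close>, whereas \<open>pieri_e\<close> has those of \<open>k\<close>. Written with
  \<open>hl_v\<close>, they differ by the ratio of the norms once the factors at
  \<open>shift N c a - k a\<close> are reindexed by one column.\<close>

lemma pieri_e_normalization:
  assumes c: "is_partition c" and N: "c 0 \<le> N" and k: "k \<in> Box c (shift N c)"
    and b0: "b > 0" and b: "\<And>a. b \<le> Suc a \<Longrightarrow> c a = 0"
  shows "(\<Prod>a<b. gauss_binom t (shift N c a - c a) (k a - c a)) * hl_norm N t (conjugate k)
       = pieri_e t k c * hl_norm N t (conjugate c)"
proof -
  note B = Box_shift[OF c k b0 b]
  define v where "v = hl_v t"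
  have vnz: "v m \<noteq> 0" for m by (simp add: v_def hl_v_nz)
  have g: "gauss_binom t n m = v n / (v m * v (n - m))" if "m \<le> n" for n m
    using that by (simp add: v_def gauss_binom_eq_hl_v)
  have ks: "k a \<le> shift N c a" for a using k by (auto simp: Box_def le_fun_def)
  have Vk: "hl_norm N t (conjugate k) = v (N - k 0) * (\<Prod>a<b. v (k a - k (Suc a)))"
    unfolding v_def
    by (subst hl_norm_conjugate[OF B(1,4), of "Suc b"]) (use B(5) in \<open>auto simp: prod.lessThan_Suc_shift simp del: prod.lessThan_Suc\<close>)
  have Vc: "hl_norm N t (conjugate c) = (\<Prod>a<b. v (shift N c a - c a))"
    unfolding v_def by (rule hl_norm_conjugate[OF c N b0 b])
  \<comment> \<open>The added factor at \<open>a = b\<close> is \<open>v 0 = 1\<close>; it makes up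
    for the factor at \<open>a = 0\<close>, which is then split off.\<close>
  have "(\<Prod>a<b. v (shift N c a - k a)) = (\<Prod>a<Suc b. v (shift N c a - k a))"
    using b[of "b - 1"] b0 B(5)[of b] by (cases b) (simp_all add: v_def)
  also have "\<dots> = v (N - k 0) * (\<Prod>a<b. v (c a - k (Suc a)))"
    by (simp add: prod.lessThan_Suc_shift del: prod.lessThan_Suc)
  finally have S: "(\<Prod>a<b. v (shift N c a - k a)) = v (N - k 0) * (\<Prod>a<b. v (c a - k (Suc a)))" .
  have "(\<Prod>a<b. gauss_binom t (shift N c a - c a) (k a - c a)) =
    (\<Prod>a<b. v (shift N c a - c a) / (v (k a - c a) * v (shift N c a - k a)))"
  proof (rule prod.cong[OF refl])
    fix a
    show "gauss_binom t (shift N c a - c a) (k a - c a) =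
      v (shift N c a - c a) / (v (k a - c a) * v (shift N c a - k a))"
      using B(2)[of a] ks[of a] by (subst g) auto
  qed
  moreover have "pieri_e t k c = (\<Prod>a<b. v (k a - k (Suc a)) / (v (k a - c a) * v (c a - k (Suc a))))"
  proof -
    have "c \<le> k" using B(2) by (simp add: le_fun_def)
    then have "pieri_e t k c = (\<Prod>a<b. gauss_binom t (k a - k (Suc a)) (k a - c a))"
      using B(5) by (subst pieri_e_eq[of b]) auto
    also have "\<dots> = (\<Prod>a<b. v (k a - k (Suc a)) / (v (k a - c a) * v (c a - k (Suc a))))"
    proof (rule prod.cong[OF refl])
      fix a
      show "gauss_binom t (k a - k (Suc a)) (k a - c a) =
        v (k a - k (Suc a)) / (v (k a - c a) * v (c a - k (Suc a)))"
        using B(2)[of a] B(3)[of a] by (subst g) auto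
    qed
    finally show ?thesis .
  qed
  moreover have "(\<Prod>a<b. v (f a)) \<noteq> 0" for f using vnz by simp
  ultimately show ?thesis
    unfolding Vk Vc by (simp add: prod_dividef prod.distrib S vnz)
qed

text \<open>If \<open>c\<close> has more than \<open>N\<close> rows, so has every \<open>k\<close>
  above it, and both sides vanish. Otherwise the sum over the box extends to all partitions of the
  right size, as any further \<open>k\<close> fails to contain \<open>c\<close>, is too long, or is
  not reached by a vertical strip.\<close>

theorem esym_times_HL:
  assumes c: "is_partition c"
  shows "esym N x r * HL N c = (\<Sum>k\<in>partitions_of (psize c + r). pieri_e t k c * HL N k)"
proof (cases "c 0 \<le> N")
  case False
  have "pieri_e t k c * HL N k = 0" if "k \<in> partitions_of (psize c + r)" for k
  proof (cases "c \<le> k")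
    case True
    then have "\<not> k 0 \<le> N" using False by (meson le_funD order_trans)
    then show ?thesis using that by (simp add: hall_littlewood_conjugate partitions_of_def)
  qed (simp add: pieri_e_def)
  then have "(\<Sum>k\<in>partitions_of (psize c + r). pieri_e t k c * HL N k) = 0"
    by (intro sum.neutral ballI)
  then show ?thesis using False by (simp add: hall_littlewood_conjugate[OF c])
next
  case True
  obtain b where b0: "b > 0" and b: "\<And>a. b \<le> Suc a \<Longrightarrow> c a = 0" using is_partition_bound[OF c] by blast
  note B = Box_shift[OF c _ b0 b]
  have finb: "finite (Box c (shift N c))"
  proof (rule finite_Box)
    have "shift N c a = 0" if "b \<le> a" for a using that b0 b[of "a - 1"] by (cases a) auto
    then have "{a. shift N c a \<noteq> 0} \<subseteq> {..<b}"
      by (metis (mono_tags) lessThan_iff mem_Collect_eq not_le subsetI)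
    then show "finite {a. shift N c a \<noteq> 0}" by (rule finite_subset) simp
  qed
  have "esym N x r * HL N c = (\<Sum>k\<in>Box c (shift N c).
      of_bool ((\<Sum>a<b. k a - c a) = r) * (\<Prod>a<b. gauss_binom t (shift N c a - c a) (k a - c a)) *
      hl_sym N x t (conjugate k)) / hl_norm N t (conjugate c)"
    using esym_times_hl_sym_conjugate[OF inj_x is_partition_antimono[OF c] True b0 b, of r t] True
    by (simp add: hall_littlewood_conjugate[OF c])
  also have "\<dots> = (\<Sum>k\<in>Box c (shift N c). of_bool (psize k = psize c + r) * (pieri_e t k c * HL N k))"
    unfolding sum_divide_distrib
  proof (rule sum.cong[OF refl])
    fix k assume k: "k \<in> Box c (shift N c)"
    have nz: "hl_norm N t (conjugate k) \<noteq> 0" "hl_norm N t (conjugate c) \<noteq> 0"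
      using hl_norm_conjugate_nz B(1,4)[OF k] c True by auto
    have "(\<Prod>a<b. gauss_binom t (shift N c a - c a) (k a - c a)) * hl_sym N x t (conjugate k) / hl_norm N t (conjugate c)
      = pieri_e t k c * HL N k"
      using pieri_e_normalization[OF c True k b0 b] nz B(1,4)[OF k]
      by (simp add: hall_littlewood_conjugate field_simps)
    moreover have "(\<Sum>a<b. k a - c a) = r \<longleftrightarrow> psize k = psize c + r" using B(6)[OF k] by simp
    ultimately show "of_bool ((\<Sum>a<b. k a - c a) = r) * (\<Prod>a<b. gauss_binom t (shift N c a - c a) (k a - c a)) *
      hl_sym N x t (conjugate k) / hl_norm N t (conjugate c) =
      of_bool (psize k = psize c + r) * (pieri_e t k c * HL N k)" by simp
  qed
  also have "\<dots> = (\<Sum>k\<in>{k \<in> Box c (shift N c). psize k = psize c + r}. pieri_e t k c * HL N k)"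
    unfolding sum.inter_filter[OF finb] by (rule sum.cong) auto
  also have "\<dots> = (\<Sum>k\<in>partitions_of (psize c + r). pieri_e t k c * HL N k)"
  proof (rule sum.mono_neutral_left[OF finite_partitions_of])
    show "{k \<in> Box c (shift N c). psize k = psize c + r} \<subseteq> partitions_of (psize c + r)"
      using B(1) by (auto simp: partitions_of_def)
    show "\<forall>k\<in>partitions_of (psize c + r) - {k \<in> Box c (shift N c). psize k = psize c + r}.
      pieri_e t k c * HL N k = 0"
    proof
      fix k assume k: "k \<in> partitions_of (psize c + r) - {k \<in> Box c (shift N c). psize k = psize c + r}"
      then have kp: "is_partition k" and nb: "k \<notin> Box c (shift N c)" by (auto simp: partitions_of_def)
      show "pieri_e t k c * HL N k = 0"
      proof (rule ccontr)
        assume nz: "pieri_e t k c * HL N k \<noteq> 0"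
        then have ck: "c \<le> k" by (auto simp: pieri_e_def)
        have "k 0 \<le> N" using nz hall_littlewood_conjugate[OF kp, of N x t] by (cases "k 0 \<le> N") auto
        moreover have "k (Suc a) \<le> c a" for a using pieri_e_eq_0[OF kp ck] nz by fastforce
        ultimately have "k a \<le> shift N c a" for a by (cases a) auto
        then show False using nb ck by (auto simp: Box_def le_fun_def)
      qed
    qed
  qed
  finally show ?thesis .
qed

end

section \<open>The Pieri rule for complete symmetric functions\<close>

text \<open>This is the factor that a single step of a flag contributes to the right-hand side of
  the theorem. There is no strip condition: for generic \<open>t\<close> every \<open>l\<close>
  containing \<open>c\<close> occurs.\<close>

definition pieri_h :: "'a::comm_ring_1 \<Rightarrow> seq \<Rightarrow> seq \<Rightarrow> 'a" where
  "pieri_h t l c = of_bool (c \<le> l) * Prod_any (\<lambda>a. t ^ ((l a - c a) choose 2) *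
     gauss_binom t (l a - c (Suc a)) (c a - c (Suc a)))"

lemma pieri_h_eq:
  assumes "\<And>a. b \<le> a \<Longrightarrow> l a = 0"
  shows "pieri_h t l c = of_bool (c \<le> l) * (\<Prod>a<b. t ^ ((l a - c a) choose 2) *
     gauss_binom t (l a - c (Suc a)) (c a - c (Suc a)))"
proof (cases "c \<le> l")
  case True
  have "a < b" if "t ^ ((l a - c a) choose 2) *
     gauss_binom t (l a - c (Suc a)) (c a - c (Suc a)) \<noteq> 1" for a
  proof (rule ccontr)
    assume "\<not> a < b"
    then have "l a = 0" "c a = 0" using assms[of a] True by (auto simp: le_fun_def dest: spec[of _ a])
    then show False using that by (simp add: numeral_2_eq_2)
  qed
  then have "{a. t ^ ((l a - c a) choose 2) *
     gauss_binom t (l a - c (Suc a)) (c a - c (Suc a)) \<noteq> 1} \<subseteq> {..<b}" by blast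
  then show ?thesis
    unfolding pieri_h_def by (subst Prod_any.expand_superset[of "{..<b}"]) auto
qed (simp add: pieri_h_def)

lemma pieri_h_self: "pieri_h t c c = 1"
  by (simp add: pieri_h_def numeral_2_eq_2)

text \<open>The coefficients \<open>pieri_e\<close> and \<open>pieri_h\<close> turn out to be inverse to each other up to signs.
  By the trinomial revision, each summand of the relevant sum over \<open>k\<close> is of the following form, in
  which the smallest \<open>i\<close> with \<open>c i < l i\<close> contributes an alternating sum that vanishes.\<close>

lemma (in not_root_of_unity) sum_Box_alternating:
  assumes l: "antimono l" and cl: "c \<le> l" "c \<noteq> l" and b: "\<And>a. b \<le> a \<Longrightarrow> l a = 0"
  shows "(\<Sum>k\<in>Box c l. \<Prod>a<b.
     of_bool (k (Suc a) \<le> c a) * gauss_binom t (l a - k (Suc a)) (c a - k (Suc a)) *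
     ((- 1) ^ (k a - c a) * t ^ ((l a - k a) choose 2) * gauss_binom t (l a - c a) (k a - c a))) = 0"
proof -
  define f where "f a v = of_bool (v \<le> c a) * gauss_binom t (l a - v) (c a - v)" for a v
  define g where "g a v = (- 1) ^ (v - c a) * t ^ ((l a - v) choose 2) * gauss_binom t (l a - c a) (v - c a)" for a v
  have le: "c a \<le> l a" for a using cl by (simp add: le_fun_def)
  have ex: "\<exists>i. c i < l i" using cl le by (metis ext le_neq_implies_less)
  define i where "i = (LEAST i. c i < l i)"
  have i: "c i < l i" unfolding i_def using ex by (rule LeastI_ex)
  have lt: "l a = c a" if "a < i" for a
    using not_less_Least[OF that[unfolded i_def]] le[of a] by simp
  have ib: "i < b" using b[of i] i by (cases "i < b") auto
  \<comment> \<open>Besides \<open>g i\<close>, only the factor \<open>f\<close> at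
    \<open>i - 1\<close> involves coordinate \<open>i\<close>. There \<open>l\<close> and
    \<open>c\<close> agree by minimality of \<open>i\<close>, so its binomial has equal indices and
    is 1; hence coordinate \<open>i\<close> can be summed on its own.\<close>
  have f1: "f a v = 1" if "Suc a = i" "v \<le> l i" for a v
  proof -
    have "l a = c a" using lt that by simp
    moreover have "l i \<le> l a" using l that by (auto simp: antimono_def)
    ultimately show ?thesis using that by (simp add: f_def)
  qed
  have S: "(\<Sum>v\<in>{c i..l i}. g i v) = 0"
  proof -
    have "(\<Sum>v\<in>{c i..l i}. g i v) = (\<Sum>j\<le>l i - c i. (- 1) ^ j * t ^ ((l i - c i - j) choose 2) * gauss_binom t (l i - c i) j)"
      by (rule sum.reindex_bij_witness[where i = "\<lambda>j. c i + j" and j = "\<lambda>v. v - c i"])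
        (use i in \<open>auto simp: g_def\<close>)
    also have "\<dots> = 0" unfolding gauss_binom_alternating_sum using i by simp
    finally show ?thesis .
  qed
  define Z where "Z k = f i (k (Suc i)) * (\<Prod>a\<in>{..<b} - {i}. (if Suc a = i then 1 else f a (k (Suc a))) * g a (k a))" for k :: seq
  have "(\<Sum>k\<in>Box c l. \<Prod>a<b. f a (k (Suc a)) * g a (k a)) =
    (\<Sum>k\<in>Box c (l(i := c i)). \<Sum>v\<in>{c i..l i}. \<Prod>a<b. f a ((k(i := v)) (Suc a)) * g a ((k(i := v)) a))"
    by (rule sum_Box_split) (rule le)
  also have "\<dots> = (\<Sum>k\<in>Box c (l(i := c i)). \<Sum>v\<in>{c i..l i}. Z k * g i v)"
  proof (intro sum.cong[OF refl])
    fix k v assume v: "v \<in> {c i..l i}"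
    have "(\<Prod>a<b. f a ((k(i := v)) (Suc a)) * g a ((k(i := v)) a)) =
      f i (k (Suc i)) * g i v * (\<Prod>a\<in>{..<b} - {i}. f a ((k(i := v)) (Suc a)) * g a ((k(i := v)) a))"
      using ib by (subst prod.remove[of _ i]) auto
    also have "(\<Prod>a\<in>{..<b} - {i}. f a ((k(i := v)) (Suc a)) * g a ((k(i := v)) a)) =
      (\<Prod>a\<in>{..<b} - {i}. (if Suc a = i then 1 else f a (k (Suc a))) * g a (k a))"
      by (rule prod.cong[OF refl]) (use f1 v in auto)
    finally show "(\<Prod>a<b. f a ((k(i := v)) (Suc a)) * g a ((k(i := v)) a)) = Z k * g i v"
      by (simp add: Z_def mult_ac)
  qed
  also have "\<dots> = 0" by (simp add: S flip: sum_distrib_left)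
  finally show ?thesis by (simp only: f_def g_def)
qed

text \<open>Where \<open>pieri_e\<close> does not vanish, \<open>k (Suc a) <= c a <= k a\<close>
  holds, so that \<open>k\<close> is automatically a partition. The sum over partitions thus becomes
  a sum over the whole box, in which coordinates vary independently and the strip condition survives
  as an indicator.\<close>

lemma (in not_root_of_unity) sum_pieri_e_pieri_h:
  assumes c: "is_partition c" and l: "is_partition l" and cl: "c \<le> l" "c \<noteq> l"
  shows "(\<Sum>k\<in>{k \<in> Box c l. is_partition k}. (- 1) ^ (psize k - psize c) * pieri_e t k c * pieri_h t l k) = 0"
proof -
  obtain b where b: "\<And>a. b \<le> Suc a \<Longrightarrow> l a = 0" using is_partition_bound[OF l] by blast
  then have lb: "l a = 0" if "b \<le> a" for a using that by simp
  have cb: "c a = 0" if "b \<le> a" for a using lb[OF that] cl by (auto simp: le_fun_def dest: spec[of _ a])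
  have fin: "finite (Box c l)" using l by (intro finite_Box) (simp add: is_partition_def)
  define T where "T k a = of_bool (k (Suc a) \<le> c a) * gauss_binom t (l a - k (Suc a)) (c a - k (Suc a)) *
     ((- 1) ^ (k a - c a) * t ^ ((l a - k a) choose 2) * gauss_binom t (l a - c a) (k a - c a))" for k a
  define I where "I = {k \<in> Box c l. \<forall>a. k (Suc a) \<le> c a}"
  have kb: "k a = 0" if "k \<in> Box c l" "b \<le> a" for k a
    using that lb[of a] by (auto simp: Box_def le_fun_def dest!: spec[of _ a])
  have Ip: "is_partition k" if "k \<in> I" for k
  proof (rule is_partitionI)
    fix a show "k (Suc a) \<le> k a"
      using that by (auto simp: I_def Box_def le_fun_def intro: order_trans)
  qed (use that kb in \<open>auto simp: I_def\<close>)
  have "(\<Sum>k\<in>{k \<in> Box c l. is_partition k}. (- 1) ^ (psize k - psize c) * pieri_e t k c * pieri_h t l k) =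
    (\<Sum>k\<in>I. \<Prod>a<b. T k a)"
  proof (rule sum.mono_neutral_cong_right)
    show "\<forall>k\<in>{k \<in> Box c l. is_partition k} - I. (- 1) ^ (psize k - psize c) * pieri_e t k c * pieri_h t l k = 0"
    proof
      fix k assume "k \<in> {k \<in> Box c l. is_partition k} - I"
      then obtain a where "is_partition k" "c \<le> k" "\<not> k (Suc a) \<le> c a" by (auto simp: I_def Box_def)
      then have "pieri_e t k c = 0" by (rule pieri_e_eq_0)
      then show "(- 1) ^ (psize k - psize c) * pieri_e t k c * pieri_h t l k = 0" by simp
    qed
    fix k assume k: "k \<in> I"
    then have kB: "k \<in> Box c l" and ks: "\<And>a. k (Suc a) \<le> c a" by (auto simp: I_def)
    have ck: "c a \<le> k a" and kl: "k a \<le> l a" for a using kB by (auto simp: Box_def le_fun_def)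
    have "psize k = (\<Sum>a<b. k a)" "psize c = (\<Sum>a<b. c a)"
      using kb[OF kB] cb by (auto intro: psize_eq)
    then have "psize k - psize c = (\<Sum>a<b. k a - c a)"
      using ck by (simp add: sum_subtractf_nat)
    then have s: "(- 1) ^ (psize k - psize c) = (\<Prod>a<b. (- 1 :: 'a) ^ (k a - c a))"
      by (simp add: power_sum)
    have 1: "pieri_e t k c = (\<Prod>a<b. gauss_binom t (k a - k (Suc a)) (k a - c a))"
      using ck by (subst pieri_e_eq[OF kb[OF kB]]) (auto simp: le_fun_def)
    have 2: "pieri_h t l k = (\<Prod>a<b. t ^ ((l a - k a) choose 2) *
     gauss_binom t (l a - k (Suc a)) (k a - k (Suc a)))"
      using kl by (subst pieri_h_eq[OF lb]) (auto simp: le_fun_def)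
    show "(- 1) ^ (psize k - psize c) * pieri_e t k c * pieri_h t l k = (\<Prod>a<b. T k a)"
      unfolding s 1 2 prod.distrib[symmetric]
    proof (rule prod.cong[OF refl])
      fix a
      have "gauss_binom t (l a - k (Suc a)) (k a - k (Suc a)) * gauss_binom t (k a - k (Suc a)) (k a - c a)
        = gauss_binom t (l a - k (Suc a)) (c a - k (Suc a)) * gauss_binom t (l a - c a) (k a - c a)"
        by (rule gauss_binom_trinomial_revision) (use ck kl ks in auto)
      then show "(- 1) ^ (k a - c a) * gauss_binom t (k a - k (Suc a)) (k a - c a) *
         (t ^ (l a - k a choose 2) * gauss_binom t (l a - k (Suc a)) (k a - k (Suc a))) = T k a"
        using ks[of a] by (simp add: T_def mult_ac)
    qed
  qed (use fin Ip in \<open>auto simp: I_def\<close>)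
  also have "\<dots> = (\<Sum>k\<in>Box c l. \<Prod>a<b. T k a)"
  proof (rule sum.mono_neutral_left[OF fin])
    show "\<forall>k\<in>Box c l - I. (\<Prod>a<b. T k a) = 0"
    proof
      fix k assume k: "k \<in> Box c l - I"
      then obtain a where a: "\<not> k (Suc a) \<le> c a" by (auto simp: I_def)
      then have "a < b" using kb[of k "Suc a"] k by (cases "a < b") auto
      then show "(\<Prod>a<b. T k a) = 0" using a by (intro prod_zero) (auto simp: T_def)
    qed
  qed (auto simp: I_def)
  also have "\<dots> = 0"
    unfolding T_def by (rule sum_Box_alternating[OF is_partition_antimono[OF l] cl lb])
  finally show ?thesis .
qed

text \<open>The recursion is the relation \<open>\<Sum> (-1)\<^sup>i e\<^sub>i h\<^bsub>m-i\<^esub> = 0\<close>.\<close>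

fun hsym :: "nat \<Rightarrow> (nat \<Rightarrow> 'a::comm_ring_1) \<Rightarrow> nat \<Rightarrow> 'a" where
  "hsym N x 0 = 1"
| "hsym N x (Suc m) = (\<Sum>i\<le>m. (- 1) ^ i * esym N x (Suc i) * hsym N x (m - i))"

text \<open>This is the recursion of \<open>hsym\<close> on the level of coefficients. It isolates
  the term of size 0 in the vanishing alternating sum, where only \<open>k = c\<close>
  contributes.\<close>

lemma (in not_root_of_unity) alternating_sum_pieri:
  assumes c: "is_partition c" and l: "l \<in> partitions_of (psize c + Suc m)"
  shows "(\<Sum>i\<le>m. (- 1) ^ i * (\<Sum>k\<in>partitions_of (psize c + Suc i). pieri_e t k c * pieri_h t l k)) = pieri_h t l c"
proof -
  have lp: "is_partition l" "psize l = psize c + Suc m" using l by (auto simp: partitions_of_def)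
  define X where "X i = (\<Sum>k\<in>partitions_of (psize c + i). pieri_e t k c * pieri_h t l k)" for i
  have "(\<Sum>i\<le>Suc m. (- 1) ^ i * X i) = 0"
  proof (cases "c \<le> l")
    case False
    have "pieri_e t k c * pieri_h t l k = 0" for k
      using False order_trans by (auto simp: pieri_e_def pieri_h_def)
    then have "X i = 0" for i unfolding X_def by (intro sum.neutral ballI)
    then show ?thesis by simp
  next
    case True
    define K where "K = {k \<in> Box c l. is_partition k}"
    have fin: "finite K" unfolding K_def using lp by (intro finite_subset[OF _ finite_Box[of l c]]) (auto simp: is_partition_def)
    have X: "X i = (\<Sum>k\<in>K. of_bool (psize k = psize c + i) * (pieri_e t k c * pieri_h t l k))" for i
    proof -
      have "X i = (\<Sum>k\<in>{k \<in> K. psize k = psize c + i}. pieri_e t k c * pieri_h t l k)"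
        unfolding X_def
      proof (rule sum.mono_neutral_right[OF finite_partitions_of])
        show "\<forall>k\<in>partitions_of (psize c + i) - {k \<in> K. psize k = psize c + i}. pieri_e t k c * pieri_h t l k = 0"
          by (auto simp: partitions_of_def K_def Box_def pieri_e_def pieri_h_def)
      qed (auto simp: partitions_of_def K_def)
      also have "\<dots> = (\<Sum>k\<in>K. of_bool (psize k = psize c + i) * (pieri_e t k c * pieri_h t l k))"
        unfolding sum.inter_filter[OF fin] by (rule sum.cong) auto
      finally show ?thesis .
    qed
    have "(\<Sum>i\<le>Suc m. (- 1) ^ i * X i) =
      (\<Sum>k\<in>K. (\<Sum>i\<le>Suc m. (- 1) ^ i * of_bool (psize k = psize c + i)) * (pieri_e t k c * pieri_h t l k))"
      unfolding X sum_distrib_left sum_distrib_right by (subst sum.swap) (simp add: mult_ac)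
    also have "\<dots> = (\<Sum>k\<in>K. (- 1) ^ (psize k - psize c) * pieri_e t k c * pieri_h t l k)"
    proof (rule sum.cong[OF refl])
      fix k assume k: "k \<in> K"
      then have "psize c \<le> psize k" "psize k \<le> psize l"
        using psize_mono lp(1) by (auto simp: K_def Box_def)
      then have "(\<Sum>i\<le>Suc m. (- 1) ^ i * of_bool (psize k = psize c + i)) =
         (\<Sum>i\<le>Suc m. if i = psize k - psize c then (- 1 :: 'a) ^ i else 0)"
        by (intro sum.cong) auto
      also have "\<dots> = (- 1) ^ (psize k - psize c)"
        using \<open>psize k \<le> psize l\<close> lp(2) by (subst sum.delta) auto
      finally show "(\<Sum>i\<le>Suc m. (- 1) ^ i * of_bool (psize k = psize c + i)) * (pieri_e t k c * pieri_h t l k)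
         = (- 1) ^ (psize k - psize c) * pieri_e t k c * pieri_h t l k"
        by (simp add: mult.assoc)
    qed
    also have "\<dots> = 0"
      unfolding K_def using lp by (intro sum_pieri_e_pieri_h[OF c lp(1) True]) auto
    finally show ?thesis .
  qed
  moreover have "X 0 = pieri_h t l c"
  proof -
    have "X 0 = (\<Sum>k\<in>{c}. pieri_e t k c * pieri_h t l k)"
      unfolding X_def
    proof (rule sum.mono_neutral_right[OF finite_partitions_of])
      show "\<forall>k\<in>partitions_of (psize c + 0) - {c}. pieri_e t k c * pieri_h t l k = 0"
      proof
        fix k assume k: "k \<in> partitions_of (psize c + 0) - {c}"
        then have "\<not> c \<le> k" using psize_le_eq[of c k] by (auto simp: partitions_of_def)
        then show "pieri_e t k c * pieri_h t l k = 0" by (simp add: pieri_e_def)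
      qed
    qed (use c in \<open>auto simp: partitions_of_def\<close>)
    moreover have "pieri_e t c c = 1" by (simp add: pieri_e_def)
    ultimately show ?thesis by simp
  qed
  ultimately have "pieri_h t l c - (\<Sum>i\<le>m. (- 1) ^ i * X (Suc i)) = 0"
    unfolding sum.atMost_Suc_shift by (simp add: sum_negf)
  then show ?thesis by (simp add: X_def)
qed

text \<open>The recursion of \<open>hsym\<close> expresses the product through the rule for
  \<open>esym\<close> and smaller complete functions acting on other shapes; the resulting
  coefficients satisfy the recursion of \<open>pieri_h\<close>.\<close>

theorem (in hl_setting) hsym_times_HL:
  assumes "is_partition c"
  shows "hsym N x m * HL N c = (\<Sum>l\<in>partitions_of (psize c + m). pieri_h t l c * HL N l)"
  using assms
proof (induction m arbitrary: c rule: less_induct)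
  case (less m)
  note c = less.prems
  show ?case
  proof (cases m)
    case 0
    have "(\<Sum>l\<in>partitions_of (psize c + 0). pieri_h t l c * HL N l) = (\<Sum>l\<in>{c}. pieri_h t l c * HL N l)"
    proof (rule sum.mono_neutral_right[OF finite_partitions_of])
      show "\<forall>k\<in>partitions_of (psize c + 0) - {c}. pieri_h t k c * HL N k = 0"
      proof
        fix k assume k: "k \<in> partitions_of (psize c + 0) - {c}"
        then have "\<not> c \<le> k" using psize_le_eq[of c k] by (auto simp: partitions_of_def)
        then show "pieri_h t k c * HL N k = 0" by (simp add: pieri_h_def)
      qed
    qed (use c in \<open>auto simp: partitions_of_def\<close>)
    then show ?thesis using 0 by (simp add: pieri_h_self)
  next
    case (Suc m')
    let ?P = "\<lambda>i. partitions_of (psize c + Suc i)"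
    have "hsym N x m * HL N c = (\<Sum>i\<le>m'. (- 1) ^ i * (hsym N x (m' - i) * (esym N x (Suc i) * HL N c)))"
      unfolding Suc hsym.simps sum_distrib_right by (simp add: mult_ac)
    also have "\<dots> = (\<Sum>i\<le>m'. (- 1) ^ i * (\<Sum>k\<in>?P i. pieri_e t k c * (hsym N x (m' - i) * HL N k)))"
      unfolding esym_times_HL[OF c] by (simp add: sum_distrib_left mult_ac)
    also have "\<dots> = (\<Sum>i\<le>m'. (- 1) ^ i * (\<Sum>k\<in>?P i. pieri_e t k c * (\<Sum>l\<in>?P m'. pieri_h t l k * HL N l)))"
    proof (intro sum.cong[OF refl] arg_cong2[where f = "(*)"] refl)
      fix i k assume i: "i \<in> {..m'}" and k: "k \<in> ?P i"
      have "psize k + (m' - i) = psize c + Suc m'" using i k by (auto simp: partitions_of_def)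
      then show "hsym N x (m' - i) * HL N k = (\<Sum>l\<in>?P m'. pieri_h t l k * HL N l)"
        using less.IH[of "m' - i" k] Suc k by (simp add: partitions_of_def)
    qed
    also have "\<dots> = (\<Sum>l\<in>?P m'. (\<Sum>i\<le>m'. (- 1) ^ i * (\<Sum>k\<in>?P i. pieri_e t k c * pieri_h t l k)) * HL N l)"
    proof -
      have "(\<Sum>k\<in>?P i. pieri_e t k c * (\<Sum>l\<in>?P m'. pieri_h t l k * HL N l)) =
        (\<Sum>l\<in>?P m'. (\<Sum>k\<in>?P i. pieri_e t k c * pieri_h t l k) * HL N l)" for i
        unfolding sum_distrib_left sum_distrib_right by (subst sum.swap) (simp add: mult_ac)
      then show ?thesis
        unfolding sum_distrib_right by (subst sum.swap) (simp add: sum_distrib_left mult_ac)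
    qed
    also have "\<dots> = (\<Sum>l\<in>?P m'. pieri_h t l c * HL N l)"
      by (rule sum.cong[OF refl]) (simp only: alternating_sum_pieri[OF c])
    finally show ?thesis using Suc by simp
  qed
qed

section \<open>Schur functions\<close>

definition vdm :: "nat \<Rightarrow> (nat \<Rightarrow> 'a::comm_ring_1) \<Rightarrow> 'a" where
  "vdm N x = (\<Prod>(i, j)\<in>pairs N. x i - x j)"

lemma vdm_adjacent:
  assumes i: "Suc i < N"
  shows "vdm N (x \<circ> transpose i (Suc i)) = - vdm N x"
proof -
  let ?s = "transpose i (Suc i)"
  let ?Q = "pairs N - {(i, Suc i)}"
  have r: "vdm N y = (y i - y (Suc i)) * (\<Prod>(j, k)\<in>?Q. y j - y k)" for y :: "nat \<Rightarrow> 'a"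
    unfolding vdm_def using i by (subst prod.remove[of _ "(i, Suc i)"]) (auto simp: pairs_def finite_pairs[unfolded pairs_def])
  have "(\<Prod>(j, k)\<in>?Q. (x \<circ> ?s) j - (x \<circ> ?s) k) = (\<Prod>(j, k)\<in>?Q. x j - x k)"
    by (rule prod.reindex_bij_witness[where i = "\<lambda>(j, k). (?s j, ?s k)" and j = "\<lambda>(j, k). (?s j, ?s k)"])
      (use i in \<open>auto simp: pairs_def transpose_def split: if_splits\<close>)
  then show ?thesis unfolding r by (simp add: algebra_simps)
qed

text \<open>A transposition is conjugate, by an adjacent one, to a transposition of closer indices;
  the three sign changes amount to one.\<close>

lemma vdm_transpose:
  assumes "a < b" "b < N"
  shows "vdm N (x \<circ> transpose a b) = - vdm N x"
  using assms
proof (induction b arbitrary: x)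
  case 0
  then show ?case by simp
next
  case (Suc b)
  show ?case
  proof (cases "a = b")
    case True
    then show ?thesis using vdm_adjacent Suc.prems by blast
  next
    case False
    then have ab: "a < b" using Suc.prems by simp
    let ?s = "transpose b (Suc b)"
    have "transpose a (Suc b) = ?s \<circ> transpose a b \<circ> ?s"
      using ab by (auto simp: fun_eq_iff transpose_def)
    then have "x \<circ> transpose a (Suc b) = ((x \<circ> ?s) \<circ> transpose a b) \<circ> ?s" by (simp add: comp_assoc)
    then have "vdm N (x \<circ> transpose a (Suc b)) = - vdm N ((x \<circ> ?s) \<circ> transpose a b)"
      using vdm_adjacent[OF Suc.prems(2)] by metis
    also have "vdm N ((x \<circ> ?s) \<circ> transpose a b) = - vdm N (x \<circ> ?s)"
      using Suc.prems ab by (intro Suc.IH) auto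
    finally show ?thesis using vdm_adjacent[OF Suc.prems(2), of x] by simp
  qed
qed

lemma vdm_permutes:
  assumes "w permutes {..<N}"
  shows "vdm N (x \<circ> w) = of_int (sign w) * vdm N x"
  using assms finite_lessThan
proof (induction w arbitrary: x rule: permutes_induct)
  case id
  then show ?case by simp
next
  case (swap a b p)
  have "vdm N (x \<circ> transpose a b) = - vdm N x"
    using vdm_transpose[of a b N x] vdm_transpose[of b a N x] swap.hyps
    by (cases "a < b") (auto simp: transpose_commute)
  moreover have "vdm N (x \<circ> (transpose a b \<circ> p)) = of_int (sign p) * vdm N (x \<circ> transpose a b)"
    using swap.IH[of "x \<circ> transpose a b"] by (simp only: comp_assoc)
  moreover have "permutation p" using swap.hyps(4) permutes_imp_permutation by blast
  then have "sign (transpose a b \<circ> p) = - sign p"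
    using swap.hyps(3) by (simp add: sign_compose permutation_swap_id sign_swap_id)
  ultimately show ?case by (simp only: of_int_minus mult_minus_left mult_minus_right)
qed

lemma vdm_nz:
  fixes x :: "nat \<Rightarrow> 'a::field"
  shows "inj x \<Longrightarrow> vdm N x \<noteq> 0"
  unfolding vdm_def by (subst prod_zero_iff) (auto simp: pairs_def finite_pairs[unfolded pairs_def] inj_eq)

definition alternant :: "nat \<Rightarrow> (nat \<Rightarrow> 'a::comm_ring_1) \<Rightarrow> seq \<Rightarrow> 'a" where
  "alternant N x \<beta> = (\<Sum>w | w permutes {..<N}. of_int (sign w) * (\<Prod>i<N. x (w i) ^ \<beta> i))"

lemma det_eq_alternant: "det (mat N N (\<lambda>(i, j). x i ^ \<beta> j)) = alternant N x \<beta>"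
proof -
  have "det (mat N N (\<lambda>(i, j). x i ^ \<beta> j)) =
    (\<Sum>w | w permutes {0..<N}. of_int (sign w) * (\<Prod>i<N. mat N N (\<lambda>(i, j). x i ^ \<beta> j) $$ (w i, i)))"
    by (rule det_col) simp
  also have "\<dots> = (\<Sum>w | w permutes {0..<N}. of_int (sign w) * (\<Prod>i<N. x (w i) ^ \<beta> i))"
  proof (rule sum.cong[OF refl])
    fix w assume "w \<in> {w. w permutes {0..<N}}"
    then have "w permutes {0..<N}" by simp
    then have wN: "w i < N" if "i < N" for i using permutes_in_image[of w "{0..<N}" i] that by simp
    show "of_int (sign w) * (\<Prod>i<N. mat N N (\<lambda>(i, j). x i ^ \<beta> j) $$ (w i, i)) =
      of_int (sign w) * (\<Prod>i<N. x (w i) ^ \<beta> i)"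
      using wN by (intro arg_cong2[where f = "(*)"] prod.cong) auto
  qed
  finally show ?thesis by (simp add: alternant_def lessThan_atLeast0)
qed

text \<open>Index \<open>i\<close> is the first entry of \<open>N - 1 - i\<close> pairs. This is
  where the staircase exponents of the alternants come from.\<close>

lemma prod_pairs_fst: "(\<Prod>(i, j)\<in>pairs N. y i) = (\<Prod>i<N. y i ^ (N - 1 - i))"
proof -
  have "pairs N = Sigma {..<N} (\<lambda>i. {Suc i..<N})" by (auto simp: pairs_def)
  then show ?thesis by (simp add: prod.Sigma[symmetric])
qed

text \<open>At \<open>t = 0\<close> the numerators of the pair factors multiply to the staircase
  monomial. The denominators multiply to the permuted Vandermonde product, which differs from
  \<open>vdm\<close> by the sign that makes the sum an alternant.\<close>

lemma hl_sym_zero: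
  assumes "inj x"
  shows "hl_sym N x 0 p = alternant N x (\<lambda>i. p i + (N - 1 - i)) / vdm N x"
proof -
  have "hl_sym N x 0 p = (\<Sum>w | w permutes {..<N}. of_int (sign w) * (\<Prod>i<N. x (w i) ^ (p i + (N - 1 - i))) / vdm N x)"
    unfolding hl_sym_def
  proof (rule sum.cong[OF refl])
    fix w assume "w \<in> {w. w permutes {..<N}}"
    then have w: "w permutes {..<N}" by simp
    have 1: "(\<Prod>(i, j)\<in>pairs N. (x (w i) - 0 * x (w j)) / (x (w i) - x (w j))) =
      (\<Prod>i<N. x (w i) ^ (N - 1 - i)) / vdm N (x \<circ> w)"
      using prod_pairs_fst[of "x \<circ> w" N] by (simp add: vdm_def case_prod_unfold prod_dividef)
    have 2: "1 / vdm N (x \<circ> w) = of_int (sign w) / vdm N x"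
      unfolding vdm_permutes[OF w] by (cases w rule: sign_cases) auto
    have "(\<Prod>i<N. x (w i) ^ p i) * (\<Prod>(i, j)\<in>pairs N. (x (w i) - 0 * x (w j)) / (x (w i) - x (w j))) =
      (\<Prod>i<N. x (w i) ^ (p i + (N - 1 - i))) * (1 / vdm N (x \<circ> w))"
      unfolding 1 by (simp only: power_add prod.distrib) simp
    then show "(\<Prod>i<N. x (w i) ^ p i) * (\<Prod>(i, j)\<in>pairs N. (x (w i) - 0 * x (w j)) / (x (w i) - x (w j))) =
      of_int (sign w) * (\<Prod>i<N. x (w i) ^ (p i + (N - 1 - i))) / vdm N x"
      unfolding 2 by simp
  qed
  then show ?thesis by (simp add: alternant_def sum_divide_distrib)
qed

lemma not_root_of_unity_0: "not_root_of_unity (0 :: 'a::field)"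
  by standard (auto simp: power_0_left)

lemma hl_v_zero: "hl_v (0 :: 'a::field) m = 1"
  by (auto simp: hl_v_def intro!: prod.neutral)

lemma schur_eq_hall_littlewood:
  fixes x :: "nat \<Rightarrow> 'a::field"
  assumes inj: "inj x" and nz: "\<And>i. x i \<noteq> 0"
  shows "schur N x p = hall_littlewood N x 0 p"
proof -
  have "hl_norm N (0 :: 'a) p = 1" by (simp add: hl_norm_def hl_v_zero)
  \<comment> \<open>The denominator of \<open>schur\<close> is evaluated by the symmetrization of
    the empty monomial at \<open>t = 0\<close>, which is 1.\<close>
  moreover have "alternant N x (\<lambda>i. N - 1 - i) / vdm N x = 1"
    using not_root_of_unity.hl_sym_0[OF not_root_of_unity_0 inj nz, of N]
    by (simp add: hl_sym_zero[OF inj] hl_v_zero)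
  then have "alternant N x (\<lambda>i. N - 1 - i) = vdm N x" using vdm_nz[OF inj] by simp
  moreover have "hall_littlewood N x 0 p = (if p N = 0 then hl_sym N x 0 p / hl_norm N 0 p else 0)"
    by (simp only: hall_littlewood_def hl_sym_def pairs_def)
  ultimately show ?thesis
    by (simp add: schur_def det_eq_alternant hl_sym_zero[OF inj])
qed

text \<open>Since \<open>l\<close> and \<open>c\<close> hold column lengths, the usual condition of
  at most one new box per column is coordinatewise.\<close>

definition horizontal_strip :: "seq \<Rightarrow> seq \<Rightarrow> bool" where
  "horizontal_strip l c \<longleftrightarrow> c \<le> l \<and> (\<forall>a. l a \<le> Suc (c a))"

text \<open>A power of 0 with exponent \<open>d choose 2\<close> excludes exactly the columns that
  grow by two or more, and the Gaussian binomials that occur are 1 at 0.\<close>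

lemma pieri_h_zero:
  assumes c: "is_partition c" and l: "is_partition l"
  shows "pieri_h (0 :: 'a::idom) l c = of_bool (horizontal_strip l c)"
proof (cases "c \<le> l")
  case True
  obtain b where b: "\<And>a. b \<le> Suc a \<Longrightarrow> l a = 0" using is_partition_bound[OF l] by blast
  have lb: "l a = 0" if "b \<le> a" for a using b that by simp
  have le: "c a \<le> l a" for a using True by (simp add: le_fun_def)
  have "(0 :: 'a) ^ ((l a - c a) choose 2) * gauss_binom 0 (l a - c (Suc a)) (c a - c (Suc a)) =
    of_bool (l a \<le> Suc (c a))" for a
  proof -
    have "gauss_binom (0 :: 'a) (l a - c (Suc a)) (c a - c (Suc a)) = 1"
      using le[of a] by (simp add: gauss_binom_zero diff_le_mono)
    moreover have "((l a - c a) choose 2) = 0 \<longleftrightarrow> l a \<le> Suc (c a)"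
      by (auto simp: binomial_eq_0_iff)
    ultimately show ?thesis by (simp add: power_0_left)
  qed
  then have "pieri_h (0 :: 'a) l c = (\<Prod>a<b. of_bool (l a \<le> Suc (c a)))"
    using True by (subst pieri_h_eq[OF lb]) auto
  also have "\<dots> = of_bool (\<forall>a<b. l a \<le> Suc (c a))"
    by (auto intro!: prod.neutral) 
  also have "(\<forall>a<b. l a \<le> Suc (c a)) \<longleftrightarrow> horizontal_strip l c"
    using True lb by (auto simp: horizontal_strip_def) (metis le0 not_le)
  finally show ?thesis .
qed (simp add: pieri_h_def horizontal_strip_def)

theorem hsym_times_schur:
  fixes x :: "nat \<Rightarrow> 'a::field"
  assumes inj: "inj x" and nz: "\<And>i. x i \<noteq> 0" and c: "is_partition c"
  shows "hsym N x m * schur N x (conjugate c) =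
    (\<Sum>l\<in>partitions_of (psize c + m). of_bool (horizontal_strip l c) * schur N x (conjugate l))"
proof -
  interpret hl_setting "0 :: 'a" x
    by (intro hl_setting.intro not_root_of_unity_0 hl_setting_axioms.intro inj nz)
  show ?thesis
    unfolding schur_eq_hall_littlewood[OF inj nz] hsym_times_HL[OF c]
    by (rule sum.cong[OF refl]) (auto simp: pieri_h_zero[OF c] partitions_of_def)
qed

section \<open>Removing the largest letter of a tableau\<close>

lemma mem_diagram: "(i, j) \<in> diagram p \<longleftrightarrow> j < p i"
  by (simp add: diagram_def)

lemma diagram_Sigma:
  assumes "\<And>i. b \<le> i \<Longrightarrow> p i = 0"
  shows "diagram p = Sigma {..<b} (\<lambda>i. {..<p i})"
proof -
  have "i < b" if "j < p i" for i j using assms[of i] that by (cases "i < b") auto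
  then show ?thesis by (auto simp: diagram_def)
qed

lemma finite_diagram:
  assumes "is_partition p"
  shows "finite (diagram p)"
proof -
  obtain b where b: "\<And>i. b \<le> Suc i \<Longrightarrow> p i = 0" using is_partition_bound[OF assms] by blast
  have "diagram p = Sigma {..<b} (\<lambda>i. {..<p i})" by (rule diagram_Sigma) (use b in simp)
  then show ?thesis by simp
qed

lemma card_diagram:
  assumes "is_partition p"
  shows "card (diagram p) = psize p"
proof -
  obtain b where b: "\<And>i. b \<le> Suc i \<Longrightarrow> p i = 0" using is_partition_bound[OF assms] by blast
  have "diagram p = Sigma {..<b} (\<lambda>i. {..<p i})" by (rule diagram_Sigma) (use b in simp)
  moreover have "psize p = (\<Sum>i<b. p i)" by (rule psize_eq) (use b in simp)
  ultimately show ?thesis by (simp add: card_SigmaI)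
qed

lemma finite_ssyt: "is_partition p \<Longrightarrow> finite (ssyt p \<mu>)"
  unfolding ssyt_def
  by (rule finite_subset[OF _ finite_PiE[of "diagram p" "\<lambda>_. {..<length \<mu>}"]]) (auto simp: finite_diagram)

lemma conjugate_le_iff:
  assumes "is_partition p" "is_partition q"
  shows "conjugate q \<le> conjugate p \<longleftrightarrow> q \<le> p"
proof -
  have "conjugate q \<le> conjugate p \<longleftrightarrow> (\<forall>i j. i < conjugate q j \<longrightarrow> i < conjugate p j)"
    by (auto simp: le_fun_def intro: less_le_trans) (meson not_le order_refl)
  also have "\<dots> \<longleftrightarrow> (\<forall>j i. j < q i \<longrightarrow> j < p i)"
    by (auto simp: less_conjugate_iff assms)
  also have "\<dots> \<longleftrightarrow> q \<le> p"
    by (auto simp: le_fun_def intro: less_le_trans) (meson not_le order_refl)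
  finally show ?thesis .
qed

definition shape_below :: "nat \<Rightarrow> seq \<Rightarrow> (nat \<times> nat \<Rightarrow> nat) \<Rightarrow> seq" where
  "shape_below r p T = (\<lambda>i. card {j. j < p i \<and> T (i, j) < r})"

definition extend_tableau :: "nat \<Rightarrow> seq \<Rightarrow> seq \<Rightarrow> (nat \<times> nat \<Rightarrow> nat) \<Rightarrow> nat \<times> nat \<Rightarrow> nat" where
  "extend_tableau r p q T = (\<lambda>c\<in>diagram p. if c \<in> diagram q then T c else r)"

lemma ssytD:
  assumes "T \<in> ssyt p \<mu>"
  shows "j < p i \<Longrightarrow> T (i, j) < length \<mu>"
    "j < j' \<Longrightarrow> j' < p i \<Longrightarrow> T (i, j) \<le> T (i, j')"
    "i < i' \<Longrightarrow> j < p i' \<Longrightarrow> T (i, j) < T (i', j)"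
    "k < length \<mu> \<Longrightarrow> card {c \<in> diagram p. T c = k} = \<mu> ! k"
    "T \<in> extensional (diagram p)"
proof -
  have T: "T \<in> diagram p \<rightarrow>\<^sub>E {..<length \<mu>}"
    "\<And>i j j'. j < j' \<and> (i, j') \<in> diagram p \<longrightarrow> T (i, j) \<le> T (i, j')"
    "\<And>i i' j. i < i' \<and> (i', j) \<in> diagram p \<longrightarrow> T (i, j) < T (i', j)"
    "\<And>k. k < length \<mu> \<longrightarrow> card {c \<in> diagram p. T c = k} = \<mu> ! k"
    using assms unfolding ssyt_def by blast+
  show "j < p i \<Longrightarrow> T (i, j) < length \<mu>" using T(1) by (auto simp: mem_diagram dest!: PiE_mem[of _ _ _ "(i, j)"])
  show "j < j' \<Longrightarrow> j' < p i \<Longrightarrow> T (i, j) \<le> T (i, j')"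
    "i < i' \<Longrightarrow> j < p i' \<Longrightarrow> T (i, j) < T (i', j)"
    "k < length \<mu> \<Longrightarrow> card {c \<in> diagram p. T c = k} = \<mu> ! k"
    using T(2-4) by (simp_all add: mem_diagram)
  show "T \<in> extensional (diagram p)" using T(1) by (simp add: PiE_iff)
qed

lemma ssytI:
  assumes "T \<in> extensional (diagram p)" "\<And>i j. j < p i \<Longrightarrow> T (i, j) < length \<mu>"
    "\<And>i j j'. j < j' \<Longrightarrow> j' < p i \<Longrightarrow> T (i, j) \<le> T (i, j')"
    "\<And>i i' j. i < i' \<Longrightarrow> j < p i' \<Longrightarrow> T (i, j) < T (i', j)"
    "\<And>k. k < length \<mu> \<Longrightarrow> card {c \<in> diagram p. T c = k} = \<mu> ! k"
  shows "T \<in> ssyt p \<mu>"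
  using assms unfolding ssyt_def by (auto simp: PiE_iff mem_diagram)

context
  fixes p :: seq and \<mu> :: "nat list" and m n :: nat
  assumes p: "p \<in> partitions_of (n + m)"
begin

lemma p_partition: "is_partition p"
  using p by (simp add: partitions_of_def)

lemma p_antimono: "i \<le> i' \<Longrightarrow> p i' \<le> p i"
  using is_partition_antimono[OF p_partition] by (simp add: antimono_def)

text \<open>Rows increase weakly, so the cells of a row with a smaller letter form an initial
  segment, whose length is the cardinality in \<open>shape_below\<close>.\<close>

lemma less_shape_below_iff:
  assumes T: "T \<in> ssyt p (\<mu> @ [m])"
  shows "j < shape_below (length \<mu>) p T i \<longleftrightarrow> j < p i \<and> T (i, j) < length \<mu>"
proof -
  let ?S = "{j. j < p i \<and> T (i, j) < length \<mu>}"
  have dc: "j' \<in> ?S" if "j \<in> ?S" "j' \<le> j" for j j'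
    using that ssytD(2)[OF T, of j' j i] by (cases "j' = j") auto
  have fin: "finite ?S" by simp
  have "?S = {..<card ?S}"
  proof (cases "?S = {}")
    case False
    have "?S = {..Max ?S}"
    proof (intro equalityI subsetI)
      fix j assume "j \<in> ?S"
      then show "j \<in> {..Max ?S}" using Max_ge[OF fin] by blast
    next
      fix j assume "j \<in> {..Max ?S}"
      then show "j \<in> ?S" using dc[OF Max_in[OF fin False]] by blast
    qed
    then show ?thesis by (metis card_atMost lessThan_Suc_atMost)
  next
    case True
    then show ?thesis by (simp only: card.empty lessThan_0)
  qed
  then have "j \<in> ?S \<longleftrightarrow> j \<in> {..<card ?S}" by (rule arg_cong)
  then show ?thesis by (simp add: shape_below_def)
qed

lemma shape_below_partition:
  assumes T: "T \<in> ssyt p (\<mu> @ [m])"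
  shows "is_partition (shape_below (length \<mu>) p T)"
proof (rule is_partitionI)
  fix a
  have "j < shape_below (length \<mu>) p T a" if "j < shape_below (length \<mu>) p T (Suc a)" for j
    using that p_antimono[of a "Suc a"] ssytD(3)[OF T, of a "Suc a" j]
    by (auto simp: less_shape_below_iff[OF T])
  then show "shape_below (length \<mu>) p T (Suc a) \<le> shape_below (length \<mu>) p T a" by (meson not_le order_refl)
next
  fix a assume "n + m \<le> a"
  then have "p a = 0" using partitions_of_eq_0[OF p] by blast
  then show "shape_below (length \<mu>) p T a = 0" by (simp add: shape_below_def)
qed

lemma shape_below_le:
  assumes T: "T \<in> ssyt p (\<mu> @ [m])"
  shows "shape_below (length \<mu>) p T \<le> p"
proof (rule le_funI)
  fix i
  have "card {j. j < p i \<and> T (i, j) < length \<mu>} \<le> card {..<p i}" by (rule card_mono) auto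
  then show "shape_below (length \<mu>) p T i \<le> p i" by (simp add: shape_below_def)
qed

lemma ssyt_outside_shape_below:
  assumes T: "T \<in> ssyt p (\<mu> @ [m])"
  shows "j < p i \<Longrightarrow> \<not> j < shape_below (length \<mu>) p T i \<Longrightarrow> T (i, j) = length \<mu>"
  using ssytD(1)[OF T, of j i] by (auto simp: less_shape_below_iff[OF T])

lemma diagram_shape_below:
  assumes T: "T \<in> ssyt p (\<mu> @ [m])"
  shows "diagram (shape_below (length \<mu>) p T) = diagram p - {c \<in> diagram p. T c = length \<mu>}"
  using ssyt_outside_shape_below[OF T] by (auto simp: mem_diagram less_shape_below_iff[OF T])

lemma shape_below_mem:
  assumes T: "T \<in> ssyt p (\<mu> @ [m])"
  shows "shape_below (length \<mu>) p T \<in> {q \<in> partitions_of n. horizontal_strip (conjugate p) (conjugate q)}"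
proof -
  let ?q = "shape_below (length \<mu>) p T"
  have q: "is_partition ?q" by (rule shape_below_partition[OF T])
  have "psize ?q = card (diagram p) - card {c \<in> diagram p. T c = length \<mu>}"
    unfolding card_diagram[OF q, symmetric] diagram_shape_below[OF T]
    by (rule card_Diff_subset) (use finite_diagram[OF p_partition] in auto)
  also have "\<dots> = n"
    using p ssytD(4)[OF T, of "length \<mu>"] by (simp add: card_diagram[OF p_partition] partitions_of_def)
  finally have "psize ?q = n" .
  moreover have "conjugate p j \<le> Suc (conjugate ?q j)" for j
  proof (rule ccontr)
    \<comment> \<open>Row \<open>?i\<close> is the first one whose cell in column \<open>j\<close>
      lies outside the smaller shape. If the column grew by two, this cell and the next one below
      would both carry the largest letter.\<close>
    let ?i = "conjugate ?q j"
    assume "\<not> conjugate p j \<le> Suc ?i"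
    then have "j < p ?i" "j < p (Suc ?i)"
      using less_conjugate_iff[OF p_partition, of _ j] by (metis Suc_lessD not_le)+
    moreover have "\<not> j < ?q ?i" "\<not> j < ?q (Suc ?i)"
      using less_conjugate_iff[OF q, of _ j] by (metis less_irrefl, metis not_less_eq less_Suc_eq)
    ultimately have "T (?i, j) = length \<mu>" "T (Suc ?i, j) = length \<mu>"
      using ssyt_outside_shape_below[OF T] by blast+
    then show False using ssytD(3)[OF T, of ?i "Suc ?i" j] \<open>j < p (Suc ?i)\<close> by simp
  qed
  moreover have "conjugate ?q \<le> conjugate p"
    using shape_below_le[OF T] conjugate_le_iff[OF p_partition q] by simp
  ultimately show ?thesis using q by (simp add: partitions_of_def horizontal_strip_def)
qed

lemma restrict_ssyt:
  assumes T: "T \<in> ssyt p (\<mu> @ [m])"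
  shows "restrict T (diagram (shape_below (length \<mu>) p T)) \<in> ssyt (shape_below (length \<mu>) p T) \<mu>"
proof (rule ssytI)
  let ?q = "shape_below (length \<mu>) p T"
  note lq = less_shape_below_iff[OF T]
  show "restrict T (diagram ?q) (i, j) < length \<mu>" if "j < ?q i" for i j
    using that by (simp add: mem_diagram lq)
  show "restrict T (diagram ?q) (i, j) \<le> restrict T (diagram ?q) (i, j')" if "j < j'" "j' < ?q i" for i j j'
  proof -
    have "j < ?q i" using that by simp
    then show ?thesis using that ssytD(2)[OF T, of j j' i] by (simp add: mem_diagram lq)
  qed
  show "restrict T (diagram ?q) (i, j) < restrict T (diagram ?q) (i', j)" if "i < i'" "j < ?q i'" for i i' j
  proof -
    have "?q i' \<le> ?q i"
      using is_partition_antimono[OF shape_below_partition[OF T]] that by (simp add: antimono_def)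
    then have "j < ?q i" using that by simp
    then show ?thesis using that ssytD(3)[OF T, of i i' j] by (simp add: mem_diagram lq)
  qed
  show "card {c \<in> diagram ?q. restrict T (diagram ?q) c = k} = \<mu> ! k" if "k < length \<mu>" for k
  proof -
    have "{c \<in> diagram ?q. restrict T (diagram ?q) c = k} = {c \<in> diagram p. T c = k}"
      using that by (auto simp: diagram_shape_below[OF T])
    then show ?thesis using that ssytD(4)[OF T, of k] by (simp add: nth_append)
  qed
qed simp

context
  fixes q T
  assumes q: "q \<in> {q \<in> partitions_of n. horizontal_strip (conjugate p) (conjugate q)}"
    and T: "T \<in> ssyt q \<mu>"
begin

lemma q_partition: "is_partition q"
  using q by (simp add: partitions_of_def)

lemma q_le: "q i \<le> p i"
  using q conjugate_le_iff[OF p_partition q_partition] by (simp add: horizontal_strip_def le_fun_def)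

lemma extend_tableau_eq:
  "j < q i \<Longrightarrow> extend_tableau (length \<mu>) p q T (i, j) = T (i, j)"
  "j < p i \<Longrightarrow> \<not> j < q i \<Longrightarrow> extend_tableau (length \<mu>) p q T (i, j) = length \<mu>"
  using q_le[of i] by (auto simp: extend_tableau_def mem_diagram)

lemma extend_ssyt: "extend_tableau (length \<mu>) p q T \<in> ssyt p (\<mu> @ [m])"
proof (rule ssytI)
  let ?E = "extend_tableau (length \<mu>) p q T"
  have Tr: "T (i, j) < length \<mu>" if "j < q i" for i j using ssytD(1)[OF T that] by simp
  have le: "?E (i, j) \<le> length \<mu>" if "j < p i" for i j
    using that extend_tableau_eq[of j i] Tr[of j i] by (cases "j < q i") auto
  show "?E (i, j) < length (\<mu> @ [m])" if "j < p i" for i j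
    using le[OF that] by simp
  show "?E (i, j) \<le> ?E (i, j')" if "j < j'" "j' < p i" for i j j'
  proof (cases "j' < q i")
    case True
    then show ?thesis using that ssytD(2)[OF T, of j j' i] by (simp add: extend_tableau_eq)
  next
    case False
    then show ?thesis using that le[of j i] by (simp add: extend_tableau_eq(2))
  qed
  show "?E (i, j) < ?E (i', j)" if "i < i'" "j < p i'" for i i' j
  proof -
    \<comment> \<open>A column has at most one cell in the strip, and it is the lowest; so a cell
      with another one below it belongs to \<open>q\<close> and carries a smaller letter than any
      new cell.\<close>
    have "i' < conjugate p j" using that less_conjugate_iff[OF p_partition] by simp
    also have "\<dots> \<le> Suc (conjugate q j)" using q by (simp add: horizontal_strip_def)
    finally have "i < conjugate q j" using that by simp
    then have "j < q i" using less_conjugate_iff[OF q_partition] by simp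
    then show ?thesis
      using that ssytD(3)[OF T, of i i' j] Tr[of j i] extend_tableau_eq[of j i'] extend_tableau_eq(1)[of j i]
      by (cases "j < q i'") auto
  qed
  have sub: "diagram q \<subseteq> diagram p" using less_le_trans[OF _ q_le] by (auto simp: mem_diagram)
  show "card {c \<in> diagram p. ?E c = k} = (\<mu> @ [m]) ! k" if "k < length (\<mu> @ [m])" for k
  proof (cases "k = length \<mu>")
    case True
    have "{c \<in> diagram p. ?E c = k} = diagram p - diagram q"
    proof -
      have "?E (i, j) = length \<mu> \<longleftrightarrow> \<not> j < q i" if "j < p i" for i j
        using that extend_tableau_eq[of j i] Tr[of j i] by (cases "j < q i") auto
      then show ?thesis unfolding True by (auto simp: mem_diagram)
    qed
    then have "card {c \<in> diagram p. ?E c = k} = card (diagram p) - card (diagram q)"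
      using sub finite_diagram[OF q_partition] by (simp add: card_Diff_subset)
    also have "\<dots> = m"
      using p q by (simp add: card_diagram p_partition q_partition partitions_of_def)
    finally show ?thesis using True by simp
  next
    case False
    then have kr: "k < length \<mu>" using that by simp
    have "{c \<in> diagram p. ?E c = k} = {c \<in> diagram q. T c = k}"
      using sub kr by (auto simp: extend_tableau_def)
    then show ?thesis using ssytD(4)[OF T kr] kr by (simp add: nth_append)
  qed
qed (simp add: extend_tableau_def)

lemma shape_below_extend: "shape_below (length \<mu>) p (extend_tableau (length \<mu>) p q T) = q"
proof
  fix i
  have "{j. j < p i \<and> extend_tableau (length \<mu>) p q T (i, j) < length \<mu>} = {..<q i}"
  proof (intro equalityI subsetI)
    fix j assume "j \<in> {j. j < p i \<and> extend_tableau (length \<mu>) p q T (i, j) < length \<mu>}"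
    then show "j \<in> {..<q i}" using extend_tableau_eq(2)[of j i] by (cases "j < q i") auto
  next
    fix j assume "j \<in> {..<q i}"
    then show "j \<in> {j. j < p i \<and> extend_tableau (length \<mu>) p q T (i, j) < length \<mu>}"
      using q_le[of i] ssytD(1)[OF T, of j i] by (simp add: extend_tableau_eq(1))
  qed
  then show "shape_below (length \<mu>) p (extend_tableau (length \<mu>) p q T) i = q i" by (simp add: shape_below_def)
qed

lemma restrict_extend: "restrict (extend_tableau (length \<mu>) p q T) (diagram q) = T"
proof (rule extensionalityI[of _ "diagram q"])
  show "T \<in> extensional (diagram q)" by (rule ssytD(5)[OF T])
  fix c assume "c \<in> diagram q"
  then show "restrict (extend_tableau (length \<mu>) p q T) (diagram q) c = T c"
    by (cases c) (simp add: mem_diagram extend_tableau_eq(1))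
qed simp

end

lemma extend_restrict:
  assumes T: "T \<in> ssyt p (\<mu> @ [m])"
  shows "extend_tableau (length \<mu>) p (shape_below (length \<mu>) p T) (restrict T (diagram (shape_below (length \<mu>) p T))) = T"
proof (rule extensionalityI[of _ "diagram p"])
  show "T \<in> extensional (diagram p)" by (rule ssytD(5)[OF T])
  fix c assume "c \<in> diagram p"
  then show "extend_tableau (length \<mu>) p (shape_below (length \<mu>) p T) (restrict T (diagram (shape_below (length \<mu>) p T))) c = T c"
    by (auto simp: extend_tableau_def diagram_shape_below[OF T])
qed (simp add: extend_tableau_def)

text \<open>A tableau amounts to its restriction to the letters below \<open>length \<mu>\<close>
  together with the shape of this restriction, because all remaining cells carry the largest
  letter.\<close>

lemma kostka_snoc_aux:
  "kostka p (\<mu> @ [m]) = (\<Sum>q | q \<in> partitions_of n \<and> horizontal_strip (conjugate p) (conjugate q). kostka q \<mu>)"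
proof -
  let ?Q = "{q \<in> partitions_of n. horizontal_strip (conjugate p) (conjugate q)}"
  have "bij_betw (\<lambda>T. (shape_below (length \<mu>) p T, restrict T (diagram (shape_below (length \<mu>) p T))))
    (ssyt p (\<mu> @ [m])) (Sigma ?Q (\<lambda>q. ssyt q \<mu>))"
  proof (rule bij_betwI[where g = "\<lambda>(q, T). extend_tableau (length \<mu>) p q T"])
    show "(\<lambda>T. (shape_below (length \<mu>) p T, restrict T (diagram (shape_below (length \<mu>) p T))))
      \<in> ssyt p (\<mu> @ [m]) \<rightarrow> Sigma ?Q (\<lambda>q. ssyt q \<mu>)"
      using shape_below_mem restrict_ssyt by blast
    show "(\<lambda>(q, T). extend_tableau (length \<mu>) p q T) \<in> Sigma ?Q (\<lambda>q. ssyt q \<mu>) \<rightarrow> ssyt p (\<mu> @ [m])"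
      using extend_ssyt by auto
    fix T assume "T \<in> ssyt p (\<mu> @ [m])"
    then show "(case (shape_below (length \<mu>) p T, restrict T (diagram (shape_below (length \<mu>) p T))) of
      (q, T) \<Rightarrow> extend_tableau (length \<mu>) p q T) = T" using extend_restrict by simp
  next
    fix y assume y: "y \<in> Sigma ?Q (\<lambda>q. ssyt q \<mu>)"
    obtain q T where "y = (q, T)" by (cases y)
    then show "(\<lambda>T. (shape_below (length \<mu>) p T, restrict T (diagram (shape_below (length \<mu>) p T))))
      ((\<lambda>(q, T). extend_tableau (length \<mu>) p q T) y) = y"
      using shape_below_extend restrict_extend y by auto
  qed
  then have "kostka p (\<mu> @ [m]) = card (Sigma ?Q (\<lambda>q. ssyt q \<mu>))"
    unfolding kostka_def by (rule bij_betw_same_card)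
  also have "\<dots> = (\<Sum>q\<in>?Q. kostka q \<mu>)"
    unfolding kostka_def
  proof (rule card_SigmaI)
    show "finite ?Q" using finite_partitions_of[of n] by (rule rev_finite_subset) auto
  qed (auto simp: finite_ssyt partitions_of_def)
  finally show ?thesis .
qed

end

text \<open>The recursion has the coefficients by which \<open>hsym\<close> acts on Schur functions;
  this agreement turns products of complete functions into sums with Kostka numbers.\<close>

lemma kostka_snoc:
  assumes "p \<in> partitions_of (n + m)"
  shows "kostka p (\<mu> @ [m]) = (\<Sum>q\<in>partitions_of n. of_bool (horizontal_strip (conjugate p) (conjugate q)) * kostka q \<mu>)"
  unfolding kostka_snoc_aux[OF assms] sum.inter_filter[OF finite_partitions_of]
  by (rule sum.cong) auto

section \<open>Products of complete symmetric functions in the Schur basis\<close>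

lemma partitions_of_0: "partitions_of 0 = {\<lambda>_. 0}"
proof -
  have "is_partition (\<lambda>_. 0)" by (rule is_partitionI) auto
  then have "(\<lambda>_. 0) \<in> partitions_of 0" by (simp add: partitions_of_def psize_def)
  moreover have "k = (\<lambda>_. 0)" if "k \<in> partitions_of 0" for k
    using partitions_of_eq_0[OF that] by auto
  ultimately show ?thesis by blast
qed

lemma kostka_Nil: "kostka (\<lambda>_. 0) [] = 1"
proof -
  have "ssyt (\<lambda>_. 0) [] = {\<lambda>_. undefined}" by (auto simp: ssyt_def diagram_def)
  then show ?thesis by (simp add: kostka_def)
qed

lemma conjugate_0: "conjugate (\<lambda>_. 0) = (\<lambda>_. 0)"
  by (simp add: conjugate_def)

lemma (in hl_setting) hall_littlewood_0: "hall_littlewood N x t (\<lambda>_. 0) = 1"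
proof -
  have p: "is_partition (\<lambda>_. 0)" using partitions_of_0 by (auto simp: partitions_of_def)
  have "hall_littlewood N x t (\<lambda>_. 0) = hl_sym N x t (\<lambda>_. 0) / hl_norm N t (\<lambda>_. 0)"
    using hall_littlewood_conjugate[OF p, of N x t] by (simp add: conjugate_0)
  moreover have "hl_norm N t (\<lambda>_. 0) = hl_v t N"
    using hl_norm_conjugate[OF p, of N 1 t] by (simp add: conjugate_0)
  ultimately show ?thesis using hl_sym_0[OF inj_x x_nz] hl_v_nz by simp
qed

lemma sum_partitions_conjugate:
  "(\<Sum>p\<in>partitions_of n. f (conjugate p)) = (\<Sum>p\<in>partitions_of n. f p)"
  by (rule sum.reindex_bij_betw[OF bij_betw_conjugate])

theorem prod_hsym_eq_schur:
  fixes x :: "nat \<Rightarrow> 'a::field"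
  assumes inj: "inj x" and nz: "\<And>i. x i \<noteq> 0"
  shows "(\<Prod>m\<leftarrow>\<mu>. hsym N x m) = (\<Sum>\<eta>\<in>partitions_of (sum_list \<mu>). of_nat (kostka \<eta> \<mu>) * schur N x \<eta>)"
proof (induction \<mu> rule: rev_induct)
  case Nil
  interpret hl_setting "0 :: 'a" x
    by (intro hl_setting.intro not_root_of_unity_0 hl_setting_axioms.intro inj nz)
  show ?case by (simp add: partitions_of_0 kostka_Nil schur_eq_hall_littlewood[OF inj nz] hall_littlewood_0)
next
  case (snoc m \<mu>)
  let ?n = "sum_list \<mu>"
  let ?hs = "\<lambda>p q. of_bool (horizontal_strip (conjugate p) (conjugate q)) :: 'a"
  have pieri: "hsym N x m * schur N x \<eta> = (\<Sum>p\<in>partitions_of (?n + m). ?hs p \<eta> * schur N x p)"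
    if "\<eta> \<in> partitions_of ?n" for \<eta>
  proof -
    have \<eta>: "is_partition \<eta>" "psize \<eta> = ?n" using that by (auto simp: partitions_of_def)
    have "hsym N x m * schur N x \<eta> = (\<Sum>l\<in>partitions_of (?n + m).
        of_bool (horizontal_strip l (conjugate \<eta>)) * schur N x (conjugate l))"
      using hsym_times_schur[OF inj nz is_partition_conjugate[OF \<eta>(1)], of N m] \<eta>
      by (simp add: conjugate_conjugate psize_conjugate)
    also have "\<dots> = (\<Sum>p\<in>partitions_of (?n + m). ?hs p \<eta> * schur N x (conjugate (conjugate p)))"
      by (rule sum_partitions_conjugate[symmetric])
    also have "\<dots> = (\<Sum>p\<in>partitions_of (?n + m). ?hs p \<eta> * schur N x p)"
      by (rule sum.cong) (auto simp: conjugate_conjugate partitions_of_def)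
    finally show ?thesis .
  qed
  have "(\<Prod>m\<leftarrow>\<mu> @ [m]. hsym N x m) = (\<Sum>\<eta>\<in>partitions_of ?n. of_nat (kostka \<eta> \<mu>) * (hsym N x m * schur N x \<eta>))"
    by (simp add: snoc sum_distrib_left mult_ac)
  also have "\<dots> = (\<Sum>\<eta>\<in>partitions_of ?n. of_nat (kostka \<eta> \<mu>) * (\<Sum>p\<in>partitions_of (?n + m). ?hs p \<eta> * schur N x p))"
    by (rule sum.cong) (simp_all add: pieri)
  also have "\<dots> = (\<Sum>p\<in>partitions_of (?n + m). (\<Sum>\<eta>\<in>partitions_of ?n. ?hs p \<eta> * of_nat (kostka \<eta> \<mu>)) * schur N x p)"
    unfolding sum_distrib_left sum_distrib_right by (subst sum.swap) (simp add: mult_ac)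
  also have "\<dots> = (\<Sum>p\<in>partitions_of (?n + m). of_nat (kostka p (\<mu> @ [m])) * schur N x p)"
    by (rule sum.cong[OF refl]) (simp add: kostka_snoc)
  finally show ?case by simp
qed

section \<open>Linear independence of the Hall--Littlewood functions\<close>

lemma scalar_0 [simp]: "scalar 0 = 0"
  and scalar_1 [simp]: "scalar 1 = 1"
  and scalar_add: "scalar (a + b) = scalar a + scalar b"
  and scalar_diff: "scalar (a - b) = scalar a - scalar b"
  and scalar_mult: "scalar (a * b) = scalar a * scalar b"
  by (simp_all add: scalar_def single_add single_diff mult_single flip: to_fract_mult to_fract_diff)

lemma scalar_eq_iff [simp]: "scalar a = scalar b \<longleftrightarrow> a = b"
  by (auto simp: scalar_def dest: arg_cong[where f = "\<lambda>p. Poly_Mapping.lookup p 0"])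

lemma scalar_sum: "scalar (\<Sum>i\<in>A. f i) = (\<Sum>i\<in>A. scalar (f i))"
  by (induction A rule: infinite_finite_induct) (simp_all add: scalar_add)

lemma scalar_prod: "scalar (\<Prod>i\<in>A. f i) = (\<Prod>i\<in>A. scalar (f i))"
  by (induction A rule: infinite_finite_induct) (simp_all add: scalar_mult)

lemma scalar_power: "scalar (a ^ n) = scalar a ^ n"
  by (induction n) (simp_all add: scalar_mult)

lemma scalar_of_nat: "scalar (of_nat n) = of_nat n"
  by (induction n) (simp_all add: scalar_add)

lemma scalar_gauss_binom: "scalar (gauss_binom a n k) = gauss_binom (scalar a) n k"
  by (rule gauss_binom_hom) (simp_all add: scalar_add scalar_mult)

type_synonym pol = "(nat \<Rightarrow>\<^sub>0 nat) \<Rightarrow>\<^sub>0 int poly"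

definition pol_x :: "nat \<Rightarrow> pol" where
  "pol_x i = Poly_Mapping.single (Poly_Mapping.single i 1) 1"

definition pol_c :: "int poly \<Rightarrow> pol" where
  "pol_c a = Poly_Mapping.single 0 a"

lemma to_fract_pol_x: "to_fract (pol_x i) = var_x i"
  by (simp add: pol_x_def var_x_def)

lemma to_fract_pol_c: "to_fract (pol_c a) = scalar a"
  by (simp add: pol_c_def scalar_def)

lemma pol_c_mult: "pol_c (a * b) = pol_c a * pol_c b"
  by (simp add: pol_c_def mult_single)

lemma lookup_pol_c_mult: "Poly_Mapping.lookup (pol_c a * f) m = a * Poly_Mapping.lookup f m"
  unfolding pol_c_def mult_map_scale_conv_mult[symmetric]
  by (simp add: Poly_Mapping.map.rep_eq when_def)

lemma inj_var_x: "inj var_x"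
proof (rule injI)
  fix i j assume "var_x i = var_x j"
  then have "(Poly_Mapping.single (Poly_Mapping.single i 1) 1 :: pol) = Poly_Mapping.single (Poly_Mapping.single j 1) 1"
    by (simp add: var_x_def)
  from arg_cong[OF this, of "\<lambda>p. Poly_Mapping.lookup p (Poly_Mapping.single i 1)"]
  have "Poly_Mapping.single j 1 = (Poly_Mapping.single i 1 :: nat \<Rightarrow>\<^sub>0 nat)"
    by (auto simp: lookup_single when_def split: if_splits)
  from arg_cong[OF this, of "\<lambda>p. Poly_Mapping.lookup p i"] show "i = j"
    by (auto simp: lookup_single when_def split: if_splits)
qed

lemma var_x_nz: "var_x i \<noteq> 0"
proof -
  have "(Poly_Mapping.single (Poly_Mapping.single i 1) 1 :: pol) \<noteq> 0"
    by (metis lookup_single_eq lookup_zero zero_neq_one)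
  then show ?thesis by (simp add: var_x_def)
qed

interpretation hl: hl_setting "scalar var_t" var_x
proof (intro hl_setting.intro not_root_of_unity.intro hl_setting_axioms.intro inj_var_x var_x_nz)
  fix i :: nat assume "i > 0"
  then have "poly (var_t ^ i) 0 \<noteq> poly 1 (0 :: int)" by (simp add: var_t_def power_0_left)
  then have "var_t ^ i \<noteq> 1" by metis
  then show "scalar var_t ^ i \<noteq> 1" by (simp flip: scalar_power scalar_1)
qed

text \<open>Each quotient \<open>(1 - t ^ i) / (1 - t)\<close> is a geometric sum, so the norm lies
  in Z[t]. This lets a relation between the functions be cleared of denominators without leaving
  polynomial coefficients.\<close>

lemma hl_norm_scalar:
  obtains V where "hl_norm N (scalar var_t) q = scalar V"
proof -
  define P where "P m = (\<Prod>i=1..m. \<Sum>j<i. var_t ^ j)" for m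
  have "(1 - scalar var_t ^ i) / (1 - scalar var_t) = scalar (\<Sum>j<i. var_t ^ j)" for i
  proof -
    have "1 - scalar var_t ^ i = (1 - scalar var_t) * (\<Sum>j<i. scalar var_t ^ j)"
      by (rule one_diff_power_eq)
    then show ?thesis using hl.t_neq_1 by (simp add: scalar_sum scalar_power)
  qed
  then have P: "hl_v (scalar var_t) m = scalar (P m)" for m
    by (simp add: hl_v_def P_def scalar_prod)
  have "hl_norm N (scalar var_t) q = scalar (Prod_any (\<lambda>a. P (card {j. j < N \<and> q j = a})))"
    unfolding hl_norm_def Prod_any.expand_set P scalar_prod
    by (rule prod.cong) (simp_all flip: scalar_1)
  then show ?thesis by (rule that)
qed

text \<open>This is \<open>hl_sym\<close> over the common denominator \<open>vdm\<close>. The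
  denominator of the summand of \<open>w\<close> differs from \<open>vdm\<close> by the sign of
  \<open>w\<close>, which therefore appears in the numerator.\<close>

definition hl_num :: "nat \<Rightarrow> seq \<Rightarrow> pol" where
  "hl_num N q = (\<Sum>w | w permutes {..<N}. of_int (sign w) * ((\<Prod>i<N. pol_x (w i) ^ q i) *
     (\<Prod>(i, j)\<in>pairs N. pol_x (w i) - pol_c var_t * pol_x (w j))))"

lemma to_fract_sum: "to_fract (\<Sum>i\<in>A. f i) = (\<Sum>i\<in>A. to_fract (f i))"
  by (induction A rule: infinite_finite_induct) simp_all

lemma to_fract_prod: "to_fract (\<Prod>i\<in>A. f i) = (\<Prod>i\<in>A. to_fract (f i))"
  by (induction A rule: infinite_finite_induct) simp_all

lemma to_fract_power: "to_fract (a ^ n) = to_fract a ^ n"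
  by (induction n) simp_all

lemma to_fract_of_int_sign: "to_fract (of_int (sign w)) = of_int (sign w)"
  by (cases w rule: sign_cases) simp_all

lemma hl_sym_times_vdm:
  "hl_sym N var_x (scalar var_t) q * vdm N var_x = to_fract (hl_num N q)"
  unfolding hl_sym_def hl_num_def to_fract_sum sum_distrib_right
proof (rule sum.cong[OF refl])
  fix w assume "w \<in> {w. w permutes {..<N}}"
  then have w: "w permutes {..<N}" by simp
  define A where "A = (\<Prod>i<N. var_x (w i) ^ q i)"
  define B where "B = (\<Prod>(i, j)\<in>pairs N. var_x (w i) - scalar var_t * var_x (w j))"
  have 1: "(\<Prod>(i, j)\<in>pairs N. (var_x (w i) - scalar var_t * var_x (w j)) / (var_x (w i) - var_x (w j)))
    = B / vdm N (var_x \<circ> w)"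
    by (simp add: B_def vdm_def case_prod_unfold prod_dividef)
  have "A * (B / vdm N (var_x \<circ> w)) * vdm N var_x = of_int (sign w) * (A * B)"
    unfolding vdm_permutes[OF w] using vdm_nz[OF inj_var_x, of N]
    by (cases w rule: sign_cases) auto
  moreover have "to_fract (of_int (sign w) * ((\<Prod>i<N. pol_x (w i) ^ q i) *
     (\<Prod>(i, j)\<in>pairs N. pol_x (w i) - pol_c var_t * pol_x (w j)))) = of_int (sign w) * (A * B)"
    by (simp add: A_def B_def to_fract_prod to_fract_power to_fract_of_int_sign case_prod_unfold
        to_fract_pol_x to_fract_pol_c)
  ultimately show "(\<Prod>i<N. var_x (w i) ^ q i) *
    (\<Prod>(i, j)\<in>pairs N. (var_x (w i) - scalar var_t * var_x (w j)) / (var_x (w i) - var_x (w j))) * vdm N var_x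
    = to_fract (of_int (sign w) * ((\<Prod>i<N. pol_x (w i) ^ q i) *
     (\<Prod>(i, j)\<in>pairs N. pol_x (w i) - pol_c var_t * pol_x (w j))))"
    unfolding 1 A_def by simp
qed

lemma dvd_prod_diff:
  fixes f g :: "'b \<Rightarrow> 'a::comm_ring_1"
  assumes "finite P"
  shows "c dvd (\<Prod>p\<in>P. f p - c * g p) - (\<Prod>p\<in>P. f p)"
  using assms
proof (induction P rule: finite_induct)
  case empty
  then show ?case by simp
next
  case (insert p P)
  let ?A = "\<Prod>p\<in>P. f p - c * g p" and ?B = "\<Prod>p\<in>P. f p"
  have "(f p - c * g p) * ?A - f p * ?B = f p * (?A - ?B) - c * (g p * ?A)"
    by (simp add: algebra_simps)
  then show ?case using insert by (simp add: dvd_diff)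
qed

text \<open>Modulo \<open>t\<close> every factor \<open>x_i - t x_j\<close> becomes
  \<open>x_i\<close>, so the staircase exponents appear and the numerator reduces to that of a Schur
  function.\<close>

lemma hl_num_cong_alternant:
  "pol_c var_t dvd hl_num N q - alternant N pol_x (\<lambda>i. q i + (N - 1 - i))"
  unfolding hl_num_def alternant_def sum_subtractf[symmetric]
proof (rule dvd_sum)
  fix w
  let ?A = "\<Prod>i<N. pol_x (w i) ^ q i"
  let ?B = "\<Prod>(i, j)\<in>pairs N. pol_x (w i) - pol_c var_t * pol_x (w j)"
  have "(\<Prod>i<N. pol_x (w i) ^ (q i + (N - 1 - i))) = ?A * (\<Prod>(i, j)\<in>pairs N. pol_x (w i))"
    unfolding prod_pairs_fst[of "\<lambda>i. pol_x (w i)"] by (simp only: power_add prod.distrib)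
  then have "of_int (sign w) * (?A * ?B) - of_int (sign w) * (\<Prod>i<N. pol_x (w i) ^ (q i + (N - 1 - i)))
    = of_int (sign w) * ?A * (?B - (\<Prod>(i, j)\<in>pairs N. pol_x (w i)))"
    by (simp only: right_diff_distrib mult.assoc)
  moreover have "pol_c var_t dvd ?B - (\<Prod>(i, j)\<in>pairs N. pol_x (w i))"
    using dvd_prod_diff[OF finite_pairs, where c = "pol_c var_t" and f = "\<lambda>(i, j). pol_x (w i)"
        and g = "\<lambda>(i, j). pol_x (w j)"]
    by (simp add: case_prod_unfold)
  ultimately show "pol_c var_t dvd of_int (sign w) * (?A * ?B) -
    of_int (sign w) * (\<Prod>i<N. pol_x (w i) ^ (q i + (N - 1 - i)))"
    by (simp only: dvd_mult)
qed

section \<open>Leading monomials of alternants\<close>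

definition monomial :: "nat \<Rightarrow> seq \<Rightarrow> (nat \<Rightarrow> nat) \<Rightarrow> (nat \<Rightarrow>\<^sub>0 nat)" where
  "monomial N \<beta> w = (\<Sum>i<N. Poly_Mapping.single (w i) (\<beta> i))"

lemma prod_pol_x: "(\<Prod>i<N. pol_x (w i) ^ \<beta> i) = Poly_Mapping.single (monomial N \<beta> w) 1"
proof -
  have p: "pol_x i ^ n = Poly_Mapping.single (Poly_Mapping.single i n) 1" for i n
    by (induction n) (simp_all add: pol_x_def mult_single flip: single_add)
  show ?thesis
    unfolding monomial_def by (induction N) (simp_all add: p mult_single add.commute)
qed

lemma strict_mono_on_permutes_id:
  assumes w: "w permutes {..<N}" and mono: "\<And>i j. i < j \<Longrightarrow> j < N \<Longrightarrow> w i < w (j :: nat)"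
  shows "w = id"
proof -
  have "w i = i" if "i < N" for i
    using that
  proof (induction i rule: less_induct)
    case (less i)
    have inj: "inj w" using w by (rule permutes_inj)
    have ge: "i \<le> w i"
    proof (rule ccontr)
      assume "\<not> i \<le> w i"
      then have "w (w i) = w i" using less by simp
      then show False using inj \<open>\<not> i \<le> w i\<close> by (metis injD order_refl)
    qed
    obtain k where k: "w k = i" using permutes_surj[OF w] by (metis surjD)
    have kN: "k < N" using permutes_in_image[OF w, of k] k less.prems by simp
    have "\<not> k < i" using less.IH[of k] k kN by auto
    then have "k = i" using mono[of i k] ge k kN by (cases "i < k") auto
    then show ?case using k by simp
  qed
  then show ?thesis using permutes_not_in[OF w] by (metis eq_id_iff lessThan_iff)
qed

text \<open>The exponents \<open>q i + (N - 1 - i)\<close> and those of \<open>p\<close> decrease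
  strictly. If \<open>w\<close> carries one sequence to the other, it cannot reverse a pair, so it
  is the identity.\<close>

lemma monomial_eqD:
  assumes w: "w permutes {..<N}" and q: "antimono q" and p: "antimono p"
    and eq: "monomial N (\<lambda>i. q i + (N - 1 - i)) w = monomial N (\<lambda>i. p i + (N - 1 - i)) id"
  shows "w = id \<and> (\<forall>i<N. q i = p i)"
proof -
  have l: "Poly_Mapping.lookup (monomial N \<beta> w) (w j) = \<beta> j" if "w permutes {..<N}" "j < N" for \<beta> w j
  proof -
    have "Poly_Mapping.lookup (monomial N \<beta> w) (w j) = (\<Sum>i<N. if i = j then \<beta> j else 0)"
      unfolding monomial_def lookup_sum lookup_single
      by (rule sum.cong) (use permutes_inj[OF that(1)] in \<open>auto simp: when_def inj_eq\<close>)
    then show ?thesis using that by simp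
  qed
  have e: "q i + (N - 1 - i) = p (w i) + (N - 1 - w i)" if "i < N" for i
  proof -
    have "w i < N" using permutes_in_image[OF w, of i] that by simp
    then show ?thesis
      using l[OF w that, of "\<lambda>i. q i + (N - 1 - i)"] l[OF permutes_id, of "w i" "\<lambda>i. p i + (N - 1 - i)"] eq
      by simp
  qed
  have dec: "q j + (N - 1 - j) < q i + (N - 1 - i)" if "antimono q" "i < j" "j < N" for q :: seq and i j
  proof -
    have "q j \<le> q i" using that by (simp add: antimono_def)
    then show ?thesis using that by simp
  qed
  have "w = id"
  proof (rule strict_mono_on_permutes_id[OF w])
    fix i j assume ij: "i < j" "j < N"
    have wN: "w i < N" "w j < N"
      using permutes_in_image[OF w, of i] permutes_in_image[OF w, of j] ij by simp_all
    show "w i < w j"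
    proof (rule ccontr)
      assume "\<not> w i < w j"
      moreover have "w i \<noteq> w j" using permutes_inj[OF w] ij by (simp add: inj_eq)
      ultimately have "w j < w i" by simp
      from dec[OF p this wN(1)] dec[OF q ij] e[of i] e[of j] ij show False by simp
    qed
  qed
  moreover have "q i = p i" if "i < N" for i using e[OF that] that \<open>w = id\<close> by simp
  ultimately show ?thesis by simp
qed

lemma lookup_alternant:
  assumes q: "antimono q" and p: "antimono p"
  shows "Poly_Mapping.lookup (alternant N pol_x (\<lambda>i. q i + (N - 1 - i)))
     (monomial N (\<lambda>i. p i + (N - 1 - i)) id) = of_bool (\<forall>i<N. q i = p i)"
proof -
  let ?m = "monomial N (\<lambda>i. p i + (N - 1 - i)) id"
  have "Poly_Mapping.lookup (alternant N pol_x (\<lambda>i. q i + (N - 1 - i))) ?m =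
    (\<Sum>w | w permutes {..<N}. if w = id then of_bool (\<forall>i<N. q i = p i) else 0)"
    unfolding alternant_def prod_pol_x lookup_sum
  proof (rule sum.cong[OF refl])
    fix w assume "w \<in> {w. w permutes {..<N}}"
    then have w: "w permutes {..<N}" by simp
    have "Poly_Mapping.lookup (of_int (sign w) * Poly_Mapping.single m 1 :: pol) ?m = of_int (sign w) * (1 when m = ?m)" for m
      by (cases w rule: sign_cases) (simp_all add: lookup_single when_def)
    moreover have "monomial N (\<lambda>i. q i + (N - 1 - i)) w = ?m \<longleftrightarrow> w = id \<and> (\<forall>i<N. q i = p i)"
    proof
      assume "w = id \<and> (\<forall>i<N. q i = p i)"
      then show "monomial N (\<lambda>i. q i + (N - 1 - i)) w = ?m" unfolding monomial_def by (intro sum.cong) auto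
    qed (rule monomial_eqD[OF w q p])
    ultimately show "Poly_Mapping.lookup (of_int (sign w) * Poly_Mapping.single (monomial N (\<lambda>i. q i + (N - 1 - i)) w) 1 :: pol) ?m =
      (if w = id then of_bool (\<forall>i<N. q i = p i) else 0)"
      by (auto simp: when_def)
  qed
  also have "\<dots> = of_bool (\<forall>i<N. q i = p i)"
    by (subst sum.delta) (simp_all add: finite_permutations permutes_id)
  finally show ?thesis .
qed

lemma hl_num_independent_dvd:
  assumes fin: "finite Q" and Q: "\<And>q. q \<in> Q \<Longrightarrow> is_partition q \<and> q N = 0"
    and sum0: "(\<Sum>q\<in>Q. pol_c (b q) * hl_num N q) = 0" and p: "p \<in> Q"
  shows "var_t dvd b p"
proof -
  let ?m = "monomial N (\<lambda>i. p i + (N - 1 - i)) id"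
  let ?a = "\<lambda>q. alternant N pol_x (\<lambda>i. q i + (N - 1 - i))"
  have anti: "antimono q" if "q \<in> Q" for q using Q[OF that] is_partition_antimono by blast
  have "pol_c var_t dvd (\<Sum>q\<in>Q. pol_c (b q) * (hl_num N q - ?a q))"
    by (intro dvd_sum dvd_mult hl_num_cong_alternant)
  then have "pol_c var_t dvd - (\<Sum>q\<in>Q. pol_c (b q) * ?a q)"
    using sum0 by (simp add: right_diff_distrib sum_subtractf)
  then obtain B where B: "(\<Sum>q\<in>Q. pol_c (b q) * ?a q) = pol_c var_t * B"
    by (auto elim: dvdE)
  have "Poly_Mapping.lookup (\<Sum>q\<in>Q. pol_c (b q) * ?a q) ?m = (\<Sum>q\<in>Q. if q = p then b p else 0)"
    unfolding lookup_sum lookup_pol_c_mult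
  proof (rule sum.cong[OF refl])
    fix q assume q: "q \<in> Q"
    have "(\<forall>i<N. q i = p i) \<longleftrightarrow> q = p"
    proof
      assume a: "\<forall>i<N. q i = p i"
      have "q i = p i" for i
      proof (cases "i < N")
        case False
        then have "q i \<le> q N" "p i \<le> p N" using anti q p by (simp_all add: antimono_def)
        then show ?thesis using Q[OF q] Q[OF p] by simp
      qed (use a in simp)
      then show "q = p" by auto
    qed auto
    then show "b q * Poly_Mapping.lookup (?a q) ?m = (if q = p then b p else 0)"
      using lookup_alternant[OF anti[OF q] anti[OF p]] by auto
  qed
  also have "\<dots> = b p" using fin p by simp
  finally have "b p = var_t * Poly_Mapping.lookup B ?m" unfolding B lookup_pol_c_mult ..
  then show ?thesis by simp
qed

text \<open>All coefficients are divisible by \<open>t\<close>, and cancelling it leaves a relation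
  of the same form. So every power of \<open>t\<close> divides \<open>b p\<close>, which is
  impossible beyond the degree of a nonzero polynomial.\<close>

lemma hl_num_independent:
  assumes fin: "finite Q" and Q: "\<And>q. q \<in> Q \<Longrightarrow> is_partition q \<and> q N = 0"
    and sum0: "(\<Sum>q\<in>Q. pol_c (b q) * hl_num N q) = 0" and p: "p \<in> Q"
  shows "b p = 0"
proof -
  have "\<forall>q\<in>Q. var_t ^ n dvd b q" for n
    using sum0
  proof (induction n arbitrary: b)
    case (Suc n)
    have "\<forall>q\<in>Q. \<exists>c. b q = var_t * c"
      using hl_num_independent_dvd[OF fin Q Suc.prems] by (auto elim: dvdE)
    then obtain b' where b': "\<And>q. q \<in> Q \<Longrightarrow> b q = var_t * b' q" by metis
    have "pol_c var_t * (\<Sum>q\<in>Q. pol_c (b' q) * hl_num N q) = (\<Sum>q\<in>Q. pol_c (b q) * hl_num N q)"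
      unfolding sum_distrib_left by (rule sum.cong) (simp_all add: b' pol_c_mult mult.assoc)
    moreover have "pol_c var_t \<noteq> 0"
    proof
      assume "pol_c var_t = 0"
      then have "var_t = 0" by (metis lookup_single_eq lookup_zero pol_c_def)
      then show False by (simp add: var_t_def)
    qed
    ultimately have "(\<Sum>q\<in>Q. pol_c (b' q) * hl_num N q) = 0"
      unfolding Suc.prems mult_eq_0_iff by blast
    from Suc.IH[OF this] show ?case by (simp add: b' mult_dvd_mono)
  qed simp
  then have d: "var_t ^ Suc (degree (b p)) dvd b p" using p by blast
  show ?thesis
  proof (rule ccontr)
    assume "b p \<noteq> 0"
    with d have "degree (var_t ^ Suc (degree (b p))) \<le> degree (b p)" by (rule dvd_imp_degree_le)
    moreover have "degree (var_t ^ n) = n" for n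
      by (simp add: var_t_def degree_power_eq)
    ultimately show False by (metis Suc_n_not_le_n)
  qed
qed

theorem hall_littlewood_independent:
  assumes fin: "finite Q" and Q: "Q \<subseteq> {q. is_partition q}"
    and sum0: "\<And>N. (\<Sum>q\<in>Q. scalar (K q) * hall_littlewood N var_x (scalar var_t) q) = 0"
    and p: "p \<in> Q"
  shows "K p = 0"
proof -
  \<comment> \<open>The entry \<open>conjugate q 0\<close> is the number of parts of
    \<open>q\<close>, so with \<open>N\<close> variables no function in the relation vanishes for
    lack of room.\<close>
  define N where "N = (\<Sum>q\<in>Q. conjugate q 0)"
  have qN: "q N = 0" if "q \<in> Q" for q
  proof -
    have "conjugate q 0 \<le> N" unfolding N_def by (rule member_le_sum[OF that]) (simp_all add: fin)
    then show ?thesis using less_conjugate_iff[of q N 0] Q that by auto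
  qed
  have "\<forall>q. \<exists>V. hl_norm N (scalar var_t) q = scalar V" using hl_norm_scalar by metis
  then obtain V where V: "\<And>q. hl_norm N (scalar var_t) q = scalar (V q)" by metis
  have Vnz: "V q \<noteq> 0" if "q \<in> Q" for q
  proof -
    have q: "is_partition q" using Q that by auto
    have "conjugate q 0 \<le> N" using less_conjugate_iff[OF q, of N 0] qN[OF that] by simp
    then have "hl_norm N (scalar var_t) q \<noteq> 0"
      using hl.hl_norm_conjugate_nz[OF is_partition_conjugate[OF q]] by (simp add: conjugate_conjugate[OF q])
    then show ?thesis using V[of q] by auto
  qed
  \<comment> \<open>Multiplying the relation by all norms cancels the one of \<open>q\<close> and
    leaves the product of the others as a nonzero factor of its coefficient.\<close>
  define D where "D q = (\<Prod>q'\<in>Q - {q}. V q')" for q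
  have Dnz: "D q \<noteq> 0" for q unfolding D_def using Vnz fin by auto
  have "to_fract (\<Sum>q\<in>Q. pol_c (K q * D q) * hl_num N q) =
    (\<Sum>q\<in>Q. scalar (K q) * hall_littlewood N var_x (scalar var_t) q) * (scalar (\<Prod>q\<in>Q. V q) * vdm N var_x)"
    unfolding to_fract_sum sum_distrib_right
  proof (rule sum.cong[OF refl])
    fix q assume q: "q \<in> Q"
    have "(\<Prod>q\<in>Q. V q) = V q * D q" unfolding D_def using fin q by (rule prod.remove)
    moreover have "hall_littlewood N var_x (scalar var_t) q = hl_sym N var_x (scalar var_t) q / scalar (V q)"
      using qN[OF q] by (simp add: hall_littlewood_def hl_sym_def pairs_def V)
    moreover have "scalar (V q) \<noteq> 0" using Vnz[OF q] by (simp flip: scalar_0)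
    ultimately show "to_fract (pol_c (K q * D q) * hl_num N q) =
      scalar (K q) * hall_littlewood N var_x (scalar var_t) q * (scalar (\<Prod>q\<in>Q. V q) * vdm N var_x)"
      by (simp add: to_fract_pol_c scalar_mult flip: hl_sym_times_vdm)
  qed
  also have "\<dots> = 0" unfolding sum0 by simp
  finally have "(\<Sum>q\<in>Q. pol_c (K q * D q) * hl_num N q) = 0" unfolding to_fract_eq_0_iff .
  from hl_num_independent[OF fin _ this p] have "K p * D p = 0" using Q qN by auto
  then show ?thesis using Dnz by simp
qed

section \<open>Expansion of Schur functions\<close>

abbreviation HLx :: "nat \<Rightarrow> seq \<Rightarrow> rat_fun" where
  "HLx N q \<equiv> hall_littlewood N var_x (scalar var_t) q"

lemma scalar_pieri_h:
  assumes l: "is_partition l"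
  shows "pieri_h (scalar var_t) l c = scalar (pieri_h var_t l c)"
proof -
  obtain b where b: "\<And>a. b \<le> Suc a \<Longrightarrow> l a = 0" using is_partition_bound[OF l] by blast
  then have lb: "l a = 0" if "b \<le> a" for a using that by simp
  show ?thesis
    by (simp add: pieri_h_eq[of b l, OF lb] scalar_mult scalar_prod scalar_power scalar_gauss_binom)
qed

lemma hsym_times_expansion:
  "hsym N var_x m * (\<Sum>c\<in>partitions_of n. scalar (K c) * HLx N (conjugate c)) =
   (\<Sum>l\<in>partitions_of (n + m). scalar (\<Sum>c\<in>partitions_of n. pieri_h var_t l c * K c) * HLx N (conjugate l))"
proof -
  have "hsym N var_x m * (\<Sum>c\<in>partitions_of n. scalar (K c) * HLx N (conjugate c)) =
    (\<Sum>c\<in>partitions_of n. scalar (K c) * (hsym N var_x m * HLx N (conjugate c)))"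
    by (simp add: sum_distrib_left mult_ac)
  also have "\<dots> = (\<Sum>c\<in>partitions_of n. scalar (K c) *
      (\<Sum>l\<in>partitions_of (n + m). scalar (pieri_h var_t l c) * HLx N (conjugate l)))"
  proof (intro sum.cong[OF refl] arg_cong2[where f = "(*)"] refl)
    fix c assume c: "c \<in> partitions_of n"
    then have "hsym N var_x m * HLx N (conjugate c) =
      (\<Sum>l\<in>partitions_of (n + m). pieri_h (scalar var_t) l c * HLx N (conjugate l))"
      using hl.hsym_times_HL[of c N m] by (simp add: partitions_of_def)
    also have "\<dots> = (\<Sum>l\<in>partitions_of (n + m). scalar (pieri_h var_t l c) * HLx N (conjugate l))"
      by (rule sum.cong) (simp_all add: scalar_pieri_h partitions_of_def)
    finally show "hsym N var_x m * HLx N (conjugate c) = \<dots>" .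
  qed
  also have "\<dots> = (\<Sum>l\<in>partitions_of (n + m). scalar (\<Sum>c\<in>partitions_of n. pieri_h var_t l c * K c) * HLx N (conjugate l))"
    unfolding scalar_sum sum_distrib_left sum_distrib_right scalar_mult
    by (subst sum.swap) (simp add: mult_ac)
  finally show ?thesis .
qed

definition hl_comb :: "nat \<Rightarrow> (seq \<Rightarrow> int poly) \<Rightarrow> nat \<Rightarrow> rat_fun" where
  "hl_comb n K N = (\<Sum>c\<in>partitions_of n. scalar (K c) * HLx N (conjugate c))"

text \<open>A single family of coefficients in Z[t] serves all \<open>N\<close>; this uniformity is
  what \<open>hl_expansion\<close> demands.\<close>

definition expandable :: "nat \<Rightarrow> (nat \<Rightarrow> rat_fun) \<Rightarrow> bool" where
  "expandable n F \<longleftrightarrow> (\<exists>K. F = hl_comb n K)"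

lemma expandable_diff:
  assumes "expandable n F" "expandable n G"
  shows "expandable n (\<lambda>N. F N - G N)"
proof -
  obtain K L where "F = hl_comb n K" "G = hl_comb n L"
    using assms unfolding expandable_def by blast
  then have "(\<lambda>N. F N - G N) = hl_comb n (\<lambda>c. K c - L c)"
    by (simp add: fun_eq_iff hl_comb_def scalar_diff left_diff_distrib sum_subtractf)
  then show ?thesis unfolding expandable_def by - (rule exI)
qed

lemma expandable_sum:
  assumes "\<And>i. i \<in> I \<Longrightarrow> expandable n (F i)"
  shows "expandable n (\<lambda>N. \<Sum>i\<in>I. F i N)"
proof -
  have "\<forall>i\<in>I. \<exists>K. F i = hl_comb n K" using assms unfolding expandable_def by blast
  then obtain K where K: "\<forall>i\<in>I. F i = hl_comb n (K i)" by (rule bchoice[THEN exE])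
  have "(\<Sum>i\<in>I. F i N) = hl_comb n (\<lambda>c. \<Sum>i\<in>I. K i c) N" for N
  proof -
    have "(\<Sum>i\<in>I. F i N) = (\<Sum>i\<in>I. hl_comb n (K i) N)" using K by simp
    also have "\<dots> = hl_comb n (\<lambda>c. \<Sum>i\<in>I. K i c) N"
      unfolding hl_comb_def scalar_sum sum_distrib_right by (rule sum.swap)
    finally show ?thesis .
  qed
  then have "(\<lambda>N. \<Sum>i\<in>I. F i N) = hl_comb n (\<lambda>c. \<Sum>i\<in>I. K i c)" by (rule ext)
  then show ?thesis unfolding expandable_def by - (rule exI)
qed

lemma expandable_hsym:
  assumes "expandable n F"
  shows "expandable (n + m) (\<lambda>N. hsym N var_x m * F N)"
proof -
  obtain K where "F = hl_comb n K" using assms unfolding expandable_def by blast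
  then have "(\<lambda>N. hsym N var_x m * F N) = hl_comb (n + m) (\<lambda>l. \<Sum>c\<in>partitions_of n. pieri_h var_t l c * K c)"
    by (simp add: fun_eq_iff hl_comb_def hsym_times_expansion)
  then show ?thesis unfolding expandable_def by - (rule exI)
qed

lemma partitions_of_psize:
  assumes "k \<in> partitions_of n"
  shows "(\<Sum>a<n. k a) = n"
proof -
  have "psize k = (\<Sum>a<n. k a)" by (rule psize_eq) (rule partitions_of_eq_0[OF assms])
  then show ?thesis using assms by (simp add: partitions_of_def)
qed

text \<open>In terms of the conjugate \<open>c\<close>, a partition arises by adding a horizontal strip in its first \<open>m\<close>
  columns, and any other horizontal strip of the same size lies further to the right.\<close>

lemma horizontal_strip_weight:
  assumes c: "c \<in> partitions_of n" and l: "l \<in> partitions_of n" and "l \<noteq> c"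
    and hs: "horizontal_strip l d" and d: "\<And>a. c a = d a + of_bool (a < m)"
  shows "(\<Sum>a<n. a * c a) < (\<Sum>a<n. a * l a)"
proof -
  \<comment> \<open>For \<open>a < m\<close> the value \<open>c a\<close> is the largest that the
    strip condition allows, for other \<open>a\<close> the smallest, so \<open>?f\<close> is never
    negative. As \<open>c\<close> and \<open>l\<close> have equal size, the part with
    \<open>m\<close> drops out and the sum of \<open>?f\<close> is the difference of the
    weights.\<close>
  let ?f = "\<lambda>a. (int a - int m) * (int (l a) - int (c a))"
  have dl: "d a \<le> l a" "l a \<le> Suc (d a)" for a using hs by (auto simp: horizontal_strip_def le_fun_def)
  have nn: "0 \<le> ?f a" for a
    using dl[of a] d[of a] by (cases "a < m") (auto intro: mult_nonneg_nonneg mult_nonpos_nonpos)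
  have "\<exists>a. l a < c a"
  proof (rule ccontr)
    assume "\<not> ?thesis"
    then have "c \<le> l" by (auto simp: le_fun_def not_less)
    then show False using psize_le_eq[of c l] c l \<open>l \<noteq> c\<close> by (auto simp: partitions_of_def)
  qed
  then obtain a where a: "l a < c a" by blast
  have an: "a < n" using a partitions_of_eq_0[OF c, of a] by (cases "a < n") auto
  have am: "a < m" using a d[of a] dl[of a] by (cases "a < m") auto
  have "0 < ?f a" using a am by (intro mult_neg_neg) auto
  then have "0 < (\<Sum>a<n. ?f a)" using nn an by (intro sum_pos2[of _ a]) auto
  also have "(\<Sum>a<n. ?f a) = (int (\<Sum>a<n. a * l a) - int (\<Sum>a<n. a * c a)) -
    int m * (int (\<Sum>a<n. l a) - int (\<Sum>a<n. c a))"
    by (simp add: algebra_simps sum.distrib sum_subtractf sum_distrib_left)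
  finally show ?thesis
    unfolding partitions_of_psize[OF c] partitions_of_psize[OF l] by (simp del: of_nat_sum)
qed

text \<open>Here \<open>m\<close> counts the columns of maximal height, which is the length of the
  bottom row; shortening these columns by one removes that row.\<close>

lemma remove_row:
  assumes c: "c \<in> partitions_of n" and n: "n > 0"
  obtains d m where "m > 0" "m \<le> n" "d \<in> partitions_of (n - m)" "\<And>a. c a = d a + of_bool (a < m)"
proof -
  have cp: "is_partition c" using c by (simp add: partitions_of_def)
  have anti: "i \<le> j \<Longrightarrow> c j \<le> c i" for i j using is_partition_antimono[OF cp] by (simp add: antimono_def)
  have c0: "c 0 > 0"
  proof (rule ccontr)
    assume "\<not> c 0 > 0"
    then have "c a = 0" for a using anti[of 0 a] by simp
    then show False using partitions_of_psize[OF c] n by simp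
  qed
  define m where "m = (LEAST a. c a < c 0)"
  have cn: "c n < c 0" using partitions_of_eq_0[OF c] c0 by simp
  have cm: "c m < c 0" unfolding m_def using cn by (rule LeastI)
  have mn: "m \<le> n" unfolding m_def using cn by (rule Least_le)
  have lt: "c a = c 0" if "a < m" for a
    using not_less_Least[OF that[unfolded m_def]] anti[of 0 a] by simp
  have m0: "m > 0" using cm by (cases m) auto
  define d where "d a = c a - of_bool (a < m)" for a
  have cd: "c a = d a + of_bool (a < m)" for a using lt[of a] c0 by (auto simp: d_def)
  have "is_partition d"
  proof (rule is_partitionI)
    fix a show "d (Suc a) \<le> d a"
    proof (cases "Suc a = m")
      case True
      then show ?thesis using cm lt[of a] by (auto simp: d_def)
    next
      case False
      then show ?thesis using anti[of a "Suc a"] by (auto simp: d_def intro: diff_le_mono)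
    qed
  next
    fix a assume "n \<le> a"
    then show "d a = 0" using partitions_of_eq_0[OF c] by (simp add: d_def)
  qed
  moreover have "psize d = n - m"
  proof -
    have "psize d = (\<Sum>a<n. d a)" by (rule psize_eq) (simp add: d_def partitions_of_eq_0[OF c])
    moreover have "n = (\<Sum>a<n. d a) + (\<Sum>a<n. of_bool (a < m))"
      using partitions_of_psize[OF c] by (simp add: cd sum.distrib)
    moreover have "(\<Sum>a<n. of_bool (a < m)) = m"
    proof -
      have "{..<n} \<inter> {a. a < m} = {..<m}" using mn by auto
      then show ?thesis by (simp add: sum_of_bool_eq)
    qed
    ultimately show ?thesis by simp
  qed
  ultimately show ?thesis using that[of m d] m0 mn cd by (simp add: partitions_of_def)
qed

text \<open>With \<open>m\<close> the smallest part and \<open>d\<close> the remaining shape, the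
  Pieri rule writes the product of \<open>h_m\<close> and the Schur function of \<open>d\<close> as
  that of \<open>c\<close> plus others of larger column weight. The product is covered by induction
  on \<open>n\<close>, the others by an inner induction on the weight.\<close>

lemma schur_expandable:
  "c \<in> partitions_of n \<Longrightarrow> expandable n (\<lambda>N. schur N var_x (conjugate c))"
proof (induction n arbitrary: c rule: less_induct)
  case (less n)
  note IH_n = less.IH
  show ?case
  proof (cases "n = 0")
    case True
    then have "c = (\<lambda>_. 0)" using less.prems partitions_of_0 by auto
    then have "schur N var_x (conjugate c) = 1" for N
      using prod_hsym_eq_schur[OF inj_var_x var_x_nz, of N "[]"]
      by (simp add: conjugate_0 partitions_of_0 kostka_Nil)
    then show ?thesis
      unfolding expandable_def True
      by (intro exI[of _ "\<lambda>_. 1"])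
        (simp add: fun_eq_iff hl_comb_def partitions_of_0 conjugate_0 hl.hall_littlewood_0)
  next
    case False
    \<comment> \<open>Since \<open>n * n\<close> bounds the column weight of every partition of
      \<open>n\<close>, this measure drops strictly when the weight grows.\<close>
    define w where "w c = n * n - (\<Sum>a<n. a * c a)" for c :: seq
    show ?thesis
      using less.prems
    proof (induction "w c" arbitrary: c rule: less_induct)
      case less
      note c = less.prems
      obtain d m where m: "m > 0" "m \<le> n" and d: "d \<in> partitions_of (n - m)"
        and cd: "\<And>a. c a = d a + of_bool (a < m)"
        using remove_row[OF c] False by (metis neq0_conv)
      let ?S = "\<lambda>l N. schur N var_x (conjugate l)"
      let ?L = "{l \<in> partitions_of n. horizontal_strip l d} - {c}"
      have nm: "n - m + m = n" using m by simp
      have dp: "is_partition d" "psize d = n - m" using d by (auto simp: partitions_of_def)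
      have hc: "horizontal_strip c d" using cd by (auto simp: horizontal_strip_def le_fun_def)
      have "hsym N var_x m * ?S d N = (\<Sum>l\<in>{l \<in> partitions_of n. horizontal_strip l d}. ?S l N)" for N
        using hsym_times_schur[OF inj_var_x var_x_nz dp(1), of N m] nm dp(2)
        by (simp add: sum.inter_filter[OF finite_partitions_of] if_distrib cong: if_cong)
          (auto intro!: sum.cong)
      also have "(\<Sum>l\<in>{l \<in> partitions_of n. horizontal_strip l d}. ?S l N) = ?S c N + (\<Sum>l\<in>?L. ?S l N)" for N
        by (rule sum.remove) (use c hc finite_partitions_of[of n] in auto)
      finally have S: "?S c N = hsym N var_x m * ?S d N - (\<Sum>l\<in>?L. ?S l N)" for N by simp
      have "expandable (n - m + m) (\<lambda>N. hsym N var_x m * ?S d N)"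
        by (rule expandable_hsym, rule IH_n[OF _ d]) (use m in simp)
      moreover have "expandable n (\<lambda>N. \<Sum>l\<in>?L. ?S l N)"
      proof (rule expandable_sum)
        fix l assume l: "l \<in> ?L"
        then have lp: "l \<in> partitions_of n" by simp
        have "(\<Sum>a<n. a * c a) < (\<Sum>a<n. a * l a)"
          by (rule horizontal_strip_weight[OF c lp _ _ cd]) (use l in auto)
        moreover have "(\<Sum>a<n. a * l a) \<le> n * n"
        proof -
          have "(\<Sum>a<n. a * l a) \<le> (\<Sum>a<n. n * l a)" by (rule sum_mono) auto
          then show ?thesis using partitions_of_psize[OF lp] by (simp flip: sum_distrib_left)
        qed
        ultimately have "w l < w c" by (simp add: w_def)
        then show "expandable n (?S l)" using lp by (rule less.hyps)
      qed
      ultimately show ?case unfolding S nm by (rule expandable_diff)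
    qed
  qed
qed

section \<open>Kostka--Foulkes polynomials\<close>

lemma hl_expansion_unique:
  assumes K: "hl_expansion p K" and L: "hl_expansion p L"
  shows "K = L"
proof (rule poly_mapping_eqI)
  fix q
  let ?Q = "Poly_Mapping.keys K \<union> Poly_Mapping.keys L"
  have ext: "schur N var_x p = (\<Sum>q\<in>?Q. scalar (Poly_Mapping.lookup M q) * HLx N q)"
    if M: "hl_expansion p M" and "Poly_Mapping.keys M \<subseteq> ?Q" for M N
  proof -
    have "schur N var_x p = (\<Sum>q\<in>Poly_Mapping.keys M. scalar (Poly_Mapping.lookup M q) * HLx N q)"
      using M by (simp add: hl_expansion_def)
    also have "\<dots> = (\<Sum>q\<in>?Q. scalar (Poly_Mapping.lookup M q) * HLx N q)"
      by (rule sum.mono_neutral_left) (use that(2) in \<open>auto simp: in_keys_iff\<close>)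
    finally show ?thesis .
  qed
  show "Poly_Mapping.lookup K q = Poly_Mapping.lookup L q"
  proof (cases "q \<in> ?Q")
    case True
    have "Poly_Mapping.lookup K q - Poly_Mapping.lookup L q = 0"
    proof (rule hall_littlewood_independent[where Q = ?Q and K = "\<lambda>q. Poly_Mapping.lookup K q - Poly_Mapping.lookup L q"])
      show "?Q \<subseteq> {q. is_partition q}" using K L by (auto simp: hl_expansion_def)
      fix N
      show "(\<Sum>q\<in>?Q. scalar (Poly_Mapping.lookup K q - Poly_Mapping.lookup L q) * HLx N q) = 0"
        using ext[OF K, of N] ext[OF L, of N]
        by (simp add: scalar_diff left_diff_distrib sum_subtractf)
    qed (use True in auto)
    then show ?thesis by simp
  qed (simp add: in_keys_iff)
qed

text \<open>Existence and uniqueness together evaluate the definite description. The coefficients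
  found are cut off outside the partitions of \<open>n\<close>, where an expansion in degree
  \<open>n\<close> says nothing, to give finite support.\<close>

lemma schur_eq_sum_kostka_foulkes:
  assumes p: "p \<in> partitions_of n"
  shows "schur N var_x p = (\<Sum>q\<in>partitions_of n. scalar (kostka_foulkes p q) * HLx N q)"
proof -
  have pp: "is_partition p" using p by (simp add: partitions_of_def)
  have "conjugate p \<in> partitions_of n" using bij_betwE[OF bij_betw_conjugate] p by blast
  from schur_expandable[OF this] obtain K where "(\<lambda>N. schur N var_x p) = hl_comb n K"
    unfolding expandable_def conjugate_conjugate[OF pp] by blast
  then have K: "schur N var_x p = (\<Sum>c\<in>partitions_of n. scalar (K c) * HLx N (conjugate c))" for N
    using fun_cong[of "\<lambda>N. schur N var_x p" "hl_comb n K" N] by (simp add: hl_comb_def)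
  define k where "k q = (if q \<in> partitions_of n then K (conjugate q) else 0)" for q
  have fin: "finite {q. k q \<noteq> 0}"
    by (rule finite_subset[OF _ finite_partitions_of[of n]]) (auto simp: k_def)
  define M where "M = Abs_poly_mapping k"
  have M: "Poly_Mapping.lookup M = k" unfolding M_def using fin by (rule lookup_Abs_poly_mapping)
  have keys: "Poly_Mapping.keys M \<subseteq> partitions_of n"
    by (auto simp: in_keys_iff M k_def split: if_splits)
  have s: "schur N var_x p = (\<Sum>q\<in>partitions_of n. scalar (k q) * HLx N q)" for N
  proof -
    have "schur N var_x p = (\<Sum>c\<in>partitions_of n. scalar (K (conjugate (conjugate c))) * HLx N (conjugate c))"
      unfolding K by (rule sum.cong) (auto simp: conjugate_conjugate partitions_of_def)
    also have "\<dots> = (\<Sum>q\<in>partitions_of n. scalar (K (conjugate q)) * HLx N q)"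
      by (rule sum_partitions_conjugate)
    also have "\<dots> = (\<Sum>q\<in>partitions_of n. scalar (k q) * HLx N q)"
      by (rule sum.cong) (auto simp: k_def)
    finally show ?thesis .
  qed
  have "hl_expansion p M"
    unfolding hl_expansion_def
  proof (intro conjI allI)
    show "Poly_Mapping.keys M \<subseteq> {q. is_partition q}" using keys by (auto simp: partitions_of_def)
    fix N
    show "schur N var_x p = (\<Sum>q\<in>Poly_Mapping.keys M. scalar (Poly_Mapping.lookup M q) * HLx N q)"
      unfolding s by (rule sum.mono_neutral_cong_right[OF finite_partitions_of keys]) (auto simp: in_keys_iff M)
  qed
  then have "(THE K. hl_expansion p K) = M" using hl_expansion_unique by blast
  then show ?thesis unfolding s by (simp add: kostka_foulkes_def M)
qed

section \<open>Flags of partitions\<close>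

text \<open>The top member is a free parameter, so that induction on \<open>\<mu>\<close> can pass
  to the flags below any of its possible predecessors.\<close>

definition flags_to :: "seq \<Rightarrow> nat list \<Rightarrow> seq list set" where
  "flags_to c \<mu> = {\<nu>. length \<nu> = length \<mu> + 1 \<and>
     (\<forall>k\<le>length \<mu>. is_partition (\<nu> ! k)) \<and>
     \<nu> ! 0 = (\<lambda>_. 0) \<and> \<nu> ! length \<mu> = c \<and>
     (\<forall>k<length \<mu>. \<nu> ! k \<le> \<nu> ! (k + 1)) \<and>
     (\<forall>k\<in>{1..length \<mu>}. psize (\<nu> ! k) = (\<Sum>j<k. \<mu> ! j))}"

lemma flags_eq_flags_to: "flags p \<mu> = flags_to (conjugate p) \<mu>"
  by (simp add: flags_def flags_to_def)

definition flag_weight :: "nat \<Rightarrow> seq list \<Rightarrow> int poly" where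
  "flag_weight r \<nu> = (\<Prod>k<r. pieri_h var_t (\<nu> ! (k + 1)) (\<nu> ! k))"

lemma psize_0: "psize (\<lambda>_. 0) = 0"
  by (simp add: psize_def)

lemma flags_toD:
  assumes "\<nu> \<in> flags_to c \<mu>"
  shows "length \<nu> = length \<mu> + 1" "k \<le> length \<mu> \<Longrightarrow> is_partition (\<nu> ! k)"
    "\<nu> ! 0 = (\<lambda>_. 0)" "\<nu> ! length \<mu> = c" "k < length \<mu> \<Longrightarrow> \<nu> ! k \<le> \<nu> ! (k + 1)"
    "k \<le> length \<mu> \<Longrightarrow> psize (\<nu> ! k) = (\<Sum>j<k. \<mu> ! j)"
  using assms by (cases k; auto simp: flags_to_def psize_0)+

lemma flags_to_Nil: "flags_to (\<lambda>_. 0) [] = {[\<lambda>_. 0]}"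
proof -
  have "is_partition (\<lambda>_. 0)" by (rule is_partitionI) auto
  then show ?thesis by (auto simp: flags_to_def length_Suc_conv)
qed

lemma flags_to_snoc:
  assumes c: "c \<in> partitions_of (sum_list \<mu> + m)"
  shows "bij_betw (\<lambda>(d, \<nu>). \<nu> @ [c]) (Sigma {d \<in> partitions_of (sum_list \<mu>). d \<le> c} (\<lambda>d. flags_to d \<mu>))
    (flags_to c (\<mu> @ [m]))"
proof (rule bij_betwI[where g = "\<lambda>\<nu>. (\<nu> ! length \<mu>, butlast \<nu>)"])
  let ?D = "Sigma {d \<in> partitions_of (sum_list \<mu>). d \<le> c} (\<lambda>d. flags_to d \<mu>)"
  have total: "(\<Sum>j<length \<mu>. \<mu> ! j) = sum_list \<mu>" by (simp add: sum_list_sum_nth lessThan_atLeast0)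
  have cp: "is_partition c" "psize c = sum_list \<mu> + m" using c by (auto simp: partitions_of_def)
  show "(\<lambda>(d, \<nu>). \<nu> @ [c]) \<in> ?D \<rightarrow> flags_to c (\<mu> @ [m])"
  proof clarify
    fix d \<nu> assume dc: "d \<le> c" and \<nu>: "\<nu> \<in> flags_to d \<mu>"
    note F = flags_toD[OF \<nu>]
    have nth: "(\<nu> @ [c]) ! k = (if k \<le> length \<mu> then \<nu> ! k else c)" if "k \<le> Suc (length \<mu>)" for k
      using F(1) that by (auto simp: nth_append)
    have sums: "(\<Sum>j<k. (\<mu> @ [m]) ! j) = (if k \<le> length \<mu> then (\<Sum>j<k. \<mu> ! j) else sum_list \<mu> + m)"
      if "k \<le> Suc (length \<mu>)" for k
    proof (cases "k \<le> length \<mu>")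
      case False
      then have "k = Suc (length \<mu>)" using that by simp
      then show ?thesis using total by (simp add: nth_append)
    qed (auto simp: nth_append)
    show "\<nu> @ [c] \<in> flags_to c (\<mu> @ [m])"
      unfolding flags_to_def mem_Collect_eq
    proof (intro conjI allI ballI impI)
      show "length (\<nu> @ [c]) = length (\<mu> @ [m]) + 1" using F(1) by simp
      show "is_partition ((\<nu> @ [c]) ! k)" if "k \<le> length (\<mu> @ [m])" for k
        using that F(2) cp by (simp add: nth)
      show "(\<nu> @ [c]) ! 0 = (\<lambda>_. 0)" using F(3) by (simp add: nth)
      show "(\<nu> @ [c]) ! length (\<mu> @ [m]) = c" by (simp add: nth)
      show "(\<nu> @ [c]) ! k \<le> (\<nu> @ [c]) ! (k + 1)" if "k < length (\<mu> @ [m])" for k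
      proof (cases "k = length \<mu>")
        case True
        then show ?thesis using F(4) dc by (simp add: nth)
      next
        case False
        then show ?thesis using that F(5)[of k] by (simp add: nth)
      qed
      show "psize ((\<nu> @ [c]) ! k) = (\<Sum>j<k. (\<mu> @ [m]) ! j)" if "k \<in> {1..length (\<mu> @ [m])}" for k
        using that F(6)[of k] cp by (simp add: nth sums del: sum.lessThan_Suc)
    qed
  qed
  show "(\<lambda>\<nu>. (\<nu> ! length \<mu>, butlast \<nu>)) \<in> flags_to c (\<mu> @ [m]) \<rightarrow> ?D"
  proof
    fix \<nu> assume \<nu>: "\<nu> \<in> flags_to c (\<mu> @ [m])"
    note F = flags_toD[OF \<nu>]
    have nth: "butlast \<nu> ! k = \<nu> ! k" if "k \<le> length \<mu>" for k
      using F(1) that by (simp add: nth_butlast)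
    have sums: "(\<Sum>j<k. (\<mu> @ [m]) ! j) = (\<Sum>j<k. \<mu> ! j)" if "k \<le> length \<mu>" for k
      using that by (auto simp: nth_append)
    have "butlast \<nu> \<in> flags_to (\<nu> ! length \<mu>) \<mu>"
      unfolding flags_to_def mem_Collect_eq
      using F(1) F(2) F(3) F(5) F(6) by (auto simp: nth sums)
    moreover have "\<nu> ! length \<mu> \<in> partitions_of (sum_list \<mu>)"
      using F(2)[of "length \<mu>"] F(6)[of "length \<mu>"] by (simp add: partitions_of_def sums total)
    moreover have "\<nu> ! length \<mu> \<le> c" using F(5)[of "length \<mu>"] F(4) by simp
    ultimately show "(\<nu> ! length \<mu>, butlast \<nu>) \<in> ?D" by simp
  qed
  fix \<nu> assume \<nu>: "\<nu> \<in> flags_to c (\<mu> @ [m])"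
  have "\<nu> \<noteq> []" using flags_toD(1)[OF \<nu>] by auto
  moreover from this have "last \<nu> = c" using flags_toD(1,4)[OF \<nu>] by (simp add: last_conv_nth)
  ultimately show "(case (\<nu> ! length \<mu>, butlast \<nu>) of (d, \<nu>) \<Rightarrow> \<nu> @ [c]) = \<nu>"
    using append_butlast_last_id[of \<nu>] by simp
next
  fix y assume "y \<in> Sigma {d \<in> partitions_of (sum_list \<mu>). d \<le> c} (\<lambda>d. flags_to d \<mu>)"
  then obtain d \<nu> where y: "y = (d, \<nu>)" "\<nu> \<in> flags_to d \<mu>" by auto
  then show "(\<lambda>\<nu>. (\<nu> ! length \<mu>, butlast \<nu>)) ((\<lambda>(d, \<nu>). \<nu> @ [c]) y) = y"
    using flags_toD(1,4)[OF y(2)] by (simp add: nth_append)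
qed

lemma finite_flags_to: "c \<in> partitions_of (sum_list \<mu>) \<Longrightarrow> finite (flags_to c \<mu>)"
proof (induction \<mu> arbitrary: c rule: rev_induct)
  case Nil
  then show ?case by (simp add: partitions_of_0 flags_to_Nil)
next
  case (snoc m \<mu>)
  have "finite (Sigma {d \<in> partitions_of (sum_list \<mu>). d \<le> c} (\<lambda>d. flags_to d \<mu>))"
    using finite_partitions_of[of "sum_list \<mu>"] snoc.IH by (intro finite_SigmaI) auto
  then show ?case using bij_betw_finite[OF flags_to_snoc] snoc.prems by simp
qed

text \<open>Flags ending in \<open>c\<close> are flags ending in some \<open>d <= c\<close> with
  \<open>c\<close> appended. This reproduces the recursion for coefficients in
  \<open>hsym_times_expansion\<close>; the other \<open>d\<close> enter with \<open>pieri_h\<close>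
  equal to 0.\<close>

lemma sum_flags_to_snoc:
  assumes c: "c \<in> partitions_of (sum_list \<mu> + m)"
  shows "(\<Sum>\<nu>\<in>flags_to c (\<mu> @ [m]). flag_weight (length (\<mu> @ [m])) \<nu>) =
    (\<Sum>d\<in>partitions_of (sum_list \<mu>). pieri_h var_t c d * (\<Sum>\<nu>\<in>flags_to d \<mu>. flag_weight (length \<mu>) \<nu>))"
proof -
  let ?D = "{d \<in> partitions_of (sum_list \<mu>). d \<le> c}"
  have fin: "finite ?D" using finite_partitions_of[of "sum_list \<mu>"] by simp
  have "(\<Sum>\<nu>\<in>flags_to c (\<mu> @ [m]). flag_weight (length (\<mu> @ [m])) \<nu>) =
    (\<Sum>(d, \<nu>)\<in>Sigma ?D (\<lambda>d. flags_to d \<mu>). flag_weight (length (\<mu> @ [m])) (\<nu> @ [c]))"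
    by (subst sum.reindex_bij_betw[OF flags_to_snoc[OF c], symmetric]) (simp add: case_prod_unfold)
  also have "\<dots> = (\<Sum>(d, \<nu>)\<in>Sigma ?D (\<lambda>d. flags_to d \<mu>). pieri_h var_t c d * flag_weight (length \<mu>) \<nu>)"
  proof (rule sum.cong[OF refl])
    fix y assume "y \<in> Sigma ?D (\<lambda>d. flags_to d \<mu>)"
    then obtain d \<nu> where y: "y = (d, \<nu>)" "\<nu> \<in> flags_to d \<mu>" by auto
    note F = flags_toD[OF y(2)]
    have "flag_weight (length \<mu>) (\<nu> @ [c]) = flag_weight (length \<mu>) \<nu>"
      unfolding flag_weight_def by (rule prod.cong) (use F(1) in \<open>auto simp: nth_append\<close>)
    moreover have "flag_weight (Suc (length \<mu>)) (\<nu> @ [c]) = flag_weight (length \<mu>) (\<nu> @ [c]) * pieri_h var_t c d"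
      using F(1,4) by (simp add: flag_weight_def nth_append)
    ultimately show "(case y of (d, \<nu>) \<Rightarrow> flag_weight (length (\<mu> @ [m])) (\<nu> @ [c])) =
      (case y of (d, \<nu>) \<Rightarrow> pieri_h var_t c d * flag_weight (length \<mu>) \<nu>)"
      using y by (simp add: mult.commute)
  qed
  also have "\<dots> = (\<Sum>d\<in>?D. pieri_h var_t c d * (\<Sum>\<nu>\<in>flags_to d \<mu>. flag_weight (length \<mu>) \<nu>))"
    unfolding sum_distrib_left by (rule sum.Sigma[symmetric, OF fin]) (auto simp: finite_flags_to)
  also have "\<dots> = (\<Sum>d\<in>partitions_of (sum_list \<mu>). pieri_h var_t c d * (\<Sum>\<nu>\<in>flags_to d \<mu>. flag_weight (length \<mu>) \<nu>))"
    by (rule sum.mono_neutral_left[OF finite_partitions_of]) (auto simp: pieri_h_def)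
  finally show ?thesis .
qed

lemma prod_hsym_eq_flags:
  "(\<Prod>m\<leftarrow>\<mu>. hsym N var_x m) = (\<Sum>c\<in>partitions_of (sum_list \<mu>).
     scalar (\<Sum>\<nu>\<in>flags_to c \<mu>. flag_weight (length \<mu>) \<nu>) * HLx N (conjugate c))"
proof (induction \<mu> rule: rev_induct)
  case Nil
  show ?case
    by (simp add: partitions_of_0 flags_to_Nil flag_weight_def conjugate_0 hl.hall_littlewood_0)
next
  case (snoc m \<mu>)
  have "(\<Prod>m\<leftarrow>\<mu> @ [m]. hsym N var_x m) = hsym N var_x m * (\<Prod>m\<leftarrow>\<mu>. hsym N var_x m)"
    by (simp add: mult.commute)
  also have "\<dots> = (\<Sum>c\<in>partitions_of (sum_list \<mu> + m).
     scalar (\<Sum>d\<in>partitions_of (sum_list \<mu>). pieri_h var_t c d * (\<Sum>\<nu>\<in>flags_to d \<mu>. flag_weight (length \<mu>) \<nu>)) *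
     HLx N (conjugate c))"
    unfolding snoc by (rule hsym_times_expansion)
  also have "\<dots> = (\<Sum>c\<in>partitions_of (sum_list \<mu> + m).
     scalar (\<Sum>\<nu>\<in>flags_to c (\<mu> @ [m]). flag_weight (length (\<mu> @ [m])) \<nu>) * HLx N (conjugate c))"
    by (rule sum.cong[OF refl]) (simp only: sum_flags_to_snoc)
  finally show ?case by simp
qed

lemma pieri_h_eq_t_binomial:
  assumes l: "is_partition l" and cl: "c \<le> l"
  shows "pieri_h var_t l c = var_t ^ Sum_any (\<lambda>i. (l i - c i) choose 2) *
    Prod_any (\<lambda>i. t_binomial (l i - c (Suc i)) (c i - c (Suc i)))"
proof -
  obtain b where b: "\<And>a. b \<le> Suc a \<Longrightarrow> l a = 0" using is_partition_bound[OF l] by blast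
  have z: "l i = 0 \<and> c i = 0 \<and> c (Suc i) = 0" if "\<not> i < b" for i
    using b[of i] b[of "Suc i"] that cl by (auto simp: le_fun_def dest: spec[of _ i] spec[of _ "Suc i"])
  have "Sum_any (\<lambda>i. (l i - c i) choose 2) = (\<Sum>i<b. (l i - c i) choose 2)"
  proof (rule Sum_any.expand_superset)
    show "{i. (l i - c i) choose 2 \<noteq> 0} \<subseteq> {..<b}"
    proof
      fix i assume "i \<in> {i. (l i - c i) choose 2 \<noteq> 0}"
      then show "i \<in> {..<b}" using z[of i] by (cases "i < b") (auto simp: numeral_2_eq_2)
    qed
  qed simp
  moreover have "Prod_any (\<lambda>i. t_binomial (l i - c (Suc i)) (c i - c (Suc i))) =
    (\<Prod>i<b. t_binomial (l i - c (Suc i)) (c i - c (Suc i)))"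
  proof (rule Prod_any.expand_superset)
    show "{i. t_binomial (l i - c (Suc i)) (c i - c (Suc i)) \<noteq> 1} \<subseteq> {..<b}"
    proof
      fix i assume "i \<in> {i. t_binomial (l i - c (Suc i)) (c i - c (Suc i)) \<noteq> 1}"
      then show "i \<in> {..<b}" using z[of i] by (cases "i < b") (auto simp: t_binomial_eq_gauss_binom)
    qed
  qed simp
  moreover have "pieri_h var_t l c = (\<Prod>i<b. var_t ^ ((l i - c i) choose 2) *
     gauss_binom var_t (l i - c (Suc i)) (c i - c (Suc i)))"
    using cl b by (subst pieri_h_eq[of b]) auto
  ultimately show ?thesis
    by (simp add: prod.distrib power_sum t_binomial_eq_gauss_binom)
qed

lemma flag_weight_eq:
  assumes "\<nu> \<in> flags_to c \<mu>"
  shows "flag_weight (length \<mu>) \<nu> = var_t ^ flag_exponent (length \<mu>) \<nu> *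
       (\<Prod>k\<in>{1..<length \<mu>}. Prod_any (\<lambda>i.
          t_binomial ((\<nu> ! (k + 1)) i - (\<nu> ! k) (i + 1))
                     ((\<nu> ! k) i - (\<nu> ! k) (i + 1))))"
proof -
  note F = flags_toD[OF assms]
  let ?B = "\<lambda>k. Prod_any (\<lambda>i. t_binomial ((\<nu> ! (k + 1)) i - (\<nu> ! k) (i + 1)) ((\<nu> ! k) i - (\<nu> ! k) (i + 1)))"
  have "flag_weight (length \<mu>) \<nu> = (\<Prod>k<length \<mu>.
      var_t ^ Sum_any (\<lambda>i. ((\<nu> ! (k + 1)) i - (\<nu> ! k) i) choose 2) * ?B k)"
    unfolding flag_weight_def
    by (rule prod.cong[OF refl]) (use F(2,5) pieri_h_eq_t_binomial in auto)
  also have "\<dots> = var_t ^ flag_exponent (length \<mu>) \<nu> * (\<Prod>k<length \<mu>. ?B k)"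
    by (simp add: prod.distrib power_sum flag_exponent_def)
  \<comment> \<open>The first member of a flag is empty, so at \<open>k = 0\<close> all lower
    indices are 0 and the binomials are 1. Hence the product may start at 1, while the exponent of
    \<open>t\<close> keeps its contribution from \<open>k = 0\<close>.\<close>
  also have "(\<Prod>k<length \<mu>. ?B k) = (\<Prod>k\<in>{1..<length \<mu>}. ?B k)"
  proof (rule prod.mono_neutral_right)
    have "?B 0 = 1" unfolding F(3) by (simp add: t_binomial_eq_gauss_binom)
    moreover have "k = 0" if "k \<in> {..<length \<mu>} - {1..<length \<mu>}" for k using that by auto
    ultimately show "\<forall>k\<in>{..<length \<mu>} - {1..<length \<mu>}. ?B k = 1" by metis
  qed auto
  finally show ?thesis .
qed

theorem theorem3p1:
  fixes lam :: "nat \<Rightarrow> nat" and \<mu> :: "nat list" and n :: nat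
  assumes "is_partition lam" and "psize lam = n" and "sum_list \<mu> = n"
  shows "(\<Sum>\<eta>\<in>partitions_of n. of_nat (kostka \<eta> \<mu>) * kostka_foulkes \<eta> lam) =
    (\<Sum>\<nu>\<in>flags lam \<mu>. var_t ^ flag_exponent (length \<mu>) \<nu> *
       (\<Prod>k\<in>{1..<length \<mu>}. Prod_any (\<lambda>i.
          t_binomial ((\<nu> ! (k + 1)) i - (\<nu> ! k) (i + 1))
                     ((\<nu> ! k) i - (\<nu> ! k) (i + 1)))))"
proof -
  \<comment> \<open>Both sides are formed for every partition \<open>q\<close> of \<open>n\<close>,
    since linear independence compares whole families of coefficients; the theorem is the entry at
    \<open>lam\<close>.\<close>
  define L where "L q = (\<Sum>\<eta>\<in>partitions_of n. of_nat (kostka \<eta> \<mu>) * kostka_foulkes \<eta> q)" for q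
  define R where "R q = (\<Sum>\<nu>\<in>flags_to (conjugate q) \<mu>. flag_weight (length \<mu>) \<nu>)" for q
  have 1: "(\<Sum>q\<in>partitions_of n. scalar (L q) * HLx N q) = (\<Prod>m\<leftarrow>\<mu>. hsym N var_x m)" for N
  proof -
    have "(\<Sum>q\<in>partitions_of n. scalar (L q) * HLx N q) =
      (\<Sum>\<eta>\<in>partitions_of n. of_nat (kostka \<eta> \<mu>) * (\<Sum>q\<in>partitions_of n. scalar (kostka_foulkes \<eta> q) * HLx N q))"
      unfolding L_def scalar_sum sum_distrib_left sum_distrib_right scalar_mult scalar_of_nat
      by (subst sum.swap) (simp add: mult_ac)
    also have "\<dots> = (\<Sum>\<eta>\<in>partitions_of n. of_nat (kostka \<eta> \<mu>) * schur N var_x \<eta>)"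
      by (rule sum.cong[OF refl]) (simp only: schur_eq_sum_kostka_foulkes)
    finally show ?thesis using prod_hsym_eq_schur[OF inj_var_x var_x_nz, of N \<mu>] assms(3) by simp
  qed
  have 2: "(\<Sum>q\<in>partitions_of n. scalar (R q) * HLx N q) = (\<Prod>m\<leftarrow>\<mu>. hsym N var_x m)" for N
  proof -
    have "(\<Prod>m\<leftarrow>\<mu>. hsym N var_x m) = (\<Sum>c\<in>partitions_of n. scalar (R (conjugate c)) * HLx N (conjugate c))"
      unfolding prod_hsym_eq_flags assms(3)
      by (rule sum.cong[OF refl]) (simp add: R_def conjugate_conjugate partitions_of_def)
    also have "\<dots> = (\<Sum>q\<in>partitions_of n. scalar (R q) * HLx N q)"
      by (rule sum_partitions_conjugate)
    finally show ?thesis by simp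
  qed
  have "L lam - R lam = 0"
  proof (rule hall_littlewood_independent[where Q = "partitions_of n" and K = "\<lambda>q. L q - R q"])
    show "(\<Sum>q\<in>partitions_of n. scalar (L q - R q) * HLx N q) = 0" for N
      using 1[of N] 2[of N] by (simp add: scalar_diff left_diff_distrib sum_subtractf)
  qed (use assms in \<open>auto simp: partitions_of_def finite_partitions_of[unfolded partitions_of_def]\<close>)
  moreover have "R lam = (\<Sum>\<nu>\<in>flags lam \<mu>. var_t ^ flag_exponent (length \<mu>) \<nu> *
       (\<Prod>k\<in>{1..<length \<mu>}. Prod_any (\<lambda>i.
          t_binomial ((\<nu> ! (k + 1)) i - (\<nu> ! k) (i + 1))
                     ((\<nu> ! k) i - (\<nu> ! k) (i + 1)))))"
    unfolding R_def flags_eq_flags_to by (rule sum.cong[OF refl]) (rule flag_weight_eq)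
  ultimately show ?thesis by (simp add: L_def)
qed

end
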